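(* Let $\Lambda$ be the function defined by $\Lambda(u)=u^2+\frac{u^4}{1-u}$. Let $t_n$ be the number of tree interval posets with $n$ minimal elements, and let $T(z)=\sum_{n\ge1}t_nz^n$ be the (ordinary) generating function of tree interval posets. The radius of convergence $\rho$ of $T(z)$ is given by $\rho=\tau-\Lambda(\tau)$, where $\tau$ is the unique solution of $\Lambda'(u)=1$ such that $\tau\in(0,1)$. The behavior of $T(z)$ near $\rho$ is given by \[ T(z)=\tau-\sqrt{\frac{2\rho}{\Lambda''(\tau)}}\sqrt{1-\frac{z}{\rho}}+\mathcal{O}\left(1-\frac{z}{\rho}\right). \] Numerically, $\tau\approx0.3501$, $\rho\approx0.2044$, $\sqrt{\frac{2\rho}{\Lambda''(\tau)}}\approx0.2808$. As a consequence, as $n\to\infty$, \[ t_n\sim\sqrt{\frac{\rho}{2\pi\Lambda''(\tau)}}\,\frac{\rho^{-n}}{n^{3/2}}. \] Numerically, $\sqrt{\frac{\rho}{2\pi\Lambda''(\tau)}}\approx0.0792$ and $\rho^{-1}\approx4.8920$.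
   Context: A permutation $\sigma=\sigma(1)\dots\sigma(n)$ of size $n$ is a word on $\{1,\dots,n\}$ containing each letter exactly once. A non-empty interval of $\sigma$ is a set of values $[j,j+h]=\{j,\dots,j+h\}$ such that $\{\sigma(i),\dots,\sigma(i+h)\}=[j,j+h]$ for some $i$. $P(\sigma)$ is the poset of all non-empty intervals of $\sigma$ (including singletons and $[1,n]$, excluding the empty set) ordered by inclusion. An interval poset is a poset of the form $P(\sigma)$; two interval posets are equal (counted once) when they are equal as sets of intervals ordered by inclusion (not merely isomorphic). $P(\sigma)$ has $n$ minimal elements (the singletons) exactly when $\sigma$ has size $n$. A tree interval poset is an interval poset $P(\sigma)$ whose Hasse diagram (the graph of covering relations) is a tree. *)

theory Defs
  imports
    "HOL-Complex_Analysis.Complex_Analysis"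
    "HOL-Combinatorics.Permutations"
    "HOL-Library.Landau_Symbols"
begin

(* The non-empty intervals of the permutation sigma of size n, as sets of values. *)
definition perm_intervals :: "nat \<Rightarrow> (nat \<Rightarrow> nat) \<Rightarrow> nat set set" where
  "perm_intervals n \<sigma> =
     {I. \<exists>i j h. 1 \<le> i \<and> i + h \<le> n \<and> I = {j..j + h} \<and> \<sigma> ` {i..i + h} = I}"

(* The order is always inclusion, so a poset of intervals is given by its set of elements and
   equality of sets is the notion of equality used for counting. *)
definition interval_poset :: "nat set set \<Rightarrow> bool" where
  "interval_poset P \<longleftrightarrow>
     (\<exists>n \<sigma>. 1 \<le> n \<and> \<sigma> permutes {1..n} \<and> P = perm_intervals n \<sigma>)"

definition minimal_elements :: "'a set set \<Rightarrow> 'a set set" where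
  "minimal_elements P = {A \<in> P. \<not> (\<exists>B\<in>P. B \<subset> A)}"

definition covers_in :: "'a set set \<Rightarrow> 'a set \<Rightarrow> 'a set \<Rightarrow> bool" where
  "covers_in P A B \<longleftrightarrow> A \<in> P \<and> B \<in> P \<and> A \<subset> B \<and> \<not> (\<exists>C\<in>P. A \<subset> C \<and> C \<subset> B)"

(* Adjacency in the Hasse diagram, seen as an undirected graph with vertex set P. *)
definition hasse_adj :: "'a set set \<Rightarrow> 'a set \<Rightarrow> 'a set \<Rightarrow> bool" where
  "hasse_adj P A B \<longleftrightarrow> covers_in P A B \<or> covers_in P B A"

(* Trees in the sense of simple undirected graphs, given by a vertex set V and a symmetric
   irreflexive adjacency relation on V: non-empty, connected, without a cycle of length at
   least 3.  The constant "tree" of the AFP entry Graph_Theory is not usable here, since it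
   forbids only directed cycles: it accepts the diagram of a diamond when edges are oriented,
   and rejects every edge when they are made symmetric. *)
definition is_tree :: "'v set \<Rightarrow> ('v \<Rightarrow> 'v \<Rightarrow> bool) \<Rightarrow> bool" where
  "is_tree V adj \<longleftrightarrow>
     V \<noteq> {} \<and>
     (\<forall>x\<in>V. \<forall>y\<in>V. adj\<^sup>*\<^sup>* x y) \<and>
     \<not> (\<exists>xs. 3 \<le> length xs \<and> distinct xs \<and> set xs \<subseteq> V \<and>
             successively adj xs \<and> adj (last xs) (hd xs))"

definition tree_interval_poset :: "nat set set \<Rightarrow> bool" where
  "tree_interval_poset P \<longleftrightarrow> interval_poset P \<and> is_tree P (hasse_adj P)"

definition num_tree_posets :: "nat \<Rightarrow> nat" where
  "num_tree_posets n = card {P. tree_interval_poset P \<and> card (minimal_elements P) = n}"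

definition tree_gf :: "complex fps" where
  "tree_gf = Abs_fps (\<lambda>n. if 1 \<le> n then of_nat (num_tree_posets n) else 0)"

definition Lam :: "real \<Rightarrow> real" where
  "Lam u = u ^ 2 + u ^ 4 / (1 - u)"

definition tau :: real where
  "tau = (THE u. u \<in> {0<..<1} \<and> deriv Lam u = 1)"

definition rho :: real where
  "rho = tau - Lam tau"

(* A disc around rho, slit along the ray from rho to infinity.  The slit is the branch cut of
   csqrt (1 - z / rho), where csqrt is the principal branch. *)
definition slit_disc :: "real \<Rightarrow> complex set" where
  "slit_disc \<epsilon> = ball (of_real rho) \<epsilon> - of_real ` {rho..}"

end

theory Submission
  imports Defs "HOL-Probability.Distributions" "HOL-Real_Asymp.Real_Asymp"
begin

text \<open>
  A tree interval poset is a set of intervals of \<open>{1..n}\<close> that contains the singletons and the whole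
  interval.  If its Hasse diagram is a tree, every element has at most one cover, so the family is
  laminar and is the family of vertices of a plane tree with \<open>n\<close> leaves.  A permutation of three
  blocks always has a pair of blocks that are neighbours in value and in position, so no vertex has
  exactly three children.  These are the only restrictions: every plane tree with arities 2 and
  at least 4 is realised, by inflating a simple permutation at every vertex
  (\<open>fam_realizable\<close>; the interval families are matched with trees in
  \<open>num_tree_posets_eq_card_trees\<close>).  Consequently \<open>T = z + \<Lambda>(T)\<close>, that is, \<open>\<psi>(T) = z\<close> for
  \<open>\<psi>(u) = u - \<Lambda>(u)\<close>.

  The asymptotics come directly from Lagrange inversion rather than from a transfer theorem.
  Lagrange inversion and Cauchy's formula give
  \<open>t\<^sub>n = 1 / (2 * \<pi> * \<i> * n) * \<integral> \<psi>(u)\<^sup>-\<^sup>n du\<close> over the circle \<open>|u| = \<tau>\<close> (\<open>card_trees_integral\<close>).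
  On this circle \<open>|\<psi>|\<close> has its minimum \<open>\<rho>\<close> exactly at \<open>\<tau>\<close>, with a quadratic lower bound
  (\<open>norm_psi_circle_ge\<close>), because \<open>\<Lambda>\<close> has nonnegative coefficients and a nonzero coefficient of
  \<open>u\<^sup>2\<close>; since \<open>\<psi>'(\<tau>) = 0\<close>, Laplace's method (\<open>laplace_method\<close>) evaluates the
  integral.  The radius of convergence is then read off from the ratio of consecutive coefficients.

  For the behaviour at \<open>\<rho>\<close>, the function \<open>\<rho> - \<psi>\<close> has a double zero at \<open>\<tau>\<close>, hence a holomorphic
  square root with a nonzero derivative there.  Its inverse function, applied to the square root of
  \<open>\<rho> - z\<close>, continues \<open>T\<close> to a slit disc and gives the expansion
  (\<open>tree_gf_local_expansion\<close>).
\<close>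

section \<open>Plane trees and their interval families\<close>

datatype ptree = Leaf | Node "ptree list"

fun leaves :: "ptree \<Rightarrow> nat" where
  "leaves Leaf = 1"
| "leaves (Node ts) = sum_list (map leaves ts)"

abbreviation width :: "ptree list \<Rightarrow> nat" where
  "width ts \<equiv> sum_list (map leaves ts)"

text \<open>The admissible arities are those of the simple permutations of size above 1, namely 2 and all numbers
  from 4 on: a node of arity at least 4 stands for a simple permutation and a binary node for a sum
  or a skew sum.  Longer sums have overlapping intervals, and there is no simple permutation of
  size 3.\<close>

fun admissible :: "ptree \<Rightarrow> bool" where
  "admissible Leaf \<longleftrightarrow> True"
| "admissible (Node ts) \<longleftrightarrow>
     (length ts = 2 \<or> 4 \<le> length ts) \<and> (\<forall>t\<in>set ts. admissible t)"

text \<open>For leaves numbered from left to right, starting with \<open>a\<close>: the sets of leaves below the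
  vertices of a tree or of a forest.\<close>

function fam :: "nat \<Rightarrow> ptree \<Rightarrow> nat set set"
  and fams :: "nat \<Rightarrow> ptree list \<Rightarrow> nat set set" where
  "fam a Leaf = {{a}}"
| "fam a (Node ts) = insert {a..<a + width ts} (fams a ts)"
| "fams a [] = {}"
| "fams a (t # ts) = fam a t \<union> fams (a + leaves t) ts"
  by pat_completeness auto
termination
  by (relation "Wellfounded.measure (\<lambda>x. case x of Inl (a, t) \<Rightarrow> size t | Inr (a, ts) \<Rightarrow> size_list size ts)")
    auto

lemma leaves_pos: "admissible t \<Longrightarrow> 0 < leaves t"
proof (induction t)
  case (Node ts)
  then have "ts \<noteq> []" by auto
  then obtain u us where "ts = u # us" by (cases ts) auto
  with Node show ?case by auto
qed auto

lemma root_in_fam: "{a..<a + leaves t} \<in> fam a t"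
  by (cases t) (auto simp: atLeastLessThanSuc)

lemma fam_bounds:
  "admissible t \<Longrightarrow> I \<in> fam a t \<Longrightarrow>
     \<exists>c d. I = {c..<d} \<and> a \<le> c \<and> c < d \<and> d \<le> a + leaves t"
  "\<forall>t\<in>set ts. admissible t \<Longrightarrow> I \<in> fams a ts \<Longrightarrow>
     \<exists>c d. I = {c..<d} \<and> a \<le> c \<and> c < d \<and> d \<le> a + width ts"
proof (induction a t and a ts arbitrary: I and I rule: fam_fams.induct)
  case (1 a)
  then show ?case by (intro exI[of _ a] exI[of _ "Suc a"]) auto
next
  case (2 a ts)
  have "0 < width ts" using leaves_pos[OF 2(2)] by simp
  with 2 show ?case by fastforce
next
  case (3 a)
  then show ?case by simp
next
  case (4 a t ts)
  show ?case
  proof (cases "I \<in> fam a t")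
    case True
    with 4(1)[of I] 4(3) show ?thesis by fastforce
  next
    case False
    with 4(4) have "I \<in> fams (a + leaves t) ts" by simp
    with 4(2)[of I] 4(3) show ?thesis by fastforce
  qed
qed

lemma fam_subset: "admissible t \<Longrightarrow> I \<in> fam a t \<Longrightarrow> I \<subseteq> {a..<a + leaves t}"
  using fam_bounds(1)[of t I a] by auto

lemma fams_subset:
  "\<forall>t\<in>set ts. admissible t \<Longrightarrow> I \<in> fams a ts \<Longrightarrow> I \<subseteq> {a..<a + width ts}"
  using fam_bounds(2)[of ts I a] by auto

lemma singleton_in_fam:
  "admissible t \<Longrightarrow> x \<in> {a..<a + leaves t} \<Longrightarrow> {x} \<in> fam a t"
  "\<forall>t\<in>set ts. admissible t \<Longrightarrow> x \<in> {a..<a + width ts} \<Longrightarrow> {x} \<in> fams a ts"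
proof (induction a t and a ts rule: fam_fams.induct)
  case (4 a t ts)
  then show ?case by (cases "x < a + leaves t") auto
qed auto

lemma fam_nonempty: "admissible t \<Longrightarrow> {} \<notin> fam a t"
  using fam_bounds(1)[of t "{}" a] by force

lemma fam_laminar:
  "admissible t \<Longrightarrow> I \<in> fam a t \<Longrightarrow> J \<in> fam a t \<Longrightarrow> I \<subseteq> J \<or> J \<subseteq> I \<or> I \<inter> J = {}"
  "\<forall>t\<in>set ts. admissible t \<Longrightarrow> I \<in> fams a ts \<Longrightarrow> J \<in> fams a ts \<Longrightarrow>
     I \<subseteq> J \<or> J \<subseteq> I \<or> I \<inter> J = {}"
proof (induction a t and a ts rule: fam_fams.induct)
  case (2 a ts)
  then show ?case using fams_subset[of ts _ a] by simp blast
next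
  case (4 a t ts)
  have *: "X \<inter> Y = {}" if "X \<in> fam a t" "Y \<in> fams (a + leaves t) ts" for X Y
    using fam_subset[OF _ that(1)] fams_subset[OF _ that(2)] 4(3) by fastforce
  show ?case using 4 *[of I J] *[of J I] by auto
qed auto

text \<open>A node with at least two children covers strictly more leaves than each of them.\<close>

lemma root_notin_fams:
  assumes "\<forall>t\<in>set ts. admissible t" "length ts \<noteq> 1" "ts \<noteq> []"
  shows "{a..<a + width ts} \<notin> fams a ts"
proof
  assume *: "{a..<a + width ts} \<in> fams a ts"
  obtain t u us where ts: "ts = t # u # us"
    using assms(2,3) by (cases ts rule: list.exhaust; cases "tl ts") auto
  have pos: "0 < leaves t" "0 < leaves u" using assms(1) leaves_pos by (auto simp: ts)
  consider "{a..<a + width ts} \<in> fam a t"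
    | "{a..<a + width ts} \<in> fams (a + leaves t) (u # us)"
    using * unfolding ts by auto
  then show False
  proof cases
    case 1
    then have "{a..<a + width ts} \<subseteq> {a..<a + leaves t}"
      using fam_subset assms(1) unfolding ts by (metis list.set_intros(1))
    with pos show False by (auto simp: ts)
  next
    case 2
    then have "{a..<a + width ts} \<subseteq> {a + leaves t..<a + leaves t + width (u # us)}"
      using fams_subset[of "u # us"] assms(1) unfolding ts by (metis list.set_intros(2))
    with pos show False by (auto simp: ts)
  qed
qed

lemma Union_fams:
  assumes "\<forall>t\<in>set ts. admissible t"
  shows "\<Union> (fams a ts) = {a..<a + width ts}"
  using fams_subset[OF assms] singleton_in_fam(2)[OF assms] by blast

text \<open>The first root of a forest can be read off as the largest interval of the family that starts
  at the left end; the rest of the family splits into what lies below this root and what lies to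
  its right.\<close>

lemma fam_inj:
  "admissible t \<Longrightarrow> admissible u \<Longrightarrow> fam a t = fam a u \<Longrightarrow> t = u"
  "\<forall>t\<in>set ts. admissible t \<Longrightarrow> \<forall>t\<in>set us. admissible t \<Longrightarrow> fams a ts = fams a us \<Longrightarrow>
     ts = us"
proof (induction a t and a ts arbitrary: u and us rule: fam_fams.induct)
  case (1 a)
  show ?case
  proof (cases u)
    case (Node us)
    have "length us = 2 \<or> 4 \<le> length us" using 1 Node by simp
    then have *: "length us \<noteq> 1" "us \<noteq> []" by auto
    have adm: "\<forall>t\<in>set us. admissible t" using 1 Node by auto
    have "{a..<a + width us} \<notin> fams a us" using root_notin_fams adm * by blast
    moreover have "{a..<a + width us} = {a}" using 1(3) Node by auto
    moreover have "{a} \<in> fams a us"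
      using singleton_in_fam(2)[OF adm, of a a] leaves_pos[OF 1(2)] Node by simp
    ultimately show ?thesis by simp
  qed simp
next
  case (2 a ts)
  have adm: "\<forall>t\<in>set ts. admissible t" and l: "length ts \<noteq> 1" "ts \<noteq> []" using 2(2) by auto
  show ?case
  proof (cases u)
    case Leaf
    have "{a..<a + width ts} \<notin> fams a ts" using root_notin_fams adm l by blast
    moreover have "{a..<a + width ts} = {a}" using 2(4) Leaf by auto
    moreover have "{a} \<in> fams a ts"
      using singleton_in_fam(2)[OF adm, of a a] leaves_pos[OF 2(2)] by simp
    ultimately show ?thesis by simp
  next
    case (Node us)
    have adm': "\<forall>t\<in>set us. admissible t" and l': "length us \<noteq> 1" "us \<noteq> []"
      using 2(3) Node by auto
    have U: "\<Union> (fam a (Node xs)) = {a..<a + width xs}"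
      if "\<forall>t\<in>set xs. admissible t" for xs using Union_fams[OF that, of a] by simp
    have "{a..<a + width ts} = {a..<a + width us}"
      using arg_cong[OF 2(4), of Union] unfolding Node U[OF adm] U[OF adm'] .
    then have "fams a ts = fams a us"
      using 2(4) Node root_notin_fams[OF adm l, of a] root_notin_fams[OF adm' l', of a]
      by (simp add: insert_ident)
    then show ?thesis using 2(1)[of us] adm adm' Node by simp
  qed
next
  case (3 a)
  then show ?case
  proof (cases us)
    case (Cons t ts)
    then show ?thesis using 3 root_in_fam[of a t] by auto
  qed simp
next
  case (4 a t ts)
  have adm: "admissible t" "\<forall>t\<in>set ts. admissible t" using 4(3) by auto
  obtain u us' where us: "us = u # us'"
    using 4(5) root_in_fam[of a t] by (cases us) auto
  have adm': "admissible u" "\<forall>t\<in>set us'. admissible t" using 4(4) us by auto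
  have not_lt: "\<not> leaves x < leaves y"
    if adm: "admissible x" "admissible y" "\<forall>t\<in>set xs. admissible t"
      and eq: "fams a (x # xs) = fams a (y # ys)" for x y xs ys
  proof
    assume lt: "leaves x < leaves y"
    have "{a..<a + leaves y} \<in> fams a (x # xs)" unfolding eq using root_in_fam[of a y] by simp
    then consider "{a..<a + leaves y} \<in> fam a x" | "{a..<a + leaves y} \<in> fams (a + leaves x) xs"
      by auto
    then show False
    proof cases
      case 1
      from fam_subset[OF adm(1) 1] lt show False by auto
    next
      case 2
      from fams_subset[OF adm(3) 2] lt leaves_pos[OF adm(1)] show False by auto
    qed
  qed
  have eq: "leaves t = leaves u"
    using not_lt[of t u ts us'] not_lt[of u t us' ts] adm adm' 4(5) us by auto
  have *: "fam a x = {I \<in> fams a (x # xs). I \<subseteq> {a..<a + leaves x}}"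
       "fams (a + leaves x) xs = {I \<in> fams a (x # xs). \<not> I \<subseteq> {a..<a + leaves x}}"
    if "admissible x" "\<forall>t\<in>set xs. admissible t" for x xs
  proof -
    have 1: "I \<subseteq> {a..<a + leaves x}" if "I \<in> fam a x" for I
      using fam_subset that \<open>admissible x\<close> by blast
    have 2: "\<not> I \<subseteq> {a..<a + leaves x}" if "I \<in> fams (a + leaves x) xs" for I
      using fam_bounds(2)[OF \<open>\<forall>t\<in>set xs. admissible t\<close> that] by fastforce
    show "fam a x = {I \<in> fams a (x # xs). I \<subseteq> {a..<a + leaves x}}"
       "fams (a + leaves x) xs = {I \<in> fams a (x # xs). \<not> I \<subseteq> {a..<a + leaves x}}"
      using 1 2 by auto
  qed
  have "fam a t = fam a u"
    unfolding *(1)[OF adm] *(1)[OF adm'] 4(5) us eq by (rule refl)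
  have "fams (a + leaves t) ts = {I \<in> fams a (t # ts). \<not> I \<subseteq> {a..<a + leaves t}}"
    by (rule *(2)[OF adm])
  also have "\<dots> = {I \<in> fams a (u # us'). \<not> I \<subseteq> {a..<a + leaves u}}" by (simp only: 4(5) us eq)
  also have "\<dots> = fams (a + leaves u) us'" by (rule *(2)[OF adm', symmetric])
  finally have "fams (a + leaves t) ts = fams (a + leaves t) us'" by (simp only: eq)
  with \<open>fam a t = fam a u\<close> show ?case using 4(1)[of u] 4(2)[of us'] adm adm' us by simp
qed

text \<open>The same splitting, at the largest member that starts at the left end, builds a forest from
  any laminar family.  The closure condition on three neighbouring members and their union is what
  rules out nodes with three children: it produces a member that contains exactly two of them.\<close>

lemma laminar_family_is_fams:
  assumes "\<And>I. I \<in> F \<Longrightarrow> \<exists>c d. I = {c..<d} \<and> a \<le> c \<and> c < d \<and> d \<le> b"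
    and "\<And>x. x \<in> {a..<b} \<Longrightarrow> {x} \<in> F"
    and "\<And>I J. I \<in> F \<Longrightarrow> J \<in> F \<Longrightarrow> I \<subseteq> J \<or> J \<subseteq> I \<or> I \<inter> J = {}"
    and "\<And>c d e f. {c..<d} \<in> F \<Longrightarrow> {d..<e} \<in> F \<Longrightarrow> {e..<f} \<in> F \<Longrightarrow> {c..<f} \<in> F \<Longrightarrow>
           {c..<e} \<in> F \<or> {d..<f} \<in> F"
    and "a \<le> b"
  shows "\<exists>ts. (\<forall>t\<in>set ts. admissible t) \<and> fams a ts = F \<and> a + width ts = b"
proof -
  have fin: "finite F" if ivl: "\<And>I. I \<in> F \<Longrightarrow> \<exists>c d. I = {c..<d} \<and> a \<le> c \<and> c < d \<and> d \<le> b"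
    for F :: "nat set set" and a b
  proof (rule finite_subset)
    show "F \<subseteq> Pow {..<b}"
    proof
      fix I assume "I \<in> F"
      then obtain c d where "I = {c..<d}" "d \<le> b" using ivl by meson
      then show "I \<in> Pow {..<b}" by auto
    qed
  qed auto
  show ?thesis using assms
  proof (induction "card F" arbitrary: F a b rule: less_induct)
    case less
    note ivl = less.prems(1) and sing = less.prems(2) and lam = less.prems(3)
      and tern = less.prems(4)
    have finF: "finite F" using fin[OF ivl] .
    show ?case
    proof (cases "a = b")
      case True
      then have "F = {}" using ivl by fastforce
      then show ?thesis using True by (intro exI[of _ "[]"]) simp
    next
      case False
      then have "a < b" using less.prems(5) by simp
      \<comment> \<open>\<open>{a..<c}\<close> will be the first root.\<close>
      define C where "C = {c. a < c \<and> {a..<c} \<in> F}"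
      have "{a..<Suc a} \<in> F" using sing[of a] \<open>a < b\<close> by simp
      then have "Suc a \<in> C" by (simp add: C_def)
      have Cb: "c \<le> b" if "c \<in> C" for c
        using ivl[of "{a..<c}"] that unfolding C_def by fastforce
      have finC: "finite C" using Cb by (meson finite_nat_set_iff_bounded_le)
      define c where "c = Max C"
      have "c \<in> C" using Max_in[OF finC] \<open>Suc a \<in> C\<close> unfolding c_def by blast
      then have c: "a < c" "{a..<c} \<in> F" "c \<le> b" using Cb by (auto simp: C_def)
      have cmax: "c' \<le> c" if "{a..<c'} \<in> F" "a < c'" for c'
        using Max_ge[OF finC, of c'] that by (simp add: c_def C_def)
      define L where "L = {I \<in> F. I \<subseteq> {a..<c}}"
      define R where "R = {I \<in> F. I \<subseteq> {c..<b}}"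
      have F: "F = L \<union> R"
      proof -
        have "I \<in> L \<union> R" if I: "I \<in> F" for I
        proof -
          obtain x y where xy: "I = {x..<y}" "a \<le> x" "x < y" "y \<le> b" using ivl[OF I] by blast
          consider "I \<subseteq> {a..<c}" | "{a..<c} \<subseteq> I" | "I \<inter> {a..<c} = {}"
            using lam[OF I c(2)] by blast
          then show ?thesis
          proof cases
            case 2
            then have "x = a" using xy c by auto
            then have "y \<le> c" using cmax[of y] xy I by simp
            then show ?thesis using \<open>x = a\<close> I xy by (auto simp: L_def)
          next
            case 3
            then have "c \<le> x" using xy c by (metis IntI atLeastLessThan_iff empty_iff le_refl not_le)
            then show ?thesis using I xy by (auto simp: R_def)
          qed (use I in \<open>auto simp: L_def\<close>)
        qed
        then show ?thesis by (auto simp: L_def R_def)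
      qed
      have RivI: "\<exists>x y. I = {x..<y} \<and> c \<le> x \<and> x < y \<and> y \<le> b" if "I \<in> R" for I
        using ivl[of I] that unfolding R_def by fastforce
      have LivI: "\<exists>x y. I = {x..<y} \<and> a \<le> x \<and> x < y \<and> y \<le> c" if "I \<in> L" for I
        using ivl[of I] that unfolding L_def by fastforce
      have "{a..<c} \<notin> R" using c RivI[of "{a..<c}"] by fastforce
      have "R \<subset> F" using F \<open>{a..<c} \<notin> R\<close> c by auto
      then have cR: "card R < card F" using finF psubset_card_mono by blast
      have "\<exists>ts. (\<forall>t\<in>set ts. admissible t) \<and> fams c ts = R \<and> c + width ts = b"
      proof (rule less.hyps[OF cR])
        fix w x y z assume *: "{w..<x} \<in> R" "{x..<y} \<in> R" "{y..<z} \<in> R" "{w..<z} \<in> R"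
        then have "{w..<y} \<in> F \<or> {x..<z} \<in> F" using tern[of w x y z] F by blast
        moreover have "w < x" "x < y" "y < z"
          using * RivI by (metis atLeastLessThan_empty_iff2 linorder_not_le)+
        then have "{w..<y} \<subseteq> {w..<z}" "{x..<z} \<subseteq> {w..<z}" by auto
        moreover have "{w..<z} \<subseteq> {c..<b}" using *(4) by (simp add: R_def)
        ultimately show "{w..<y} \<in> R \<or> {x..<z} \<in> R" unfolding R_def by blast
      next
        fix x assume "x \<in> {c..<b}"
        then show "{x} \<in> R" using sing[of x] c by (auto simp: R_def)
      qed (use RivI lam c in \<open>auto simp: R_def\<close>)
      then obtain ts where ts: "\<forall>t\<in>set ts. admissible t" "fams c ts = R" "c + width ts = b"
        by blast
      have "\<exists>t. admissible t \<and> fam a t = L \<and> a + leaves t = c"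
      proof (cases "c = Suc a")
        case True
        have "L = {{a}}"
        proof -
          have "I = {a}" if "I \<in> L" for I
            using LivI[OF that] True by fastforce
          moreover have "{a} \<in> L" using c True by (simp add: L_def)
          ultimately show ?thesis by blast
        qed
        then show ?thesis using True by (intro exI[of _ Leaf]) simp
      next
        case False
        define L' where "L' = L - {{a..<c}}"
        have topL: "{a..<c} \<in> L" using c by (simp add: L_def)
        have "L' \<subset> F" using F c by (auto simp: L'_def)
        then have cL: "card L' < card F" using finF psubset_card_mono by blast
        have tern': "{w..<y} \<in> L' \<or> {x..<z} \<in> L'"
          if *: "{w..<x} \<in> L" "{x..<y} \<in> L" "{y..<z} \<in> L" "{w..<z} \<in> L" for w x y z
        proof -
          have "{w..<y} \<in> F \<or> {x..<z} \<in> F" using tern[of w x y z] F * by blast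
          moreover have "w < x" "x < y" "y < z"
            using * LivI by (metis atLeastLessThan_empty_iff2 linorder_not_le)+
          then have "{w..<y} \<subset> {w..<z}" "{x..<z} \<subset> {w..<z}"
            by (auto simp: psubset_eq atLeastLessThan_eq_iff)
          moreover have "{w..<z} \<subseteq> {a..<c}" using *(4) by (simp add: L_def)
          ultimately show ?thesis unfolding L'_def L_def by blast
        qed
        have "\<exists>ts. (\<forall>t\<in>set ts. admissible t) \<and> fams a ts = L' \<and> a + width ts = c"
        proof (rule less.hyps[OF cL])
          fix w x y z assume "{w..<x} \<in> L'" "{x..<y} \<in> L'" "{y..<z} \<in> L'" "{w..<z} \<in> L'"
          then show "{w..<y} \<in> L' \<or> {x..<z} \<in> L'" using tern' by (simp add: L'_def)
        next
          fix x assume x: "x \<in> {a..<c}"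
          then have "{x} \<in> L" using sing[of x] c by (auto simp: L_def)
          moreover have "{x} \<noteq> {a..<c}"
          proof
            assume "{x} = {a..<c}"
            moreover have "a \<in> {a..<c}" "Suc a \<in> {a..<c}" using False c by auto
            ultimately show False by (metis n_not_Suc_n singletonD)
          qed
          ultimately show "{x} \<in> L'" by (simp add: L'_def)
        qed (use LivI lam c in \<open>auto simp: L'_def L_def\<close>)
        then obtain us where us: "\<forall>t\<in>set us. admissible t" "fams a us = L'" "a + width us = c"
          by blast
        have "us \<noteq> []" using us(3) c by auto
        moreover have "length us \<noteq> 1"
        proof
          assume "length us = 1"
          then obtain u where "us = [u]" by (metis One_nat_def length_0_conv length_Suc_conv)
          then have "{a..<c} \<in> L'" using us root_in_fam[of a u] by auto
          then show False by (simp add: L'_def)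
        qed
        moreover have "length us \<noteq> 3"
        proof
          assume "length us = 3"
          then obtain u v w where us3: "us = [u, v, w]"
            by (auto simp: numeral_3_eq_3 length_Suc_conv)
          define x where "x = a + leaves u"
          define y where "y = x + leaves v"
          have c': "c = y + leaves w" using us(3) us3 by (simp add: x_def y_def)
          have adm: "admissible u" "admissible v" "admissible w" using us(1) us3 by auto
          have L': "L' = fam a u \<union> fam x v \<union> fam y w"
            using us(2) us3 by (auto simp: x_def y_def add.assoc)
          have "{a..<x} \<in> L" "{x..<y} \<in> L" "{y..<c} \<in> L"
            using root_in_fam[of a u] root_in_fam[of x v] root_in_fam[of y w] L' c'
            by (auto simp: x_def y_def L'_def)
          then have "{a..<y} \<in> L' \<or> {x..<c} \<in> L'" using tern' topL by blast
          moreover have "a < x" "x < y" "y < c"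
            using leaves_pos adm by (auto simp: x_def y_def c')
          ultimately show False
            using fam_bounds(1)[OF adm(1), of "{a..<y}" a] fam_bounds(1)[OF adm(2), of "{a..<y}" x]
              fam_bounds(1)[OF adm(3), of "{a..<y}" y] fam_bounds(1)[OF adm(1), of "{x..<c}" a]
              fam_bounds(1)[OF adm(2), of "{x..<c}" x] fam_bounds(1)[OF adm(3), of "{x..<c}" y]
            unfolding L' x_def[symmetric] y_def[symmetric] c'[symmetric]
            by (auto simp: atLeastLessThan_eq_iff) 
        qed
        ultimately have "length us = 2 \<or> 4 \<le> length us"
          using length_0_conv[of us] by linarith
        then have "admissible (Node us)" using us(1) by simp
        moreover have "fam a (Node us) = L" using us topL by (auto simp: L'_def)
        ultimately show ?thesis using us(3) by (intro exI[of _ "Node us"]) simp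
      qed
      then obtain t where t: "admissible t" "fam a t = L" "a + leaves t = c" by blast
      show ?thesis
        using t ts F by (intro exI[of _ "t # ts"]) auto
    qed
  qed
qed

section \<open>Interval families whose Hasse diagram is a tree\<close>

lemma exists_cover_below:
  fixes P :: "'a set set"
  assumes "finite P" "A \<in> P" "K \<in> P" "A \<subset> K"
  shows "\<exists>C. covers_in P A C \<and> C \<subseteq> K"
proof -
  let ?S = "{X \<in> P. A \<subset> X \<and> X \<subseteq> K}"
  have "finite ?S" "?S \<noteq> {}" using assms by auto
  then obtain D where D: "D \<in> ?S" and Dmin: "\<forall>X\<in>?S. X \<subseteq> D \<longrightarrow> D = X"
    using finite_has_minimal by meson
  have "\<not> (A \<subset> X \<and> X \<subset> D)" if "X \<in> P" for X
  proof
    assume X: "A \<subset> X \<and> X \<subset> D"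
    then have "X \<in> ?S" using D that by auto
    then show False using Dmin X by auto
  qed
  then have "covers_in P A D" using D assms(2) unfolding covers_in_def by simp
  then show ?thesis using D by auto
qed

lemma ascending_chain_to_top:
  fixes P :: "'a set set"
  assumes "finite P" "C \<in> P" "T \<in> P" "\<And>A. A \<in> P \<Longrightarrow> A \<subseteq> T"
  shows "\<exists>xs. xs \<noteq> [] \<and> hd xs = C \<and> last xs = T \<and> set xs \<subseteq> P \<and>
           successively (covers_in P) xs \<and> sorted_wrt (\<subset>) xs"
  using assms(2)
proof (induction "card {X \<in> P. C \<subset> X}" arbitrary: C rule: less_induct)
  case less
  show ?case
  proof (cases "C = T")
    case True
    then show ?thesis using less.prems by (intro exI[of _ "[C]"]) auto
  next
    case False
    then have "C \<subset> T" using assms(4)[OF less.prems] by auto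
    then obtain D where cov: "covers_in P C D"
      using exists_cover_below[OF assms(1) less.prems assms(3)] by auto
    then have D: "D \<in> P" "C \<subset> D" by (auto simp: covers_in_def)
    have "{X \<in> P. D \<subset> X} \<subset> {X \<in> P. C \<subset> X}" using D by auto
    then have "card {X \<in> P. D \<subset> X} < card {X \<in> P. C \<subset> X}"
      using assms(1) by (intro psubset_card_mono) auto
    from less.hyps[OF this D(1)] obtain xs where
      xs: "xs \<noteq> []" "hd xs = D" "last xs = T" "set xs \<subseteq> P" "successively (covers_in P) xs"
        "sorted_wrt (\<subset>) xs" by blast
    have "C \<subset> X" if "X \<in> set xs" for X
    proof -
      obtain ys where "xs = D # ys" using xs(1,2) by (cases xs) auto
      then show ?thesis using that xs(6) D by auto
    qed
    then have "sorted_wrt (\<subset>) (C # xs)" using xs(6) by simp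
    moreover have "successively (covers_in P) (C # xs)"
      using xs(1,2,5) cov by (cases xs) auto
    ultimately show ?thesis using xs less.prems by (intro exI[of _ "C # xs"]) auto
  qed
qed

lemma sorted_wrt_psubset_distinct: "sorted_wrt (\<subset>) xs \<Longrightarrow> distinct xs"
  for xs :: "'a set list"
  by (induction xs) auto

text \<open>Two saturated chains that leave \<open>A\<close> through different covers and end at the greatest element
  close up to a cycle at their first common point.\<close>

lemma tree_imp_unique_cover:
  fixes P :: "'a set set"
  assumes "finite P" "T \<in> P" "\<And>A. A \<in> P \<Longrightarrow> A \<subseteq> T" "is_tree P (hasse_adj P)"
    and "covers_in P A C" "covers_in P A D"
  shows "C = D"
proof (rule ccontr)
  assume "C \<noteq> D"
  have inP: "A \<in> P" "C \<in> P" "D \<in> P" "A \<subset> C" "A \<subset> D" using assms(5,6) by (auto simp: covers_in_def)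
  obtain xs where xs: "xs \<noteq> []" "hd xs = C" "last xs = T" "set xs \<subseteq> P"
      "successively (covers_in P) xs" "sorted_wrt (\<subset>) xs"
    using ascending_chain_to_top[OF assms(1) inP(2) assms(2,3)] by blast
  obtain ys where ys: "ys \<noteq> []" "hd ys = D" "last ys = T" "set ys \<subseteq> P"
      "successively (covers_in P) ys" "sorted_wrt (\<subset>) ys"
    using ascending_chain_to_top[OF assms(1) inP(3) assms(2,3)] by blast
  have above: "A \<notin> set zs" if "zs \<noteq> []" "A \<subset> hd zs" "sorted_wrt (\<subset>) zs" for zs
    using that by (cases zs) auto
  have "\<exists>m\<in>set xs. m \<in> set ys" using xs ys by (metis last_in_set)
  then obtain xs1 m xs2 where m: "xs = xs1 @ m # xs2" "m \<in> set ys" "\<forall>x\<in>set xs1. x \<notin> set ys"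
    using split_list_first_prop[of xs "\<lambda>x. x \<in> set ys"] by blast
  obtain ys1 ys2 where y: "ys = ys1 @ m # ys2" using m(2) by (meson split_list)
  define zs where "zs = A # xs1 @ m # rev ys1"
  let ?adj = "hasse_adj P"
  have "successively ?adj xs" by (rule successively_mono[OF xs(5)]) (simp add: hasse_adj_def)
  then have "successively ?adj (xs1 @ [m])"
    unfolding m(1) by (auto simp: successively_append_iff)
  moreover have "successively (\<lambda>x y. ?adj y x) ys"
    by (rule successively_mono[OF ys(5)]) (simp add: hasse_adj_def)
  then have "successively ?adj (rev (ys1 @ [m]))"
    unfolding successively_rev y by (auto simp: successively_append_iff)
  ultimately have "successively ?adj (xs1 @ m # rev ys1)"
    by (auto simp: successively_append_iff successively_Cons)
  moreover have "?adj A (hd (xs1 @ m # rev ys1))"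
    using xs(2) assms(5) unfolding m(1) by (cases xs1) (auto simp: hasse_adj_def)
  ultimately have "successively ?adj zs"
    unfolding zs_def by (cases xs1) (auto simp: successively_Cons)
  moreover have "?adj (last zs) (hd zs)"
    using ys(2) assms(6) unfolding y zs_def
    by (cases ys1) (auto simp: hasse_adj_def last_rev)
  moreover have "distinct zs"
    using sorted_wrt_psubset_distinct[OF xs(6)] sorted_wrt_psubset_distinct[OF ys(6)] m(3)
      above[OF xs(1) _ xs(6)] above[OF ys(1) _ ys(6)] inP xs(2) ys(2)
    unfolding zs_def m(1) y by auto
  moreover have "set zs \<subseteq> P" using xs(4) ys(4) inP unfolding zs_def m(1) y by auto
  moreover have "3 \<le> length zs"
  proof (rule ccontr)
    assume "\<not> 3 \<le> length zs"
    moreover have "length zs = length xs1 + length ys1 + 2" by (simp add: zs_def)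
    ultimately have "length xs1 = 0" "length ys1 = 0" by linarith+
    then have "xs1 = []" "ys1 = []" by simp_all
    then show False using xs(2) ys(2) \<open>C \<noteq> D\<close> m(1) y by simp
  qed
  ultimately show False using assms(4) unfolding is_tree_def by blast
qed

text \<open>When every element has at most one cover, the elements above a given one form a chain.  Applied
  to a singleton \<open>A\<close>, this says that two members that meet are comparable.\<close>

lemma tree_imp_laminar:
  fixes P :: "'a set set"
  assumes "finite P" "T \<in> P" "\<And>A. A \<in> P \<Longrightarrow> A \<subseteq> T" "is_tree P (hasse_adj P)"
    and "A \<in> P" "I \<in> P" "J \<in> P" "A \<subseteq> I" "A \<subseteq> J"
  shows "I \<subseteq> J \<or> J \<subseteq> I"
  using assms(5,8,9)
proof (induction "card {X \<in> P. A \<subset> X}" arbitrary: A rule: less_induct)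
  case less
  have cov: "\<exists>C. covers_in P A C \<and> C \<subseteq> K" if "K \<in> P" "A \<subset> K" for K
    using exists_cover_below[OF assms(1) less.prems(1) that] .
  show ?case
  proof (cases "A = I \<or> A = J")
    case False
    then obtain C D where C: "covers_in P A C" "C \<subseteq> I" and D: "covers_in P A D" "D \<subseteq> J"
      using cov[of I] cov[of J] assms(6,7) less.prems by blast
    have "C = D" using tree_imp_unique_cover[OF assms(1-4) C(1) D(1)] .
    have "C \<in> P" "A \<subset> C" using C by (auto simp: covers_in_def)
    moreover have "card {X \<in> P. C \<subset> X} < card {X \<in> P. A \<subset> X}"
      using \<open>A \<subset> C\<close> \<open>C \<in> P\<close> assms(1) by (intro psubset_card_mono) auto
    ultimately show ?thesis using less.hyps[of C] C D \<open>C = D\<close> by blast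
  qed (use less.prems in auto)
qed

text \<open>An element of least cardinality on a cycle would be covered by both of its neighbours,
  which laminarity forbids.\<close>

lemma laminar_imp_tree:
  fixes P :: "'a set set"
  assumes "finite P" "T \<in> P" "\<And>A. A \<in> P \<Longrightarrow> A \<subseteq> T" "finite T" "{} \<notin> P"
    and lam: "\<And>I J. I \<in> P \<Longrightarrow> J \<in> P \<Longrightarrow> I \<subseteq> J \<or> J \<subseteq> I \<or> I \<inter> J = {}"
  shows "is_tree P (hasse_adj P)"
  unfolding is_tree_def
proof (intro conjI ballI notI)
  show "P = {} \<Longrightarrow> False" using assms(2) by auto
next
  let ?adj = "hasse_adj P"
  have toT: "?adj\<^sup>*\<^sup>* x T \<and> ?adj\<^sup>*\<^sup>* T x" if x: "x \<in> P" for x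
  proof -
    obtain xs where xs: "xs \<noteq> []" "hd xs = x" "last xs = T" "successively (covers_in P) xs"
      using ascending_chain_to_top[OF assms(1) x assms(2,3)] by blast
    then show ?thesis
    proof (induction xs arbitrary: x rule: list.induct)
      case (Cons y ys)
      show ?case
      proof (cases ys)
        case Nil
        then show ?thesis using Cons by auto
      next
        case (Cons z zs)
        then have "?adj\<^sup>*\<^sup>* z T \<and> ?adj\<^sup>*\<^sup>* T z" using Cons.IH[of z] Cons.prems by auto
        moreover have "?adj x z" "?adj z x" using Cons Cons.prems by (auto simp: hasse_adj_def)
        ultimately show ?thesis
          by (meson converse_rtranclp_into_rtranclp rtranclp.rtrancl_into_rtrancl)
      qed
    qed simp
  qed
  show "?adj\<^sup>*\<^sup>* x y" if "x \<in> P" "y \<in> P" for x y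
    using toT that by (meson rtranclp_trans)
next
  let ?adj = "hasse_adj P"
  assume "\<exists>xs. 3 \<le> length xs \<and> distinct xs \<and> set xs \<subseteq> P \<and> successively ?adj xs \<and>
             ?adj (last xs) (hd xs)"
  then obtain xs where xs: "3 \<le> length xs" "distinct xs" "set xs \<subseteq> P" "successively ?adj xs"
      "?adj (last xs) (hd xs)" by blast
  define l where "l = length xs"
  have fin: "finite A" if "A \<in> P" for A using assms(3,4) that finite_subset by blast
  have step: "?adj (xs ! i) (xs ! (Suc i mod l))" if "i < l" for i
  proof (cases "Suc i = l")
    case True
    have "xs \<noteq> []" using xs(1) by auto
    moreover have "l - 1 = i" "Suc i mod l = 0" using True by auto
    ultimately show ?thesis using xs(5) by (simp add: l_def last_conv_nth hd_conv_nth)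
  next
    case False
    then show ?thesis using that xs(4) by (simp add: l_def successively_conv_nth)
  qed
  have ne: "(\<lambda>x. card x) ` set xs \<noteq> {}" using xs(1) by auto
  obtain A where A: "A \<in> set xs" "card A = Min (card ` set xs)"
    using Min_in[OF _ ne] by auto
  have Amin: "card A \<le> card X" if "X \<in> set xs" for X using A that by simp
  obtain i where i: "i < l" "A = xs ! i" using A(1) by (auto simp: in_set_conv_nth l_def)
  define j where "j = (if i = 0 then l - 1 else i - 1)"
  have j: "j < l" "Suc j mod l = i" using i xs(1) by (auto simp: j_def l_def)
  define k where "k = Suc i mod l"
  have k: "k < l" using i by (auto simp: k_def)
  have "j \<noteq> k" using i xs(1) by (auto simp: j_def k_def l_def mod_Suc)
  then have neq: "xs ! j \<noteq> xs ! k" using xs(2) j k by (auto simp: l_def nth_eq_iff_index_eq)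
  have up: "covers_in P A X" if "X \<in> set xs" "?adj A X \<or> ?adj X A" for X
  proof -
    have "\<not> X \<subset> A" using Amin[OF that(1)] fin[of A] A(1) xs(3)
      by (meson leD psubset_card_mono subsetD)
    then show ?thesis using that by (auto simp: hasse_adj_def covers_in_def)
  qed
  define J K where "J = xs ! j" and "K = xs ! k"
  have J: "covers_in P A J" using up[of J] step[OF j(1)] j i by (auto simp: l_def J_def)
  have K: "covers_in P A K" using up[of K] step[OF i(1)] k i by (auto simp: l_def k_def K_def)
  have sub: "A \<subset> J" "A \<subset> K" "J \<in> P" "K \<in> P" using J K by (simp_all add: covers_in_def)
  have "A \<noteq> {}" using A(1) xs(3) assms(5) by auto
  then have "J \<inter> K \<noteq> {}" using sub(1,2) by blast
  then consider "J \<subset> K" | "K \<subset> J"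
    using lam[OF sub(3,4)] neq unfolding J_def[symmetric] K_def[symmetric] psubset_eq by metis
  then show False using J K sub by cases (auto simp: covers_in_def)
qed

section \<open>Intervals of permutations\<close>

definition convex_in :: "nat set \<Rightarrow> (nat \<Rightarrow> nat) \<Rightarrow> nat set \<Rightarrow> bool" where
  "convex_in A p I \<longleftrightarrow> (\<forall>y\<in>I. \<forall>z\<in>I. \<forall>x\<in>A. p y \<le> p x \<and> p x \<le> p z \<longrightarrow> x \<in> I)"

text \<open>A permutation is a pair of linear orders on one set, by value and by position, and its
  intervals are the sets that are convex for both.  Positions may be any numbers, since only their
  order matters; this makes inflations easy to write down.\<close>

definition ivals :: "nat set \<Rightarrow> (nat \<Rightarrow> nat) \<Rightarrow> nat set set" where
  "ivals A p = {I. I \<noteq> {} \<and> I \<subseteq> A \<and> convex_in A (\<lambda>x. x) I \<and> convex_in A p I}"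

lemma ivalsI:
  assumes "I \<noteq> {}" "I \<subseteq> A"
    and "\<And>y z x. y \<in> I \<Longrightarrow> z \<in> I \<Longrightarrow> x \<in> A \<Longrightarrow> y \<le> x \<Longrightarrow> x \<le> z \<Longrightarrow> x \<in> I"
    and "\<And>y z x. y \<in> I \<Longrightarrow> z \<in> I \<Longrightarrow> x \<in> A \<Longrightarrow> p y \<le> p x \<Longrightarrow> p x \<le> p z \<Longrightarrow> x \<in> I"
  shows "I \<in> ivals A p"
  using assms unfolding ivals_def convex_in_def by blast

lemma ivalsD:
  assumes "I \<in> ivals A p"
  shows "I \<noteq> {}" "I \<subseteq> A"
    "\<And>y z x. y \<in> I \<Longrightarrow> z \<in> I \<Longrightarrow> x \<in> A \<Longrightarrow> y \<le> x \<Longrightarrow> x \<le> z \<Longrightarrow> x \<in> I"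
    "\<And>y z x. y \<in> I \<Longrightarrow> z \<in> I \<Longrightarrow> x \<in> A \<Longrightarrow> p y \<le> p x \<Longrightarrow> p x \<le> p z \<Longrightarrow> x \<in> I"
  using assms unfolding ivals_def convex_in_def by blast+

lemma ivals_order_cong:
  assumes "\<And>x y. x \<in> A \<Longrightarrow> y \<in> A \<Longrightarrow> p x \<le> p y \<longleftrightarrow> q x \<le> q y"
  shows "ivals A p = ivals A q"
proof -
  have "convex_in A p I \<longleftrightarrow> convex_in A q I" if "I \<subseteq> A" for I
    unfolding convex_in_def using assms that by (meson subsetD)
  then show ?thesis unfolding ivals_def by blast
qed

lemma ivals_reverse:
  assumes "\<And>x y. x \<in> A \<Longrightarrow> y \<in> A \<Longrightarrow> p x \<le> p y \<longleftrightarrow> q y \<le> q x"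
  shows "ivals A p = ivals A q"
proof -
  have "convex_in A p I \<longleftrightarrow> convex_in A q I" if "I \<subseteq> A" for I
    unfolding convex_in_def using assms that by (meson subsetD)
  then show ?thesis unfolding ivals_def by blast
qed

lemma whole_in_ivals: "A \<noteq> {} \<Longrightarrow> A \<in> ivals A p"
  by (rule ivalsI) auto

lemma singleton_in_ivals: "inj_on p A \<Longrightarrow> x \<in> A \<Longrightarrow> {x} \<in> ivals A p"
  by (rule ivalsI) (auto dest: inj_onD)

lemma convex_subset_interval:
  fixes I :: "nat set"
  assumes "I \<noteq> {}" "I \<subseteq> {a..<b}"
    and "\<And>y z x. y \<in> I \<Longrightarrow> z \<in> I \<Longrightarrow> x \<in> {a..<b} \<Longrightarrow> y \<le> x \<Longrightarrow> x \<le> z \<Longrightarrow> x \<in> I"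
  shows "\<exists>c d. I = {c..<d} \<and> a \<le> c \<and> c < d \<and> d \<le> b"
proof -
  have fin: "finite I" using assms(2) finite_subset by blast
  have *: "Min I \<in> I" "Max I \<in> I" using fin assms(1) by auto
  have "I = {Min I..<Suc (Max I)}"
  proof
    show "I \<subseteq> {Min I..<Suc (Max I)}" using fin by (auto simp: less_Suc_eq_le)
    show "{Min I..<Suc (Max I)} \<subseteq> I"
    proof
      fix x assume x: "x \<in> {Min I..<Suc (Max I)}"
      then have "x \<in> {a..<b}" using * assms(2) by fastforce
      then show "x \<in> I" using assms(3)[OF *] x by simp
    qed
  qed
  moreover have "a \<le> Min I" "Min I < Suc (Max I)" "Suc (Max I) \<le> b"
    using * assms(2) fin by (auto simp: less_Suc_eq_le)
  ultimately show ?thesis by blast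
qed

lemma ivals_interval:
  assumes "I \<in> ivals {a..<b} p"
  shows "\<exists>c d. I = {c..<d} \<and> a \<le> c \<and> c < d \<and> d \<le> b"
  using convex_subset_interval[of I a b] ivalsD[OF assms] by blast

lemma perm_intervals_eq_ivals:
  assumes "\<sigma> permutes {1..n}"
  shows "perm_intervals n \<sigma> = ivals {1..<Suc n} (inv \<sigma>)"
proof (intro equalityI subsetI)
  let ?q = "inv \<sigma>"
  have inv: "?q (\<sigma> x) = x" "\<sigma> (?q x) = x" for x
    using permutes_inverses[OF assms] by auto
  fix I assume "I \<in> perm_intervals n \<sigma>"
  then obtain i j h where I: "1 \<le> i" "i + h \<le> n" "I = {j..j + h}" "\<sigma> ` {i..i + h} = I"
    unfolding perm_intervals_def by blast
  have sub: "I \<subseteq> {1..<Suc n}"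
  proof -
    have "I \<subseteq> \<sigma> ` {1..n}" using I(1,2) unfolding I(4)[symmetric] by (intro image_mono) auto
    then show ?thesis using permutes_image[OF assms] by auto
  qed
  have iff: "x \<in> I \<longleftrightarrow> ?q x \<in> {i..i + h}" for x
  proof
    assume "x \<in> I"
    then obtain v where "v \<in> {i..i + h}" "x = \<sigma> v" using I(4) by blast
    then show "?q x \<in> {i..i + h}" using inv by simp
  next
    assume "?q x \<in> {i..i + h}"
    then have "\<sigma> (?q x) \<in> I" using I(4) by blast
    then show "x \<in> I" using inv by simp
  qed
  show "I \<in> ivals {1..<Suc n} ?q"
  proof (rule ivalsI)
    show "I \<noteq> {}" using I(3) by simp
    show "x \<in> I" if "y \<in> I" "z \<in> I" "y \<le> x" "x \<le> z" for x y z
      using that unfolding I(3) by simp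
    show "x \<in> I" if "y \<in> I" "z \<in> I" "?q y \<le> ?q x" "?q x \<le> ?q z" for x y z
      using that unfolding iff by simp
  qed (use sub in auto)
next
  let ?q = "inv \<sigma>"
  have inv: "?q (\<sigma> x) = x" "\<sigma> (?q x) = x" for x
    using permutes_inverses[OF assms] by auto
  have qp: "?q permutes {1..n}" using permutes_inv[OF assms] .
  fix I assume I: "I \<in> ivals {1..<Suc n} ?q"
  obtain c d where cd: "I = {c..<d}" "1 \<le> c" "c < d" "d \<le> Suc n" using ivals_interval[OF I] by blast
  have "\<exists>c d. ?q ` I = {c..<d} \<and> 1 \<le> c \<and> c < d \<and> d \<le> Suc n"
  proof (rule convex_subset_interval)
    show "?q ` I \<noteq> {}" using ivalsD(1)[OF I] by simp
    show "?q ` I \<subseteq> {1..<Suc n}"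
      using image_mono[OF ivalsD(2)[OF I], of ?q] permutes_image[OF qp]
      by (simp add: atLeastLessThanSuc_atLeastAtMost)
    fix y z x assume *: "y \<in> ?q ` I" "z \<in> ?q ` I" "x \<in> {1..<Suc n}" "y \<le> x" "x \<le> z"
    then obtain y' z' where "y' \<in> I" "z' \<in> I" "y = ?q y'" "z = ?q z'" by blast
    moreover have "\<sigma> x \<in> {1..<Suc n}"
      using *(3) permutes_in_image[OF assms, of x] by (simp add: atLeastLessThanSuc_atLeastAtMost)
    ultimately have "\<sigma> x \<in> I" using ivalsD(4)[OF I, of y' z' "\<sigma> x"] *(4,5) by (simp add: inv(1))
    then show "x \<in> ?q ` I" by (rule rev_image_eqI) (simp add: inv)
  qed
  then obtain i e where ie: "?q ` I = {i..<e}" "1 \<le> i" "i < e" "e \<le> Suc n" by blast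
  have img: "\<sigma> ` {i..<e} = I" unfolding ie(1)[symmetric] by (simp only: image_image inv image_ident)
  have "card {i..<e} = card I"
    unfolding ie(1)[symmetric] using permutes_inj[OF qp] card_image subset_UNIV inj_on_subset by metis
  then have "e - i = d - c" using cd by simp
  define h where "h = d - c - 1"
  have "{i..<e} = {i..i + h}" "{c..<d} = {c..c + h}"
    using \<open>e - i = d - c\<close> ie(3) cd(3) by (auto simp: h_def)
  moreover have "i + h \<le> n" using ie \<open>e - i = d - c\<close> by (auto simp: h_def)
  ultimately show "I \<in> perm_intervals n \<sigma>"
    unfolding perm_intervals_def using img ie cd by auto
qed

text \<open>Only the order of the positions matters: ranking them gives a permutation.\<close>

lemma ivals_realized_by_permutation:
  assumes "inj_on p {1..<Suc n}"
  shows "\<exists>\<sigma>. \<sigma> permutes {1..n} \<and> perm_intervals n \<sigma> = ivals {1..<Suc n} p"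
proof -
  let ?A = "{1..<Suc n}"
  define r where "r x = (if x \<in> ?A then card {y \<in> ?A. p y \<le> p x} else x)" for x
  have mono: "r x < r y" if "x \<in> ?A" "y \<in> ?A" "p x < p y" for x y
  proof -
    have "{z \<in> ?A. p z \<le> p x} \<subseteq> {z \<in> ?A. p z \<le> p y}" using that(3) by (blast intro: order_trans less_imp_le)
    moreover have "y \<in> {z \<in> ?A. p z \<le> p y} - {z \<in> ?A. p z \<le> p x}" using that(2,3) by simp
    ultimately have "{z \<in> ?A. p z \<le> p x} \<subset> {z \<in> ?A. p z \<le> p y}" by blast
    then have "card {z \<in> ?A. p z \<le> p x} < card {z \<in> ?A. p z \<le> p y}"
      by (intro psubset_card_mono) auto
    then show ?thesis using that by (simp add: r_def)
  qed
  have le: "p x \<le> p y \<longleftrightarrow> r x \<le> r y" if "x \<in> ?A" "y \<in> ?A" for x y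
  proof (cases "x = y")
    case False
    then have "p x \<noteq> p y" using inj_onD[OF assms _ that] by blast
    then show ?thesis using mono[of x y] mono[of y x] that by linarith
  qed simp
  have inj: "inj_on r ?A"
  proof (rule inj_onI)
    fix x y assume *: "x \<in> ?A" "y \<in> ?A" "r x = r y"
    then have "p x = p y" using le[of x y] le[of y x] by simp
    then show "x = y" using inj_onD[OF assms _ *(1,2)] by blast
  qed
  have "r ` ?A \<subseteq> ?A"
  proof
    fix v assume "v \<in> r ` ?A"
    then obtain x where x: "x \<in> ?A" "v = card {y \<in> ?A. p y \<le> p x}" by (auto simp: r_def)
    have "v \<le> card ?A" unfolding x(2) by (intro card_mono) auto
    moreover have "0 < v" unfolding x(2) using x(1) by (subst card_gt_0_iff) auto
    ultimately show "v \<in> ?A" by simp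
  qed
  then have "bij_betw r ?A ?A"
    using inj by (simp add: bij_betw_def endo_inj_surj)
  then have "bij_betw r {1..n} {1..n}" by (simp add: atLeastLessThanSuc_atLeastAtMost)
  then have perm: "r permutes {1..n}" by (rule bij_imp_permutes) (auto simp: r_def)
  have "perm_intervals n (inv r) = ivals ?A (inv (inv r))"
    using perm_intervals_eq_ivals[OF permutes_inv[OF perm]] .
  also have "inv (inv r) = r" using permutes_inv_inv[OF perm] .
  also have "ivals ?A r = ivals ?A p" using le by (intro ivals_order_cong) auto
  finally show ?thesis using permutes_inv[OF perm] by blast
qed

text \<open>Among three neighbouring blocks, the middle one in value is adjacent in position to one of
  the other two.\<close>

lemma ivals_three_blocks:
  assumes inj: "inj_on p A"
    and L: "{c..<d} \<in> ivals A p" and M: "{d..<e} \<in> ivals A p" and R: "{e..<f} \<in> ivals A p"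
    and W: "{c..<f} \<in> ivals A p"
  shows "{c..<e} \<in> ivals A p \<or> {d..<f} \<in> ivals A p"
proof -
  note D = ivalsD
  have lt: "c < d" "d < e" "e < f" using D(1)[OF L] D(1)[OF M] D(1)[OF R] by auto
  \<comment> \<open>Disjoint blocks are separated in position.\<close>
  have sep: "p x' < p y'"
    if "I \<in> ivals A p" "J \<in> ivals A p" "I \<inter> J = {}" "x \<in> I" "y \<in> J" "p x < p y" "x' \<in> I" "y' \<in> J"
    for I J x y x' y'
  proof (rule ccontr)
    assume "\<not> p x' < p y'"
    then have le: "p y' \<le> p x'" by simp
    have inA: "x \<in> A" "y \<in> A" "x' \<in> A" "y' \<in> A" using that D(2) by blast+
    show False
    proof (cases "p x \<le> p y'")
      case True
      then have "y' \<in> I" using D(4)[OF that(1), of x x' y'] that inA le by simp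
      then show False using that by blast
    next
      case False
      then have "x \<in> J" using D(4)[OF that(2), of y' y x] that inA by simp
      then show False using that by blast
    qed
  qed
  have disj: "{c..<d} \<inter> {d..<e} = {}" "{d..<e} \<inter> {e..<f} = {}" "{c..<d} \<inter> {e..<f} = {}"
    using lt by auto
  have ne: "p x \<noteq> p y" if "x \<in> A" "y \<in> A" "x \<noteq> y" for x y using inj that by (meson inj_onD)
  \<comment> \<open>A union of two neighbouring blocks can only fail to be convex because of an
    element of the third block that lies between them.\<close>
  have fail1: "\<exists>x y z. x \<in> {e..<f} \<and> y \<in> {c..<d} \<and> z \<in> {d..<e} \<and>
      (p y < p x \<and> p x < p z \<or> p z < p x \<and> p x < p y)" if "{c..<e} \<notin> ivals A p"
  proof -
    have "\<exists>y z x. y \<in> {c..<e} \<and> z \<in> {c..<e} \<and> x \<in> A \<and> p y \<le> p x \<and> p x \<le> p z \<and> x \<notin> {c..<e}"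
    proof (rule ccontr)
      assume *: "\<not> ?thesis"
      have "{c..<e} \<in> ivals A p"
      proof (rule ivalsI)
        show "{c..<e} \<noteq> {}" using lt by auto
        show "{c..<e} \<subseteq> A"
          using D(2)[OF W] lt by (meson ivl_subset less_imp_le order_refl subset_trans)
        show "x \<in> {c..<e}" if "y \<in> {c..<e}" "z \<in> {c..<e}" "y \<le> x" "x \<le> z" for x y z
          using that by auto
        show "x \<in> {c..<e}" if "y \<in> {c..<e}" "z \<in> {c..<e}" "x \<in> A" "p y \<le> p x" "p x \<le> p z"
          for x y z
          using * that by blast
      qed
      then show False using that by simp
    qed
    then obtain y z x where *: "y \<in> {c..<e}" "z \<in> {c..<e}" "x \<in> A" "p y \<le> p x" "p x \<le> p z"
        "x \<notin> {c..<e}" by blast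
    have yz: "y \<in> {c..<f}" "z \<in> {c..<f}" using *(1,2) lt by auto
    have "x \<in> {c..<f}" by (rule D(4)[OF W yz *(3-5)])
    then have x: "x \<in> {e..<f}" using *(6) by auto
    have yzA: "y \<in> A" "z \<in> A" using yz D(2)[OF W] by blast+
    have "y \<noteq> x" "x \<noteq> z" using *(1,2,6) by blast+
    then have "p y \<noteq> p x" "p x \<noteq> p z" using ne *(3) yzA by blast+
    then have s: "p y < p x" "p x < p z" using *(4,5) by linarith+
    consider "y < d" "z < d" | "y < d" "d \<le> z" | "d \<le> y" "z < d" | "d \<le> y" "d \<le> z" by linarith
    then show ?thesis
    proof cases
      case 1
      then have "y \<in> {c..<d}" "z \<in> {c..<d}" using *(1,2) by auto
      then have "x \<in> {c..<d}" using D(4)[OF L] *(3-5) by blast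
      then show ?thesis using *(6) lt by auto
    next
      case 2
      then show ?thesis using x s *(1,2) by (intro exI[of _ x] exI[of _ y] exI[of _ z]) auto
    next
      case 3
      then show ?thesis using x s *(1,2) by (intro exI[of _ x] exI[of _ z] exI[of _ y]) auto
    next
      case 4
      then have "y \<in> {d..<e}" "z \<in> {d..<e}" using *(1,2) by auto
      then have "x \<in> {d..<e}" using D(4)[OF M] *(3-5) by blast
      then show ?thesis using *(6) lt by auto
    qed
  qed
  have fail2: "\<exists>x y z. x \<in> {c..<d} \<and> y \<in> {d..<e} \<and> z \<in> {e..<f} \<and>
      (p y < p x \<and> p x < p z \<or> p z < p x \<and> p x < p y)" if "{d..<f} \<notin> ivals A p"
  proof -
    have "\<exists>y z x. y \<in> {d..<f} \<and> z \<in> {d..<f} \<and> x \<in> A \<and> p y \<le> p x \<and> p x \<le> p z \<and> x \<notin> {d..<f}"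
    proof (rule ccontr)
      assume *: "\<not> ?thesis"
      have "{d..<f} \<in> ivals A p"
      proof (rule ivalsI)
        show "{d..<f} \<noteq> {}" using lt by auto
        show "{d..<f} \<subseteq> A"
          using D(2)[OF W] lt by (meson ivl_subset less_imp_le order_refl subset_trans)
        show "x \<in> {d..<f}" if "y \<in> {d..<f}" "z \<in> {d..<f}" "y \<le> x" "x \<le> z" for x y z
          using that by auto
        show "x \<in> {d..<f}" if "y \<in> {d..<f}" "z \<in> {d..<f}" "x \<in> A" "p y \<le> p x" "p x \<le> p z"
          for x y z
          using * that by blast
      qed
      then show False using that by simp
    qed
    then obtain y z x where *: "y \<in> {d..<f}" "z \<in> {d..<f}" "x \<in> A" "p y \<le> p x" "p x \<le> p z"
        "x \<notin> {d..<f}" by blast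
    have yz: "y \<in> {c..<f}" "z \<in> {c..<f}" using *(1,2) lt by auto
    have "x \<in> {c..<f}" by (rule D(4)[OF W yz *(3-5)])
    then have x: "x \<in> {c..<d}" using *(6) by auto
    have yzA: "y \<in> A" "z \<in> A" using yz D(2)[OF W] by blast+
    have "y \<noteq> x" "x \<noteq> z" using *(1,2,6) by blast+
    then have "p y \<noteq> p x" "p x \<noteq> p z" using ne *(3) yzA by blast+
    then have s: "p y < p x" "p x < p z" using *(4,5) by linarith+
    consider "y < e" "z < e" | "y < e" "e \<le> z" | "e \<le> y" "z < e" | "e \<le> y" "e \<le> z" by linarith
    then show ?thesis
    proof cases
      case 1
      then have "y \<in> {d..<e}" "z \<in> {d..<e}" using *(1,2) by auto
      then have "x \<in> {d..<e}" using D(4)[OF M] *(3-5) by blast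
      then show ?thesis using *(6) lt by auto
    next
      case 2
      then show ?thesis using x s *(1,2) by (intro exI[of _ x] exI[of _ y] exI[of _ z]) auto
    next
      case 3
      then show ?thesis using x s *(1,2) by (intro exI[of _ x] exI[of _ z] exI[of _ y]) auto
    next
      case 4
      then have "y \<in> {e..<f}" "z \<in> {e..<f}" using *(1,2) by auto
      then have "x \<in> {e..<f}" using D(4)[OF R] *(3-5) by blast
      then show ?thesis using *(6) lt by auto
    qed
  qed
  show ?thesis
  proof (rule ccontr)
    assume "\<not> ?thesis"
    then have n: "{c..<e} \<notin> ivals A p" "{d..<f} \<notin> ivals A p" by simp_all
    obtain x y z where
      1: "x \<in> {e..<f}" "y \<in> {c..<d}" "z \<in> {d..<e}" "p y < p x \<and> p x < p z \<or> p z < p x \<and> p x < p y"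
      using fail1[OF n(1)] by (elim exE conjE) rule
    obtain x' y' z' where
      2: "x' \<in> {c..<d}" "y' \<in> {d..<e}" "z' \<in> {e..<f}"
        "p y' < p x' \<and> p x' < p z' \<or> p z' < p x' \<and> p x' < p y'"
      using fail2[OF n(2)] by (elim exE conjE) rule
    have disj': "{d..<e} \<inter> {c..<d} = {}" "{e..<f} \<inter> {c..<d} = {}" using lt by auto
    have LR: "p y < p x \<Longrightarrow> p x' < p z'" by (rule sep[OF L R disj(3) 1(2) 1(1) _ 2(1) 2(3)])
    have RL: "p x < p y \<Longrightarrow> p z' < p x'" by (rule sep[OF R L disj'(2) 1(1) 1(2) _ 2(3) 2(1)])
    have LM: "p y < p z \<Longrightarrow> p x' < p y'" by (rule sep[OF L M disj(1) 1(2) 1(3) _ 2(1) 2(2)])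
    have M_L: "p z < p y \<Longrightarrow> p y' < p x'" by (rule sep[OF M L disj'(1) 1(3) 1(2) _ 2(2) 2(1)])
    show False using 1(4) 2(4) LR RL LM M_L by linarith
  qed
qed

section \<open>Inflations of simple permutations\<close>

text \<open>The cut is given by the smallest value \<open>c\<close> of the upper part; \<open>c'\<close> only witnesses that the lower
  part is not empty.\<close>

definition sum_decomposable :: "nat set \<Rightarrow> (nat \<Rightarrow> nat) \<Rightarrow> bool" where
  "sum_decomposable A p \<longleftrightarrow>
     (\<exists>c\<in>A. \<exists>c'\<in>A. c' < c \<and> (\<forall>x\<in>A. \<forall>y\<in>A. x < c \<and> c \<le> y \<longrightarrow> p x < p y))"

definition skew_decomposable :: "nat set \<Rightarrow> (nat \<Rightarrow> nat) \<Rightarrow> bool" where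
  "skew_decomposable A p \<longleftrightarrow>
     (\<exists>c\<in>A. \<exists>c'\<in>A. c' < c \<and> (\<forall>x\<in>A. \<forall>y\<in>A. x < c \<and> c \<le> y \<longrightarrow> p y < p x))"

definition simple_on :: "nat \<Rightarrow> (nat \<Rightarrow> nat) \<Rightarrow> bool" where
  "simple_on k q \<longleftrightarrow> inj_on q {..<k} \<and>
     (\<forall>J. J \<in> ivals {..<k} q \<longrightarrow> (\<exists>j. J = {j}) \<or> J = {..<k})"

lemma simple_onD:
  assumes "simple_on k q"
  shows "inj_on q {..<k}" "J \<in> ivals {..<k} q \<Longrightarrow> (\<exists>j. J = {j}) \<or> J = {..<k}"
  using assms by (auto simp: simple_on_def)

text \<open>A simple permutation of every size at least 4, given by the positions of the values
  \<open>0, 1, \<dots>\<close>.  It is an increasing oscillation such as \<open>1 3 0 5 2 4\<close>; for odd \<open>k\<close> the largest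
  value is moved one step to the left, since it would otherwise form a corner.\<close>

definition oscillation :: "nat \<Rightarrow> nat \<Rightarrow> nat" where
  "oscillation k v = (if odd v then 2 * v else if Suc v = k then 2 * v + 2 else 2 * v + 7)"

lemma inj_on_oscillation: "inj_on (oscillation k) {..<k}"
proof (rule inj_onI)
  fix x y assume "x \<in> {..<k}" "y \<in> {..<k}" "oscillation k x = oscillation k y"
  then show "x = y"
    unfolding oscillation_def lessThan_iff by (auto split: if_splits elim!: oddE evenE) presburger+
qed

lemma simple_on_oscillation:
  assumes k: "4 \<le> k"
  shows "simple_on k (oscillation k)"
  unfolding simple_on_def
proof (intro conjI allI impI)
  show "inj_on (oscillation k) {..<k}" by (rule inj_on_oscillation)
next
  let ?q = "oscillation k"
  fix J assume J: "J \<in> ivals {..<k} ?q"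
  then have "J \<in> ivals {0..<k} ?q" by (simp add: atLeast0LessThan)
  then obtain c d' where cd': "J = {c..<d'}" "c < d'" "d' \<le> k" using ivals_interval by blast
  define d where "d = d' - 1"
  have cd: "J = {c..d}" "c \<le> d" "d < k" using cd' by (auto simp: d_def)
  have conv: "c \<le> x \<and> x \<le> d"
    if "c \<le> y" "y \<le> d" "c \<le> z" "z \<le> d" "x < k" "?q y \<le> ?q x" "?q x \<le> ?q z" for x y z
    using ivalsD(4)[OF J, of y z x] that unfolding cd(1) by simp
  show "(\<exists>j. J = {j}) \<or> J = {..<k}"
  proof (cases "c = d")
    case True
    then show ?thesis using cd by auto
  next
    case False
    then have lt: "c < d" using cd by simp
    \<comment> \<open>Between the positions of two consecutive values there are always positions of a smaller and of
      a larger value, as long as such values exist; so neither end of \<open>J\<close> can be in the interior.\<close>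
    have "c = 0"
    proof (rule ccontr)
      assume "c \<noteq> 0"
      consider "odd c" "Suc (Suc c) \<noteq> k" | "odd c" "Suc (Suc c) = k" | "even c" by auto
      then show False
      proof cases
        case 1
        obtain m where m: "c = Suc m" using \<open>c \<noteq> 0\<close> by (cases c) auto
        have "?q m = 2 * m + 7" "?q c = 2 * m + 2" "?q (Suc c) = 2 * m + 11"
          using 1 cd lt by (auto simp: oscillation_def m)
        then show False using conv[of c "Suc c" m] lt cd m by simp
      next
        case 2
        have "3 \<le> c" using 2 k by presburger
        then obtain m where m: "c = m + 3" by (metis add.commute le_Suc_ex)
        have "?q m = 2 * m + 7" "?q c = 2 * m + 6" "?q (Suc c) = 2 * m + 10"
          using 2 cd lt by (auto simp: oscillation_def m)
        then show False using conv[of c "Suc c" m] lt cd m by simp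
      next
        case 3
        have "2 \<le> c" using 3 \<open>c \<noteq> 0\<close> by presburger
        then obtain m where m: "c = m + 2" by (metis add.commute le_Suc_ex)
        have "?q m = 2 * m + 7" "?q c = 2 * m + 11" "?q (Suc c) = 2 * m + 6"
          using 3 cd lt by (auto simp: oscillation_def m)
        then show False using conv[of "Suc c" c m] lt cd m by simp
      qed
    qed
    moreover have "Suc d = k"
    proof (rule ccontr)
      assume "Suc d \<noteq> k"
      then have d: "Suc d < k" using cd by simp
      obtain b where b: "d = Suc b" using lt by (cases d) auto
      consider "even b" "Suc (Suc d) < k" | "even b" "Suc (Suc d) = k" | "odd b" using d by linarith
      then show False
      proof cases
        case 1
        then have "?q b = 2 * b + 7" "?q d = 2 * b + 2" "?q (d + 2) = 2 * b + 6"
          using b by (auto simp: oscillation_def)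
        then show False using conv[of d b "d + 2"] 1 lt cd b by simp
      next
        case 2
        then have "?q b = 2 * b + 7" "?q d = 2 * b + 2" "?q (d + 1) = 2 * b + 6"
          using b by (auto simp: oscillation_def)
        then show False using conv[of d b "d + 1"] 2 lt cd b by simp
      next
        case 3
        then have "?q b = 2 * b" "?q d = 2 * b + 9" "?q (d + 1) = 2 * b + 4"
          using b d by (auto simp: oscillation_def)
        then show False using conv[of b d "d + 1"] 3 lt cd b d by simp
      qed
    qed
    ultimately have "J = {..<k}" using cd by auto
    then show ?thesis by simp
  qed
qed

text \<open>Inflation: the block of the value \<open>x\<close> is \<open>b x\<close>; blocks are positioned by \<open>q\<close>, and inside
  a block positions are compared by \<open>r\<close>.  An interval that meets several blocks meets a set of
  blocks that is an interval of \<open>q\<close>; if \<open>q\<close> is simple, it meets all of them.\<close>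

locale inflation =
  fixes a e :: nat and b q r :: "nat \<Rightarrow> nat" and k N :: nat
  assumes b_mono: "\<And>x y. x \<in> {a..<e} \<Longrightarrow> y \<in> {a..<e} \<Longrightarrow> x \<le> y \<Longrightarrow> b x \<le> b y"
    and b_onto: "b ` {a..<e} = {..<k}"
    and simple: "simple_on k q"
    and r_less: "\<And>x. x \<in> {a..<e} \<Longrightarrow> r x < N"
begin

abbreviation A :: "nat set" where "A \<equiv> {a..<e}"
abbreviation block :: "nat \<Rightarrow> nat set" where "block j \<equiv> {x \<in> A. b x = j}"

definition p :: "nat \<Rightarrow> nat" where "p x = N * q (b x) + r x"

lemma p_less: "x \<in> A \<Longrightarrow> y \<in> A \<Longrightarrow> q (b x) < q (b y) \<Longrightarrow> p x < p y"
proof -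
  assume *: "x \<in> A" "y \<in> A" "q (b x) < q (b y)"
  then have "N * Suc (q (b x)) \<le> N * q (b y)" by (intro mult_le_mono2) simp
  then show "p x < p y" using r_less[OF *(1)] by (simp add: p_def)
qed

lemma less_if_block_less: "x \<in> A \<Longrightarrow> y \<in> A \<Longrightarrow> b x < b y \<Longrightarrow> x < y"
  using b_mono[of y x] by linarith

lemma b_less: "x \<in> A \<Longrightarrow> b x < k"
  using b_onto by auto

lemma b_eqI: "x \<in> A \<Longrightarrow> y \<in> A \<Longrightarrow> q (b x) = q (b y) \<Longrightarrow> b x = b y"
  using simple_onD(1)[OF simple] b_less by (auto dest: inj_onD)

lemma inj_p: "(\<And>j. j < k \<Longrightarrow> inj_on r (block j)) \<Longrightarrow> inj_on p A"
proof (rule inj_onI)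
  fix x y assume inj: "\<And>j. j < k \<Longrightarrow> inj_on r (block j)" and *: "x \<in> A" "y \<in> A" "p x = p y"
  have "q (b x) = q (b y)" using p_less[of x y] p_less[of y x] * by (metis less_irrefl linorder_neqE_nat)
  then have "b x = b y" using b_eqI * by blast
  moreover have "r x = r y" using *(3) \<open>b x = b y\<close> by (simp add: p_def)
  ultimately show "x = y" using inj_onD[OF inj[OF b_less[OF *(2)]], of x y] * by simp
qed

lemma ivals_block:
  assumes "I \<in> ivals (block j) r"
  shows "I \<in> ivals A p"
proof (rule ivalsI)
  note D = ivalsD[OF assms]
  show "I \<noteq> {}" "I \<subseteq> A" using D(1,2) by auto
  fix y z x assume *: "y \<in> I" "z \<in> I" "x \<in> A"
  then have yz: "y \<in> A" "z \<in> A" "b y = j" "b z = j" using D(2) by auto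
  show "x \<in> I" if "y \<le> x" "x \<le> z"
  proof -
    have "b x = j" using b_mono[of y x] b_mono[of x z] yz * that by simp
    then show ?thesis using D(3)[of y z x] * that by simp
  qed
  show "x \<in> I" if "p y \<le> p x" "p x \<le> p z"
  proof -
    have "\<not> q (b x) < q (b y)" "\<not> q (b z) < q (b x)"
      using p_less[of x y] p_less[of z x] yz * that by auto
    then have "q (b x) = q (b y)" using yz by simp
    then have "b x = j" using b_eqI[of x y] yz * by simp
    then show ?thesis using D(4)[of y z x] * that yz by (simp add: p_def)
  qed
qed

lemma ivals_cases:
  assumes I: "I \<in> ivals A p"
  obtains j where "j < k" "I \<in> ivals (block j) r" | "b ` I = {..<k}"
proof -
  note D = ivalsD[OF I]
  have "b ` I \<in> ivals {..<k} q"
  proof (rule ivalsI)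
    show "b ` I \<noteq> {}" "b ` I \<subseteq> {..<k}" using D(1,2) b_less by auto
    fix y' z' j assume *: "y' \<in> b ` I" "z' \<in> b ` I" "j \<in> {..<k}"
    then obtain y z where yz: "y \<in> I" "z \<in> I" "y' = b y" "z' = b z" by blast
    have yzA: "y \<in> A" "z \<in> A" using yz D(2) by auto
    obtain x where x: "x \<in> A" "j = b x" using b_onto *(3) by (metis imageE)
    show "j \<in> b ` I" if "y' \<le> j" "j \<le> z'"
    proof (cases "j = y' \<or> j = z'")
      case False
      then have "\<not> x \<le> y" "\<not> z \<le> x"
        using b_mono[of x y] b_mono[of z x] x yz yzA that by auto
      then have "x \<in> I" using D(3)[of y z x] yz x by simp
      then show ?thesis using x by blast
    qed (use * in auto)
    show "j \<in> b ` I" if "q y' \<le> q j" "q j \<le> q z'"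
    proof (cases "q j = q y' \<or> q j = q z'")
      case False
      then have "p y < p x" "p x < p z" using p_less x yz yzA that by auto
      then have "x \<in> I" using D(4)[of y z x] yz x by simp
      then show ?thesis using x by blast
    next
      case True
      then have "j = y' \<or> j = z'" using b_eqI[of x y] b_eqI[of x z] x yz yzA by auto
      then show ?thesis using * by auto
    qed
  qed
  then consider j where "b ` I = {j}" | "b ` I = {..<k}" using simple_onD(2)[OF simple] by blast
  then show ?thesis
  proof cases
    case 1
    have sub: "I \<subseteq> block j" using 1 D(2) by auto
    have "j < k" using 1 D(1,2) b_less by (metis imageE insertI1 subsetD)
    moreover have "I \<in> ivals (block j) r"
    proof (rule ivalsI)
      show "I \<noteq> {}" "I \<subseteq> block j" using D(1) sub by auto
      fix y z x assume *: "y \<in> I" "z \<in> I" "x \<in> block j"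
      show "x \<in> I" if "y \<le> x" "x \<le> z" using D(3)[of y z x] * that by simp
      show "x \<in> I" if "r y \<le> r x" "r x \<le> r z"
      proof -
        have "b y = j" "b z = j" "b x = j" using * sub by auto
        then show ?thesis using D(4)[of y z x] * that by (simp add: p_def)
      qed
    qed
    ultimately show ?thesis using that(1) by blast
  next
    case 2
    then show ?thesis using that(2) by blast
  qed
qed

text \<open>An element missing from an interval that meets all blocks lies in a block that is extreme
  both in value and in position.  A simple permutation of size at least 3 has no such corner:
  the other entries would form an interval.\<close>

lemma meets_all_imp_whole:
  assumes I: "I \<in> ivals A p" and all: "b ` I = {..<k}" and k: "3 \<le> k"
  shows "I = A"
proof (rule ccontr)
  note D = ivalsD[OF I]
  assume "I \<noteq> A"
  then obtain x where x: "x \<in> A" "x \<notin> I" using D(2) by blast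
  define j where "j = b x"
  have jk: "j < k" using b_less x by (simp add: j_def)
  have ex: "\<exists>y\<in>I. b y = i" if "i < k" for i using all that by (metis imageE lessThan_iff)
  have not_between: "\<not> (i < j \<and> j < i')" if ik: "i < k" "i' < k" for i i'
  proof
    assume ij: "i < j \<and> j < i'"
    obtain y z where yz: "y \<in> I" "b y = i" "z \<in> I" "b z = i'" using ex ik by blast
    then have "\<not> x \<le> y" "\<not> z \<le> x"
      using b_mono[of x y] b_mono[of z x] x D(2) ij by (auto simp: j_def)
    then show False using D(3)[of y z x] yz x by simp
  qed
  have not_between_q: "\<not> (q i < q j \<and> q j < q i')" if ik: "i < k" "i' < k" for i i'
  proof
    assume ij: "q i < q j \<and> q j < q i'"
    obtain y z where yz: "y \<in> I" "b y = i" "z \<in> I" "b z = i'" using ex ik by blast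
    then have "p y < p x" "p x < p z"
      using p_less[of y x] p_less[of x z] x D(2) ij by (auto simp: j_def)
    then show False using D(4)[of y z x] yz x by simp
  qed
  have inj: "q i \<noteq> q j" if "i < k" "i \<noteq> j" for i
    using inj_onD[OF simple_onD(1)[OF simple], of i j] that jk by auto
  have "{..<k} - {j} \<in> ivals {..<k} q"
  proof (rule ivalsI)
    have "(if j = 0 then 1 else 0) \<in> {..<k} - {j}" using k by auto
    then show "{..<k} - {j} \<noteq> {}" by blast
    show "{..<k} - {j} \<subseteq> {..<k}" by blast
    fix y z i assume *: "y \<in> {..<k} - {j}" "z \<in> {..<k} - {j}" "i \<in> {..<k}"
    show "i \<in> {..<k} - {j}" if "y \<le> i" "i \<le> z"
      using not_between[of y z] * that by (cases "i = j") auto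
    show "i \<in> {..<k} - {j}" if "q y \<le> q i" "q i \<le> q z"
      using not_between_q[of y z] inj[of y] inj[of z] * that by (cases "i = j") auto
  qed
  moreover have "{..<k} - {j} \<noteq> {..<k}" using jk by blast
  ultimately obtain i where "{..<k} - {j} = {i}" using simple_onD(2)[OF simple] by blast
  then have "card ({..<k} - {j}) = 1" by simp
  then show False using jk k by simp
qed

text \<open>For two blocks in decreasing position order, an interval that meets both but is not
  everything cuts one of them into a skew sum.\<close>

lemma meets_both_imp_whole:
  assumes I: "I \<in> ivals A p" and all: "b ` I = {..<k}" and k: "k = 2"
    and q: "q 1 < q 0"
    and indec: "\<And>j. j < 2 \<Longrightarrow> \<not> skew_decomposable (block j) r"
  shows "I = A"
proof (rule ccontr)
  note D = ivalsD[OF I]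
  assume "I \<noteq> A"
  then obtain x where x: "x \<in> A" "x \<notin> I" using D(2) by blast
  have "0 \<in> b ` I" "1 \<in> b ` I" unfolding all using k by auto
  then obtain u v where uv: "u \<in> I" "b u = 0" "v \<in> I" "b v = 1" by (auto elim!: imageE)
  have uvA: "u \<in> A" "v \<in> A" using uv D(2) by auto
  have "b x < 2" using b_less[OF x(1)] k by simp
  then consider "b x = 0" | "b x = 1" by linarith
  then show False
  proof cases
    case 1
    define c where "c = Min (I \<inter> block 0)"
    have fin: "finite (I \<inter> block 0)" by simp
    have cI: "c \<in> I \<inter> block 0" unfolding c_def using uv uvA by (intro Min_in[OF fin]) auto
    have cmin: "c \<le> y" if "y \<in> I" "b y = 0" for y
      unfolding c_def using that D(2) by (intro Min_le[OF fin]) auto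
    have cv: "c < v" using less_if_block_less[of c v] cI uv uvA by simp
    have below: "y < c" if y: "y \<notin> I" "y \<in> block 0" for y
    proof (rule ccontr)
      assume "\<not> y < c"
      have "y < v" using less_if_block_less[of y v] y uv uvA by simp
      then show False using D(3)[of c v y] y \<open>\<not> y < c\<close> cI uv by simp
    qed
    have "skew_decomposable (block 0) r" unfolding skew_decomposable_def
    proof (rule bexI[of _ c], rule bexI[of _ x], intro conjI ballI impI)
      show "x < c" "x \<in> block 0" "c \<in> block 0" using below[of x] x 1 cI by auto
      fix y z assume *: "y \<in> block 0" "z \<in> block 0" "y < c \<and> c \<le> z"
      have "z \<in> I" using below[of z] * by auto
      have "y \<notin> I" using cmin[of y] * by auto
      show "r z < r y"
      proof (rule ccontr)
        assume "\<not> r z < r y"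
        then have "p y \<le> p z" using * by (simp add: p_def)
        moreover have "p v < p y" using p_less[of v y] uv uvA q * by simp
        ultimately show False using D(4)[of v z y] \<open>z \<in> I\<close> \<open>y \<notin> I\<close> uv * by simp
      qed
    qed
    then show False using indec[of 0] by simp
  next
    case 2
    define c where "c = Min {y \<in> block 1. y \<notin> I}"
    have fin: "finite {y \<in> block 1. y \<notin> I}" by simp
    have cI: "c \<in> {y \<in> block 1. y \<notin> I}" unfolding c_def using x 2 by (intro Min_in[OF fin]) auto
    have cmin: "c \<le> y" if "y \<in> block 1" "y \<notin> I" for y
      unfolding c_def using that by (intro Min_le[OF fin]) auto
    have above: "u < y" if "y \<in> block 1" for y
      using less_if_block_less[of u y] that uv uvA by simp
    have notI: "y \<notin> I" if "y \<in> block 1" "c \<le> y" for y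
      using D(3)[of u y c] above[of c] cI uv that by auto
    have "skew_decomposable (block 1) r" unfolding skew_decomposable_def
    proof (rule bexI[of _ c], rule bexI[of _ v], intro conjI ballI impI)
      have "\<not> c \<le> v" using notI[of v] uv uvA by auto
      then show "v < c" by simp
      show "v \<in> block 1" "c \<in> block 1" using uv uvA cI by auto
      fix y z assume *: "y \<in> block 1" "z \<in> block 1" "y < c \<and> c \<le> z"
      have "z \<notin> I" using notI * by auto
      have "y \<in> I" using cmin[of y] * by auto
      show "r z < r y"
      proof (rule ccontr)
        assume "\<not> r z < r y"
        then have "p y \<le> p z" using * by (simp add: p_def)
        moreover have "p z < p u" using p_less[of z u] uv uvA q * by simp
        ultimately show False using D(4)[of y u z] \<open>z \<notin> I\<close> \<open>y \<in> I\<close> uv * by simp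
      qed
    qed
    then show False using indec[of 1] by simp
  qed
qed

end

fun block_of :: "nat \<Rightarrow> ptree list \<Rightarrow> nat \<Rightarrow> nat" where
  "block_of a [] x = 0"
| "block_of a (t # ts) x = (if x < a + leaves t then 0 else Suc (block_of (a + leaves t) ts x))"

lemma block_of_mono: "x \<le> y \<Longrightarrow> block_of a ts x \<le> block_of a ts y"
  by (induction a ts x rule: block_of.induct) auto

lemma block_of_less: "x < a + width ts \<Longrightarrow> a \<le> x \<Longrightarrow> block_of a ts x < length ts"
  by (induction a ts x rule: block_of.induct) auto

lemma block_of_eq:
  "j < length ts \<Longrightarrow> {x \<in> {a..<a + width ts}. block_of a ts x = j} =
     {a + width (take j ts)..<a + width (take j ts) + leaves (ts ! j)}"
proof (induction ts arbitrary: a j)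
  case (Cons t ts)
  show ?case
  proof (cases j)
    case 0
    then show ?thesis by (auto split: if_splits)
  next
    case (Suc i)
    have "{x \<in> {a..<a + width (t # ts)}. block_of a (t # ts) x = j} =
        {x \<in> {a + leaves t..<a + leaves t + width ts}. block_of (a + leaves t) ts x = i}"
      using Suc by (auto split: if_splits)
    also have "\<dots> = {a + leaves t + width (take i ts)..<
        a + leaves t + width (take i ts) + leaves (ts ! i)}"
      using Cons Suc by simp
    finally show ?thesis using Suc by (simp add: add.assoc)
  qed
qed simp

lemma fams_eq_UN:
  "fams a ts = (\<Union>j<length ts. fam (a + width (take j ts)) (ts ! j))"
proof (induction ts arbitrary: a)
  case (Cons t ts)
  show ?case
    unfolding fams.simps Cons.IH length_Cons lessThan_Suc_eq_insert_0
    by (simp add: add.assoc image_image)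
qed simp

text \<open>Reversing all positions keeps the intervals and exchanges sums with skew sums.\<close>

lemma reverse_positions:
  assumes "inj_on p {a..<e}"
  obtains p' where "inj_on p' {a..<e}" "ivals {a..<e} p' = ivals {a..<e} p"
    "skew_decomposable {a..<e} p' \<longleftrightarrow> sum_decomposable {a..<e} p"
proof -
  define M where "M = Max (p ` {a..<e})"
  define p' where "p' x = M - p x" for x
  have le: "p x \<le> M" if "x \<in> {a..<e}" for x
    unfolding M_def using that by (intro Max_ge) auto
  have rev: "p' x \<le> p' y \<longleftrightarrow> p y \<le> p x" if "x \<in> {a..<e}" "y \<in> {a..<e}" for x y
    using le[OF that(1)] le[OF that(2)] by (auto simp: p'_def)
  have inj: "inj_on p' {a..<e}"
  proof (rule inj_onI)
    fix x y assume *: "x \<in> {a..<e}" "y \<in> {a..<e}" "p' x = p' y"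
    then have "p x = p y" using rev[of x y] rev[of y x] by simp
    then show "x = y" using inj_onD[OF assms _ *(1,2)] by blast
  qed
  have "p' y < p' x \<longleftrightarrow> p x < p y" if "x \<in> {a..<e}" "y \<in> {a..<e}" for x y
    using rev[of x y] that by linarith
  then have "skew_decomposable {a..<e} p' \<longleftrightarrow> sum_decomposable {a..<e} p"
    unfolding skew_decomposable_def sum_decomposable_def by (intro bex_cong refl conj_cong ball_cong) simp
  then show ?thesis using that inj ivals_reverse[of "{a..<e}" p' p] rev by blast
qed

lemma ivals_singleton: "ivals {a} p = {{a}}"
proof -
  have "{a} \<in> ivals {a} p" by (rule ivalsI) auto
  moreover have "I = {a}" if "I \<in> ivals {a} p" for I
    using ivalsD(1,2)[OF that] by blast
  ultimately show ?thesis by blast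
qed

text \<open>Every tree is the interval family of some arrangement, namely an inflation of a simple
  permutation at each node.  The arrangement can be chosen not to be a sum, or by reversal not a
  skew sum; the latter keeps a binary node from merging with a binary child.\<close>

lemma fam_realizable:
  "admissible t \<Longrightarrow> \<exists>p. inj_on p {a..<a + leaves t} \<and> ivals {a..<a + leaves t} p = fam a t \<and>
     \<not> sum_decomposable {a..<a + leaves t} p"
proof (induction t arbitrary: a)
  case Leaf
  have "{a..<Suc a} = {a}" by auto
  then show ?case
    by (intro exI[of _ "\<lambda>x. x"]) (simp add: ivals_singleton sum_decomposable_def)
next
  case (Node ts)
  define k where "k = length ts"
  define e where "e = a + width ts"
  define b where "b = block_of a ts"
  define off where "off j = a + width (take j ts)" for j
  have adm: "\<forall>t\<in>set ts. admissible t" and k: "k = 2 \<or> 4 \<le> k" using Node.prems by (auto simp: k_def)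
  \<comment> \<open>A binary node becomes a skew sum, so its children must not be skew sums themselves.\<close>
  have "\<exists>r. inj_on r {off j..<off j + leaves (ts ! j)} \<and>
      ivals {off j..<off j + leaves (ts ! j)} r = fam (off j) (ts ! j) \<and>
      \<not> skew_decomposable {off j..<off j + leaves (ts ! j)} r" if "j < k" for j
  proof -
    have "ts ! j \<in> set ts" using that by (simp add: k_def)
    then obtain p where "inj_on p {off j..<off j + leaves (ts ! j)}"
      "ivals {off j..<off j + leaves (ts ! j)} p = fam (off j) (ts ! j)"
      "\<not> sum_decomposable {off j..<off j + leaves (ts ! j)} p"
      using Node.IH[of "ts ! j" "off j"] adm by blast
    then show ?thesis using reverse_positions by metis
  qed
  then obtain R where R: "\<And>j. j < k \<Longrightarrow> inj_on (R j) {off j..<off j + leaves (ts ! j)}"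
      "\<And>j. j < k \<Longrightarrow> ivals {off j..<off j + leaves (ts ! j)} (R j) = fam (off j) (ts ! j)"
      "\<And>j. j < k \<Longrightarrow> \<not> skew_decomposable {off j..<off j + leaves (ts ! j)} (R j)"
    by metis
  define r where "r x = R (b x) x" for x
  define N where "N = Suc (Max (r ` {a..<e}))"
  define q where "q = (if k = 2 then (\<lambda>i. 1 - i) else oscillation k)"
  have block: "{x \<in> {a..<e}. b x = j} = {off j..<off j + leaves (ts ! j)}" if "j < k" for j
    using block_of_eq[of j ts a] that by (simp add: b_def e_def off_def k_def)
  have onto: "b ` {a..<e} = {..<k}"
  proof
    show "b ` {a..<e} \<subseteq> {..<k}" using block_of_less by (auto simp: b_def e_def k_def)
    show "{..<k} \<subseteq> b ` {a..<e}"
    proof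
      fix j assume j: "j \<in> {..<k}"
      then have "0 < leaves (ts ! j)" using adm leaves_pos by (simp add: k_def)
      then have "off j \<in> {x \<in> {a..<e}. b x = j}" using block[of j] j by simp
      then have "off j \<in> {a..<e}" "j = b (off j)" by simp_all
      then show "j \<in> b ` {a..<e}" by (rule rev_image_eqI)
    qed
  qed
  have simp2: "simple_on 2 (\<lambda>i. 1 - i)" unfolding simple_on_def
  proof (intro conjI allI impI)
    have two: "{..<2::nat} = {0, 1}" by auto
    show "inj_on (\<lambda>i. 1 - i) {..<2::nat}" by (auto simp: two)
    fix J assume "J \<in> ivals {..<2} (\<lambda>i. 1 - i)"
    then have "J \<noteq> {}" "J \<subseteq> {0, 1}" using ivalsD(1,2) two by blast+
    then have "J = {0} \<or> J = {1} \<or> J = {0, 1}" by blast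
    then show "(\<exists>j. J = {j}) \<or> J = {..<2}" unfolding two by blast
  qed
  interpret inflation a e b q r k N
  proof
    show "b x \<le> b y" if "x \<le> y" for x y using block_of_mono[OF that] by (simp add: b_def)
    show "b ` {a..<e} = {..<k}" by (rule onto)
    show "simple_on k q" using k simp2 simple_on_oscillation by (auto simp: q_def)
    show "r x < N" if "x \<in> {a..<e}" for x
      unfolding N_def using that by (auto simp: less_Suc_eq_le intro!: Max_ge)
  qed
  have blk: "inj_on r (block j)" "ivals (block j) r = fam (off j) (ts ! j)"
    "\<not> skew_decomposable (block j) r" if "j < k" for j
  proof -
    have r: "r x = R j x" if "x \<in> block j" for x using that by (simp add: r_def)
    have "inj_on r (block j) \<longleftrightarrow> inj_on (R j) (block j)" using r by (intro inj_on_cong)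
    then show "inj_on r (block j)" using R(1)[OF that] block[OF that] by simp
    have "ivals (block j) r = ivals (block j) (R j)"
      by (rule ivals_order_cong) (simp only: r)
    then show "ivals (block j) r = fam (off j) (ts ! j)" using R(2)[OF that] block[OF that] by simp
    have "skew_decomposable (block j) r \<longleftrightarrow> skew_decomposable (block j) (R j)"
      unfolding skew_decomposable_def by (intro bex_cong refl conj_cong ball_cong) (simp only: r)
    then show "\<not> skew_decomposable (block j) r" using R(3)[OF that] block[OF that] by simp
  qed
  have whole: "I = A" if "I \<in> ivals A p" "b ` I = {..<k}" for I
  proof (cases "k = 2")
    case True
    then show ?thesis using meets_both_imp_whole[OF that True] blk(3) by (simp add: q_def)
  next
    case False
    then show ?thesis using meets_all_imp_whole[OF that] k by simp
  qed
  have "A \<noteq> {}"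
  proof
    assume "A = {}"
    then have "card {..<k} = card (b ` {})" using onto by simp
    then show False using k by auto
  qed
  have "ivals A p = insert A (\<Union>j<k. fam (off j) (ts ! j))"
  proof (intro equalityI subsetI)
    fix I assume I: "I \<in> ivals A p"
    show "I \<in> insert A (\<Union>j<k. fam (off j) (ts ! j))"
      using I
    proof (cases rule: ivals_cases)
      case (1 j)
      then show ?thesis using blk(2) by blast
    next
      case 2
      then show ?thesis using whole I by blast
    qed
  next
    fix I assume "I \<in> insert A (\<Union>j<k. fam (off j) (ts ! j))"
    then show "I \<in> ivals A p"
      using whole_in_ivals[OF \<open>A \<noteq> {}\<close>] ivals_block blk(2) by blast
  qed
  also have "\<dots> = fam a (Node ts)"
    unfolding fam.simps fams_eq_UN by (simp add: off_def e_def k_def)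
  finally have fam: "ivals A p = fam a (Node ts)" .
  \<comment> \<open>For arity at least 4, both parts of a sum would be intervals, hence each within one block; but
    two blocks do not cover everything.\<close>
  have "\<not> sum_decomposable A p"
  proof
    assume "sum_decomposable A p"
    then obtain c c' where c: "c \<in> A" "c' \<in> A" "c' < c"
        and cut: "\<And>x y. x \<in> A \<Longrightarrow> y \<in> A \<Longrightarrow> x < c \<Longrightarrow> c \<le> y \<Longrightarrow> p x < p y"
      unfolding sum_decomposable_def by blast
    show False
    proof (cases "k = 2")
      case True
      have "0 \<in> b ` A" "1 \<in> b ` A" unfolding onto using True by auto
      then obtain u v where uv: "u \<in> A" "v \<in> A" "b u = 0" "b v = 1" by (auto elim!: imageE)
      have ends: "a \<in> A" "e - 1 \<in> A" "a < c" "c \<le> e - 1" using c by auto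
      have "b a = 0" using b_mono[of a u] uv ends by simp
      moreover have "v \<le> e - 1" using uv(2) unfolding atLeastLessThan_iff by linarith
      then have "1 \<le> b (e - 1)" using b_mono[of v "e - 1"] uv ends by simp
      then have "b (e - 1) = 1" using b_less[OF ends(2)] True by simp
      ultimately have "p (e - 1) < p a" using p_less[OF ends(2,1)] True by (simp add: q_def)
      then show False using cut[of a "e - 1"] ends by simp
    next
      case False
      then have k4: "4 \<le> k" using k by simp
      have L: "{a..<c} \<in> ivals A p"
      proof (rule ivalsI)
        show "{a..<c} \<noteq> {}" "{a..<c} \<subseteq> A" using c by auto
        fix y z x assume *: "y \<in> {a..<c}" "z \<in> {a..<c}" "x \<in> A"
        show "x \<in> {a..<c}" if "y \<le> x" "x \<le> z" using * that by auto
        show "x \<in> {a..<c}" if "p y \<le> p x" "p x \<le> p z"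
        proof (rule ccontr)
          assume "x \<notin> {a..<c}"
          then have "p z < p x" using cut[of z x] * c by auto
          then show False using that by simp
        qed
      qed
      have U: "{c..<e} \<in> ivals A p"
      proof (rule ivalsI)
        show "{c..<e} \<noteq> {}" "{c..<e} \<subseteq> A" using c by auto
        fix y z x assume *: "y \<in> {c..<e}" "z \<in> {c..<e}" "x \<in> A"
        show "x \<in> {c..<e}" if "y \<le> x" "x \<le> z" using * that by auto
        show "x \<in> {c..<e}" if "p y \<le> p x" "p x \<le> p z"
        proof (rule ccontr)
          assume "x \<notin> {c..<e}"
          then have "p x < p y" using cut[of x y] * c by auto
          then show False using that by simp
        qed
      qed
      have one: "\<exists>j. I \<subseteq> block j" if I: "I \<in> ivals A p" "I \<noteq> A" for I
        using I(1)
      proof (cases rule: ivals_cases)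
        case (1 j)
        then show ?thesis using ivalsD(2) by blast
      qed (use whole I in blast)
      have ends: "a \<in> A" "a \<notin> {c..<e}" "c \<in> A" "c \<notin> {a..<c}" using c by auto
      then have neq: "{a..<c} \<noteq> A" "{c..<e} \<noteq> A" by blast+
      obtain i where i: "{a..<c} \<subseteq> block i" using one[OF L neq(1)] by blast
      obtain j where j: "{c..<e} \<subseteq> block j" using one[OF U neq(2)] by blast
      have "b x \<in> {i, j}" if "x \<in> A" for x
      proof (cases "x < c")
        case True
        then have "x \<in> {a..<c}" using that by simp
        then have "x \<in> block i" using i by blast
        then show ?thesis by simp
      next
        case False
        then have "x \<in> {c..<e}" using that by simp
        then have "x \<in> block j" using j by blast
        then show ?thesis by simp
      qed
      then have "{..<k} \<subseteq> {i, j}" unfolding onto[symmetric] by blast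
      then have "card {..<k} \<le> card {i, j}" by (intro card_mono) auto
      also have "\<dots> \<le> 2" by (simp add: card_insert_if)
      finally show False using k4 by simp
    qed
  qed
  moreover have "inj_on p A" using inj_p blk(1) by blast
  ultimately show ?case using fam unfolding leaves.simps e_def by blast
qed

section \<open>Counting tree interval posets\<close>

lemma card_minimal_elements_ivals:
  assumes "inj_on p {1..<Suc n}"
  shows "card (minimal_elements (ivals {1..<Suc n} p)) = n"
proof -
  let ?A = "{1..<Suc n}"
  have sing: "{x} \<in> ivals ?A p" if "x \<in> ?A" for x using singleton_in_ivals[OF assms that] .
  have "minimal_elements (ivals ?A p) = (\<lambda>x. {x}) ` ?A"
  proof (intro equalityI subsetI)
    fix I assume "I \<in> minimal_elements (ivals ?A p)"
    then have I: "I \<in> ivals ?A p" and min: "\<And>B. B \<in> ivals ?A p \<Longrightarrow> \<not> B \<subset> I"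
      by (auto simp: minimal_elements_def)
    obtain x where x: "x \<in> I" "x \<in> ?A" using ivalsD(1,2)[OF I] by blast
    have "\<not> {x} \<subset> I" using min[OF sing[OF x(2)]] .
    then have "I = {x}" using x by blast
    then show "I \<in> (\<lambda>x. {x}) ` ?A" using x by blast
  next
    fix I assume "I \<in> (\<lambda>x. {x}) ` ?A"
    then obtain x where x: "x \<in> ?A" "I = {x}" by blast
    have "\<not> B \<subset> {x}" if "B \<in> ivals ?A p" for B using ivalsD(1)[OF that] by blast
    then show "I \<in> minimal_elements (ivals ?A p)"
      unfolding minimal_elements_def using sing[OF x(1)] x(2) by blast
  qed
  then show ?thesis by (simp add: card_image)
qed

definition trees :: "nat \<Rightarrow> ptree set" where
  "trees n = {t. admissible t \<and> leaves t = n}"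

text \<open>The set \<open>K\<close> lists the allowed numbers of trees.\<close>

definition forests :: "nat set \<Rightarrow> nat \<Rightarrow> ptree list set" where
  "forests K n = {ts. length ts \<in> K \<and> (\<forall>t\<in>set ts. admissible t) \<and> width ts = n}"

text \<open>Two members that meet have a common singleton below them, so the tree property makes the family
  laminar; being the intervals of a permutation gives the condition on three blocks.\<close>

lemma tree_poset_is_fam:
  assumes "tree_interval_poset P" "card (minimal_elements P) = n"
  shows "P \<in> fam 1 ` trees n"
proof -
  obtain m \<sigma> where \<sigma>: "1 \<le> m" "\<sigma> permutes {1..m}" "P = perm_intervals m \<sigma>"
    using assms(1) unfolding tree_interval_poset_def interval_poset_def by blast
  let ?A = "{1..<Suc m}"
  define p where "p = inv \<sigma>"
  have P: "P = ivals ?A p" using perm_intervals_eq_ivals[OF \<sigma>(2)] \<sigma>(3) by (simp add: p_def)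
  have inj: "inj_on p ?A" unfolding p_def
    using permutes_inj[OF permutes_inv[OF \<sigma>(2)]] by (rule inj_on_subset) simp
  have "m = n" using card_minimal_elements_ivals[OF inj] assms(2) P by simp
  have finP: "finite P"
    by (rule finite_subset[of _ "Pow ?A"]) (use P ivalsD(2) in auto)
  have top: "?A \<in> P" unfolding P by (rule whole_in_ivals) (use \<sigma>(1) in auto)
  have tree: "is_tree P (hasse_adj P)" using assms(1) by (simp add: tree_interval_poset_def)
  have "\<exists>ts. (\<forall>t\<in>set ts. admissible t) \<and> fams 1 ts = P \<and> 1 + width ts = Suc m"
  proof (rule laminar_family_is_fams)
    show "\<exists>c d. I = {c..<d} \<and> 1 \<le> c \<and> c < d \<and> d \<le> Suc m" if "I \<in> P" for I
      using ivals_interval that unfolding P .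
    show "{x} \<in> P" if "x \<in> ?A" for x unfolding P using singleton_in_ivals[OF inj that] .
    show "I \<subseteq> J \<or> J \<subseteq> I \<or> I \<inter> J = {}" if IJ: "I \<in> P" "J \<in> P" for I J
    proof (cases "I \<inter> J = {}")
      case False
      then obtain x where x: "x \<in> I" "x \<in> J" by blast
      then have "x \<in> ?A" using IJ(1) ivalsD(2) unfolding P by blast
      then have "{x} \<in> P" unfolding P by (rule singleton_in_ivals[OF inj])
      moreover have "X \<subseteq> ?A" if "X \<in> P" for X using ivalsD(2) that unfolding P .
      ultimately have "I \<subseteq> J \<or> J \<subseteq> I"
        using tree_imp_laminar[OF finP top _ tree, of "{x}" I J] IJ x by blast
      then show ?thesis by blast
    qed simp
    show "{c..<e} \<in> P \<or> {d..<f} \<in> P"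
      if "{c..<d} \<in> P" "{d..<e} \<in> P" "{e..<f} \<in> P" "{c..<f} \<in> P" for c d e f
      using ivals_three_blocks[OF inj] that unfolding P .
  qed simp
  then obtain ts where ts: "\<forall>t\<in>set ts. admissible t" "fams 1 ts = P" "width ts = m" by auto
  have "ts \<noteq> []" using ts(2) top by auto
  moreover have "length ts = 1"
  proof (rule ccontr)
    assume "length ts \<noteq> 1"
    then have "{1..<1 + width ts} \<notin> fams 1 ts" using root_notin_fams ts(1) \<open>ts \<noteq> []\<close> by blast
    then show False using ts top by simp
  qed
  then obtain t where "ts = [t]" by (metis One_nat_def length_0_conv length_Suc_conv)
  then have "admissible t" "fam 1 t = P" "leaves t = m" using ts by auto
  then show ?thesis using \<open>m = n\<close> unfolding trees_def by blast
qed

lemma fam_is_tree_poset: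
  assumes "t \<in> trees n"
  shows "tree_interval_poset (fam 1 t)" "card (minimal_elements (fam 1 t)) = n"
proof -
  have t: "admissible t" "leaves t = n" using assms by (auto simp: trees_def)
  have n: "1 \<le> n" using leaves_pos[OF t(1)] t(2) by simp
  let ?A = "{1..<Suc n}"
  obtain p where p: "inj_on p ?A" "ivals ?A p = fam 1 t"
    using fam_realizable[OF t(1), of 1] t(2) by auto
  obtain \<sigma> where \<sigma>: "\<sigma> permutes {1..n}" "perm_intervals n \<sigma> = fam 1 t"
    using ivals_realized_by_permutation[OF p(1)] p(2) by metis
  have "is_tree (fam 1 t) (hasse_adj (fam 1 t))"
  proof (rule laminar_imp_tree)
    have sub: "fam 1 t \<subseteq> Pow ?A" using fam_subset[OF t(1), of _ 1] t(2) by auto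
    show "finite (fam 1 t)" by (rule finite_subset[OF sub]) simp
    show "?A \<in> fam 1 t" using root_in_fam[of 1 t] t(2) by simp
    show "I \<subseteq> ?A" if "I \<in> fam 1 t" for I using sub that by blast
    show "{} \<notin> fam 1 t" by (rule fam_nonempty[OF t(1)])
    show "I \<subseteq> J \<or> J \<subseteq> I \<or> I \<inter> J = {}" if "I \<in> fam 1 t" "J \<in> fam 1 t" for I J
      using fam_laminar(1)[OF t(1) that] .
  qed simp
  then show "tree_interval_poset (fam 1 t)"
    unfolding tree_interval_poset_def interval_poset_def using n \<sigma> by blast
  show "card (minimal_elements (fam 1 t)) = n"
    using card_minimal_elements_ivals[OF p(1)] p(2) by simp
qed

lemma num_tree_posets_eq_card_trees: "num_tree_posets n = card (trees n)"
proof -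
  have "{P. tree_interval_poset P \<and> card (minimal_elements P) = n} = fam 1 ` trees n"
    using tree_poset_is_fam fam_is_tree_poset by blast
  moreover have "inj_on (fam 1) (trees n)"
    by (rule inj_onI) (use fam_inj(1) in \<open>auto simp: trees_def\<close>)
  ultimately show ?thesis unfolding num_tree_posets_def by (simp add: card_image)
qed

text \<open>Finiteness is inherited from the families of subsets of \<open>{0..<n}\<close>, since a forest is determined
  by its family.\<close>

lemma finite_forests: "finite (forests K n)"
proof (rule finite_imageD)
  show "inj_on (fams 0) (forests K n)"
    by (rule inj_onI) (use fam_inj(2) in \<open>auto simp: forests_def\<close>)
  have "fams 0 ` forests K n \<subseteq> Pow (Pow {0..<n})"
    using fams_subset[of _ _ 0] by (fastforce simp: forests_def)
  then show "finite (fams 0 ` forests K n)" by (rule finite_subset) simp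
qed

definition forest_fps :: "nat set \<Rightarrow> 'a::field_char_0 fps" where
  "forest_fps K = Abs_fps (\<lambda>n. of_nat (card (forests K n)))"

definition tree_fps :: "'a::field_char_0 fps" where
  "tree_fps = Abs_fps (\<lambda>n. of_nat (card (trees n)))"

lemma forests_Suc_image:
  "forests (Suc ` K) n = (\<Union>i\<in>{0..n}. (\<lambda>(t, ts). t # ts) ` (trees i \<times> forests K (n - i)))"
proof (intro equalityI subsetI)
  fix us assume us: "us \<in> forests (Suc ` K) n"
  then obtain t ts where "us = t # ts" by (cases us) (auto simp: forests_def)
  then show "us \<in> (\<Union>i\<in>{0..n}. (\<lambda>(t, ts). t # ts) ` (trees i \<times> forests K (n - i)))"
    using us by (intro UN_I[of "leaves t"]) (auto simp: forests_def trees_def)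
qed (auto simp: forests_def trees_def)

lemma finite_trees: "finite (trees n)"
proof (rule finite_imageD)
  show "inj_on (\<lambda>t. [t]) (trees n)" by (auto intro: inj_onI)
  have "(\<lambda>t. [t]) ` trees n \<subseteq> forests {1} n" by (auto simp: forests_def trees_def)
  then show "finite ((\<lambda>t. [t]) ` trees n)" using finite_forests finite_subset by blast
qed

text \<open>A non-empty forest is a first tree followed by a forest with one tree less.\<close>

lemma forest_fps_Suc_image: "forest_fps (Suc ` K) = tree_fps * forest_fps K"
proof (rule fps_ext)
  fix n
  have "card (forests (Suc ` K) n) =
      (\<Sum>i\<in>{0..n}. card ((\<lambda>(t, ts). t # ts) ` (trees i \<times> forests K (n - i))))"
    unfolding forests_Suc_image
  proof (rule card_UN_disjoint)
    show "\<forall>i\<in>{0..n}. finite ((\<lambda>(t, ts). t # ts) ` (trees i \<times> forests K (n - i)))"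
      using finite_trees finite_forests by blast
    show "\<forall>i\<in>{0..n}. \<forall>j\<in>{0..n}. i \<noteq> j \<longrightarrow> (\<lambda>(t, ts). t # ts) ` (trees i \<times> forests K (n - i)) \<inter>
        (\<lambda>(t, ts). t # ts) ` (trees j \<times> forests K (n - j)) = {}"
      by (auto simp: trees_def)
  qed simp
  also have "\<dots> = (\<Sum>i\<in>{0..n}. card (trees i) * card (forests K (n - i)))"
  proof (rule sum.cong)
    fix i
    have "inj_on (\<lambda>(t, ts). t # ts) (trees i \<times> forests K (n - i))" by (auto intro: inj_onI)
    then show "card ((\<lambda>(t, ts). t # ts) ` (trees i \<times> forests K (n - i))) =
        card (trees i) * card (forests K (n - i))"
      by (simp add: card_image card_cartesian_product)
  qed simp
  finally show "fps_nth (forest_fps (Suc ` K)) n = fps_nth (tree_fps * forest_fps K :: 'a fps) n"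
    by (simp add: forest_fps_def tree_fps_def fps_mult_nth)
qed

lemma forest_fps_singleton: "forest_fps {k} = tree_fps ^ k"
proof (induction k)
  case 0
  have "forests {0} n = (if n = 0 then {[]} else {})" for n by (auto simp: forests_def)
  then show ?case by (intro fps_ext) (simp add: forest_fps_def)
next
  case (Suc k)
  have "Suc ` {k} = {Suc k}" by simp
  then show ?case using forest_fps_Suc_image[of "{k}", where 'a = 'a] Suc.IH by simp
qed

lemma forest_fps_Un:
  assumes "K \<inter> L = {}"
  shows "forest_fps (K \<union> L) = forest_fps K + forest_fps L"
proof (rule fps_ext)
  fix n
  have "forests (K \<union> L) n = forests K n \<union> forests L n" by (auto simp: forests_def)
  moreover have "forests K n \<inter> forests L n = {}" using assms by (auto simp: forests_def)
  ultimately have "card (forests (K \<union> L) n) = card (forests K n) + card (forests L n)"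
    by (simp add: card_Un_disjoint finite_forests)
  then show "fps_nth (forest_fps (K \<union> L)) n = fps_nth (forest_fps K + forest_fps L :: 'a fps) n"
    by (simp add: forest_fps_def)
qed

lemma tree_fps_root: "tree_fps = fps_X + forest_fps ({2} \<union> {4..})"
proof (rule fps_ext)
  fix n
  have "trees n = (if n = 1 then {Leaf} else {}) \<union> Node ` forests ({2} \<union> {4..}) n"
  proof (rule set_eqI)
    fix t
    show "t \<in> trees n \<longleftrightarrow> t \<in> (if n = 1 then {Leaf} else {}) \<union> Node ` forests ({2} \<union> {4..}) n"
      by (cases t) (auto simp: trees_def forests_def)
  qed
  moreover have "card (Node ` forests ({2} \<union> {4..}) n) = card (forests ({2} \<union> {4..}) n)"
    by (intro card_image inj_onI) simp
  moreover have "card ((if n = 1 then {Leaf} else {}) \<union> Node ` forests ({2} \<union> {4..}) n) =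
      card (if n = 1 then {Leaf} else {}) + card (Node ` forests ({2} \<union> {4..}) n)"
    by (rule card_Un_disjoint) (auto simp: finite_forests)
  ultimately have "card (trees n) = (if n = 1 then 1 else 0) + card (forests ({2} \<union> {4..}) n)"
    by simp
  then show "fps_nth tree_fps n = fps_nth (fps_X + forest_fps ({2} \<union> {4..}) :: 'a fps) n"
    by (simp add: tree_fps_def forest_fps_def)
qed

text \<open>\<open>T = z + T\<^sup>2 + T\<^sup>4 / (1 - T)\<close>, with the denominator cleared.\<close>

lemma tree_fps_eq: "(1 - tree_fps) * (tree_fps - fps_X - tree_fps ^ 2) = (tree_fps ^ 4 :: 'a::field_char_0 fps)"
proof -
  let ?T = "tree_fps :: 'a fps" and ?S = "forest_fps {4..} :: 'a fps"
  have "?T = fps_X + forest_fps ({2} \<union> {4..})" by (rule tree_fps_root)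
  also have "forest_fps ({2} \<union> {4..}) = forest_fps {2} + ?S" by (rule forest_fps_Un) simp
  finally have "?T = fps_X + (?T ^ 2 + ?S)" by (simp only: forest_fps_singleton)
  then have T: "?T = fps_X + ?T ^ 2 + ?S" by (simp only: add.assoc)
  have "{4..} = {4} \<union> Suc ` {4..}"
  proof (rule set_eqI)
    fix x :: nat
    show "x \<in> {4..} \<longleftrightarrow> x \<in> {4} \<union> Suc ` {4..}" by (cases x) auto
  qed
  moreover have "{4} \<inter> Suc ` {4..} = {}" by auto
  ultimately have "?S = forest_fps {4} + forest_fps (Suc ` {4..})"
    using forest_fps_Un[of "{4}" "Suc ` {4..}", where 'a = 'a] by simp
  then have "?S = ?T ^ 4 + ?T * ?S" by (simp only: forest_fps_singleton forest_fps_Suc_image)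
  then have "?S - ?T * ?S = ?T ^ 4" by (metis add_diff_cancel_right')
  then have S: "(1 - ?T) * ?S = ?T ^ 4" by (simp only: left_diff_distrib mult_1_left)
  have "?T - (fps_X + ?T ^ 2) = ?S" using T by (metis add_diff_cancel_left')
  then have "?T - fps_X - ?T ^ 2 = ?S" by (simp only: diff_diff_eq)
  then show ?thesis using S by (simp only:)
qed

lemma tree_gf_eq_tree_fps: "tree_gf = tree_fps"
proof (rule fps_ext)
  fix n
  have "trees 0 = {}" using leaves_pos by (auto simp: trees_def)
  then show "fps_nth tree_gf n = fps_nth tree_fps n"
    by (cases n) (simp_all add: tree_gf_def tree_fps_def num_tree_posets_eq_card_trees)
qed

section \<open>Lagrange inversion\<close>

text \<open>Lagrange inversion: expand \<open>\<phi>\<^sup>n\<close> in powers of \<open>u\<close>, substitute \<open>u = T\<close> and divide by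
  \<open>T\<^sup>n\<close>; multiplied by \<open>T'\<close>, every term is the derivative of a power of \<open>T\<close> except the one with
  \<open>T' / T\<close>, so taking residues isolates one coefficient of \<open>\<phi>\<^sup>n\<close>.\<close>

lemma lagrange_inversion:
  fixes \<phi> T :: "'a::field_char_0 fps"
  assumes T: "T = fps_X * (\<phi> oo T)" and nz: "fps_nth \<phi> 0 \<noteq> 0" and n: "0 < n"
  shows "of_nat n * fps_nth T n = fps_nth (\<phi> ^ n) (n - 1)"
proof -
  have T0: "fps_nth T 0 = 0" by (subst T) simp
  have T1: "fps_nth T 1 = fps_nth \<phi> 0" by (subst T) (simp add: fps_compose_nth)
  define c where "c k = fps_nth (\<phi> ^ n) k" for k
  define R where "R = fps_shift n (\<phi> ^ n)"
  have cutoff: "fps_cutoff n (\<phi> ^ n) = (\<Sum>k<n. fps_const (c k) * fps_X ^ k)"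
    by (rule fps_ext) (simp add: fps_sum_nth c_def if_distrib cong: if_cong)
  have "\<phi> ^ n = R * fps_X ^ n + (\<Sum>k<n. fps_const (c k) * fps_X ^ k)"
    using fps_shift_cutoff[of n "\<phi> ^ n"] cutoff by (simp add: R_def)
  then have "(\<phi> ^ n) oo T = (R oo T) * T ^ n + (\<Sum>k<n. fps_const (c k) * T ^ k)"
    using T0 by (simp add: fps_compose_add_distrib fps_compose_sum_distrib fps_compose_mult_distrib
        fps_X_power_compose)
  then have "T ^ n = fps_X ^ n * ((R oo T) * T ^ n + (\<Sum>k<n. fps_const (c k) * T ^ k))"
    using T T0 by (metis fps_compose_power power_mult_distrib)
  then have "fps_to_fls (T ^ n) =
      fps_to_fls (fps_X ^ n * ((R oo T) * T ^ n + (\<Sum>k<n. fps_const (c k) * T ^ k)))" by simp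
  moreover define G where "G = fps_to_fls T"
  moreover define S where "S = fps_to_fls (R oo T)"
  moreover have "fps_to_fls (\<Sum>k<m. fps_const (c k) * T ^ k) = (\<Sum>k<m. fls_const (c k) * G ^ k)" for m
    by (induction m) (simp_all add: G_def fls_times_fps_to_fls fps_to_fls_power)
  ultimately have Gn: "G ^ n = fls_X ^ n * (S * G ^ n + (\<Sum>k<n. fls_const (c k) * G ^ k))"
    by (simp add: fls_times_fps_to_fls fps_to_fls_power)
  define H where "H = inverse G"
  define W where "W = inverse (fls_X :: 'a fls) ^ n"
  have "G \<noteq> 0" using T1 nz by (auto simp: G_def)
  then have GH: "G * H = 1" by (simp add: H_def)
  have XW: "W * fls_X ^ n = 1" by (simp add: W_def power_inverse)
  have "W = W * (G ^ n * H ^ n)" using GH by (simp flip: power_mult_distrib)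
  also have "\<dots> = (W * fls_X ^ n) * (S * (G ^ n * H ^ n) + (\<Sum>k<n. fls_const (c k) * (G ^ k * H ^ n)))"
    by (subst Gn) (simp add: algebra_simps sum_distrib_left)
  also have "\<dots> = S + (\<Sum>k<n. fls_const (c k) * H ^ (n - k))"
  proof -
    have "G ^ k * H ^ n = H ^ (n - k)" if "k < n" for k
    proof -
      have "H ^ n = H ^ k * H ^ (n - k)" using that by (simp flip: power_add)
      then have "G ^ k * H ^ n = (G * H) ^ k * H ^ (n - k)" by (simp add: power_mult_distrib mult.assoc)
      then show ?thesis by (simp add: GH)
    qed
    moreover have "G ^ n * H ^ n = 1" using GH by (simp flip: power_mult_distrib)
    ultimately show ?thesis using XW by simp
  qed
  finally have W: "W = S + (\<Sum>k<n. fls_const (c k) * H ^ (n - k))" .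
  define G' where "G' = fls_deriv G"
  have H': "fls_deriv H = - (G' * H ^ 2)"
  proof -
    have "fls_deriv (G * H) = 0" using GH by simp
    then have "G' * H + G * fls_deriv H = 0" by (simp add: G'_def add.commute)
    then have *: "G * fls_deriv H = - (G' * H)" by (metis add.commute eq_neg_iff_add_eq_0)
    have "fls_deriv H = (G * H) * fls_deriv H" by (simp only: GH mult_1_left)
    also have "\<dots> = H * (G * fls_deriv H)" by (simp only: ac_simps)
    also have "\<dots> = - (G' * H ^ 2)" unfolding * by (simp add: power2_eq_square ac_simps)
    finally show ?thesis .
  qed
  have res0: "fls_residue (H ^ (n - k) * G') = 0" if "Suc k < n" for k
  proof -
    define m where "m = n - k - 2"
    have m: "n - k = Suc (Suc m)" using that by (simp add: m_def)
    have "fls_deriv (H ^ Suc m) = - (of_nat (Suc m) * (H ^ (n - k) * G'))"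
      unfolding fls_deriv_power H' m by (simp add: power2_eq_square ac_simps)
    then have "fls_residue (of_nat (Suc m) * (H ^ (n - k) * G')) = 0"
      using fls_residue_deriv[of "H ^ Suc m"] by (simp del: of_nat_Suc)
    then have "of_nat (Suc m) * fls_residue (H ^ (n - k) * G') = 0"
      by (metis fls_residue_of_int_times(1) of_int_of_nat_eq)
    then show ?thesis by (simp del: of_nat_Suc)
  qed
  have "fls_subdegree G = 1" unfolding G_def
  proof (rule fls_subdegree_eqI)
    show "fls_nth (fps_to_fls T) 1 \<noteq> 0" using T1 nz by simp
    show "fls_nth (fps_to_fls T) k = 0" if "k < 1" for k using that T0 by (cases "k = 0") auto
  qed
  then have res1: "fls_residue (H * G') = 1"
    unfolding H_def G'_def by (subst fls_residue_deriv_times_inverse_eq_subdegree) simp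
  have "fls_residue (W * G') = of_nat n * fps_nth T n"
  proof -
    have "W * G' = fls_shift n G'"
      unfolding W_def fls_inverse_X by (simp add: fls_X_inv_power_times_conv_shift)
    then show ?thesis using n by (simp add: G'_def G_def)
  qed
  moreover have "fls_residue (W * G') = c (n - 1)"
  proof -
    have "fls_residue (S * G') = 0"
      by (simp add: S_def G'_def G_def fls_deriv_fps_to_fls flip: fls_times_fps_to_fls)
    moreover have "fls_residue (0 :: 'a fls) = 0" by simp
    then have "fls_residue ((\<Sum>k<m. fls_const (c k) * H ^ (n - k)) * G') =
        (\<Sum>k<m. c k * fls_residue (H ^ (n - k) * G'))" for m
      by (induction m) (simp_all add: distrib_right fls_residue_add mult.assoc
          fls_residue_fls_const_times del: fls_residue_def fls_times_nth)
    moreover have "(\<Sum>k<n. c k * fls_residue (H ^ (n - k) * G')) =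
        (\<Sum>k<n. if k = n - 1 then c k else 0)"
    proof (rule sum.cong)
      fix k assume k: "k \<in> {..<n}"
      show "c k * fls_residue (H ^ (n - k) * G') = (if k = n - 1 then c k else 0)"
      proof (cases "k = n - 1")
        case True
        then have "n - k = 1" using n by simp
        then show ?thesis using True res1 by simp
      next
        case False
        then show ?thesis using res0[of k] k by simp
      qed
    qed simp
    ultimately show ?thesis using n unfolding W by (simp add: distrib_right)
  qed
  ultimately show ?thesis by (simp add: c_def)
qed

section \<open>The inverse function of the generating function, and the constants\<close>

text \<open>The equation \<open>T = z + \<Lambda>(T)\<close> says that \<open>T\<close> is the inverse function of \<open>\<psi>(u) = u - \<Lambda>(u)\<close>.  It is
  used for real and for complex arguments.\<close>

definition psi :: "'a::field \<Rightarrow> 'a" where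
  "psi u = u - (u ^ 2 + u ^ 4 / (1 - u))"

lemma psi_alt: "u \<noteq> 1 \<Longrightarrow> psi u = 2 * u + 1 + u ^ 3 - 1 / (1 - u)"
  unfolding psi_def
  by (simp add: divide_simps) (simp add: algebra_simps power2_eq_square power3_eq_cube power4_eq_xxxx)

lemma Lam_alt: "u \<noteq> 1 \<Longrightarrow> Lam u = 1 / (1 - u) - 1 - u - u ^ 3"
  unfolding Lam_def
  by (simp add: divide_simps) (simp add: algebra_simps power2_eq_square power3_eq_cube power4_eq_xxxx)

lemma deriv_Lam:
  assumes "u < 1"
  shows "deriv Lam u = 1 / (1 - u) ^ 2 - 1 - 3 * u ^ 2"
proof (rule DERIV_imp_deriv)
  have "((\<lambda>u. 1 / (1 - u) - 1 - u - u ^ 3) has_field_derivative 1 / (1 - u) ^ 2 - 1 - 3 * u ^ 2) (at u)"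
    using assms by (auto intro!: derivative_eq_intros simp: power2_eq_square)
  then show "(Lam has_field_derivative 1 / (1 - u) ^ 2 - 1 - 3 * u ^ 2) (at u)"
    by (rule has_field_derivative_transform_within_open[where S = "{..<1}"])
      (use assms Lam_alt in auto)
qed

lemma has_real_derivative_deriv_Lam:
  assumes "u < 1"
  shows "((\<lambda>u::real. 1 / (1 - u) ^ 2 - 1 - 3 * u ^ 2) has_real_derivative 2 / (1 - u) ^ 3 - 6 * u) (at u)"
proof -
  have d: "((\<lambda>u. 1 / (1 - u)) has_real_derivative 1 / (1 - u) ^ 2) (at u)"
    using assms by (auto intro!: derivative_eq_intros simp: power2_eq_square)
  have "((\<lambda>u. (1 / (1 - u)) ^ 2) has_real_derivative 2 * (1 / (1 - u)) * (1 / (1 - u) ^ 2)) (at u)"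
    using DERIV_power[OF d, of 2] by (simp add: ac_simps)
  moreover have "((\<lambda>u. 1 + 3 * u ^ 2) has_real_derivative 6 * u) (at u)"
    by (auto intro!: derivative_eq_intros)
  ultimately have "((\<lambda>u. (1 / (1 - u)) ^ 2 - (1 + 3 * u ^ 2)) has_real_derivative
      2 * (1 / (1 - u)) * (1 / (1 - u) ^ 2) - 6 * u) (at u)" by (rule DERIV_diff)
  then show ?thesis
    by (simp add: power_divide power3_eq_cube power2_eq_square diff_diff_eq mult.assoc)
qed

lemma deriv2_Lam:
  assumes "u < 1"
  shows "(deriv ^^ 2) Lam u = 2 / (1 - u) ^ 3 - 6 * u"
proof -
  have "(deriv Lam has_field_derivative 2 / (1 - u) ^ 3 - 6 * u) (at u)"
    using has_real_derivative_deriv_Lam[OF assms]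
    by (rule has_field_derivative_transform_within_open[where S = "{..<1}"])
      (use assms deriv_Lam in auto)
  then show ?thesis by (simp add: numeral_2_eq_2 DERIV_imp_deriv)
qed

lemma deriv_Lam_strict_mono:
  assumes "0 < x" "x < y" "y < (1::real)"
  shows "1 / (1 - x) ^ 2 - 1 - 3 * x ^ 2 < 1 / (1 - y) ^ 2 - 1 - 3 * y ^ 2"
proof (rule DERIV_pos_imp_increasing[OF assms(2)])
  fix u assume u: "x \<le> u" "u \<le> y"
  let ?f = "\<lambda>u::real. 1 / (1 - u) ^ 2 - 1 - 3 * u ^ 2"
  have u01: "0 < u" "u < 1" using u assms by auto
  have "(?f has_real_derivative 2 / (1 - u) ^ 3 - 6 * u) (at u)"
    using u01 by (intro has_real_derivative_deriv_Lam) simp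
  moreover have "3 * u * (1 - u) ^ 3 < 1"
  proof -
    have "3 * u * (1 - u) ^ 3 \<le> 3 * (u * (1 - u)) * 1"
      using u01 by (simp add: power3_eq_cube mult_le_one mult.assoc)
    also have "3 * (u * (1 - u)) * 1 < 1"
    proof -
      have "0 \<le> (u - 1 / 2) ^ 2" by simp
      then show ?thesis by (simp add: power2_eq_square algebra_simps)
    qed
    finally show ?thesis .
  qed
  then have "0 < 2 / (1 - u) ^ 3 - 6 * u" using u01 by (simp add: field_simps)
  ultimately show "\<exists>D. (?f has_real_derivative D) (at u) \<and> 0 < D" by blast
qed

text \<open>The bounds on \<open>\<tau>\<close> are the end points for the intermediate value theorem; they are tight enough
  for all numerical claims.\<close>

lemma ex1_deriv_Lam_eq_1: "\<exists>!u. u \<in> {0<..<1} \<and> deriv Lam u = 1"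
  and tau_bounds: "0.35012 < tau" "tau < 0.35013"
  and tau_eq: "1 / (1 - tau) ^ 2 = 2 + 3 * tau ^ 2"
proof -
  let ?f = "\<lambda>u::real. 1 / (1 - u) ^ 2 - 1 - 3 * u ^ 2"
  have "\<exists>u\<ge>0.35012. u \<le> 0.35013 \<and> ?f u = 1"
  proof (rule IVT')
    show "?f 0.35012 \<le> 1" "1 \<le> ?f 0.35013" by (simp_all add: power2_eq_square)
    show "continuous_on {0.35012..0.35013} ?f" by (intro continuous_intros) auto
  qed simp
  then obtain u where u: "0.35012 \<le> u" "u \<le> 0.35013" "?f u = 1" by blast
  have "?f 0.35012 \<noteq> 1" "?f 0.35013 \<noteq> 1" by (simp_all add: power2_eq_square)
  then have ne: "u \<noteq> 0.35012" "u \<noteq> 0.35013" using u(3) by metis+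
  have iff: "v \<in> {0<..<1} \<and> deriv Lam v = 1 \<longleftrightarrow> v = u" for v
  proof
    assume v: "v \<in> {0<..<1} \<and> deriv Lam v = 1"
    then have "?f v = 1" using deriv_Lam[of v] by simp
    then show "v = u"
      using deriv_Lam_strict_mono[of u v] deriv_Lam_strict_mono[of v u] u v
      by (cases u v rule: linorder_cases) auto
  next
    assume "v = u"
    then show "v \<in> {0<..<1} \<and> deriv Lam v = 1" using u deriv_Lam[of u] by simp
  qed
  show "\<exists>!u. u \<in> {0<..<1} \<and> deriv Lam u = 1" unfolding iff by simp
  have "tau = u" unfolding tau_def iff by simp
  then show "0.35012 < tau" "tau < 0.35013" "1 / (1 - tau) ^ 2 = 2 + 3 * tau ^ 2"
    using u ne by simp_all
qed

text \<open>Half of \<open>\<Lambda>''(\<tau>)\<close>.\<close>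

definition curv :: real where "curv = 1 / (1 - tau) ^ 3 - 3 * tau"

lemma deriv2_Lam_tau: "(deriv ^^ 2) Lam tau = 2 * curv"
  using deriv2_Lam[of tau] tau_bounds by (simp add: curv_def)

text \<open>Because \<open>\<Lambda>'(\<tau>) = 1\<close>, the point \<open>\<tau>\<close> is a double zero of \<open>\<rho> - \<psi>\<close>; this is the
  cofactor.\<close>

definition cofactor :: "'a::real_normed_field \<Rightarrow> 'a" where
  "cofactor u = 1 / ((1 - u) * (1 - of_real tau) ^ 2) - u - 2 * of_real tau"

lemma rho_eq_psi: "rho = psi tau"
  by (simp add: rho_def psi_def Lam_def)

lemma rho_minus_psi:
  fixes u :: "'a::real_normed_field"
  assumes "u \<noteq> 1"
  shows "of_real rho - psi u = (u - of_real tau) ^ 2 * cofactor u"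
proof -
  let ?t = "of_real tau :: 'a"
  define A where "A = 1 / (1 - u)"
  define B where "B = 1 / (1 - ?t)"
  have "of_real tau \<noteq> (of_real 1 :: 'a)" using tau_bounds unfolding of_real_eq_iff by simp
  then have t1: "?t \<noteq> 1" by simp
  have "B ^ 2 = of_real (1 / (1 - tau) ^ 2)" by (simp add: B_def power_divide)
  then have BB: "B * B = 2 + 3 * ?t ^ 2" unfolding tau_eq by (simp add: power2_eq_square)
  have AB: "A - B = (u - ?t) * (A * B)" using assms t1 by (simp add: A_def B_def field_simps)
  have "of_real rho = psi ?t" by (simp add: rho_eq_psi psi_def)
  then have rho: "of_real rho = 2 * ?t + 1 + ?t ^ 3 - B" using psi_alt[OF t1] by (simp add: B_def)
  have psi: "psi u = 2 * u + 1 + u ^ 3 - A" using psi_alt[OF assms] by (simp add: A_def)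
  have cof: "cofactor u = A * (B * B) - u - 2 * ?t"
    by (simp add: cofactor_def A_def B_def power2_eq_square)
  have "(u - ?t) ^ 2 * (A * (B * B)) = (u - ?t) * B * ((u - ?t) * (A * B))"
    by (simp add: power2_eq_square ac_simps)
  also have "\<dots> = (u - ?t) * B * (A - B)" by (simp only: AB)
  also have "\<dots> = (u - ?t) * (A * B) - (u - ?t) * (B * B)" by (simp add: algebra_simps)
  also have "\<dots> = A - B - (u - ?t) * (2 + 3 * ?t ^ 2)" by (simp only: AB BB)
  finally have *: "(u - ?t) ^ 2 * (A * (B * B)) = A - B - (u - ?t) * (2 + 3 * ?t ^ 2)" .
  have "(u - ?t) ^ 2 * cofactor u = A - B - (u - ?t) * (2 + 3 * ?t ^ 2) - (u - ?t) ^ 2 * (u + 2 * ?t)"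
    unfolding cof *[symmetric] by (simp add: algebra_simps)
  also have "\<dots> = of_real rho - psi u"
    unfolding rho psi by (simp add: algebra_simps power2_eq_square power3_eq_cube)
  finally show ?thesis by simp
qed

lemma cofactor_tau: "cofactor (of_real tau) = (of_real curv :: 'a::real_normed_field)"
  by (simp add: cofactor_def curv_def power3_eq_cube power2_eq_square)

lemma curv_bounds: "2.5929 < curv" "curv < 2.5932"
proof -
  have "1 / (1 - tau) ^ 3 = (2 + 3 * tau ^ 2) * (1 / (1 - tau))"
    unfolding tau_eq[symmetric] by (simp add: power3_eq_cube power2_eq_square)
  moreover have "1 / (1 - tau) \<le> 1 / (1 - 0.35013)" "1 / (1 - 0.35012) \<le> 1 / (1 - tau)"
    using tau_bounds by (intro divide_left_mono; simp)+
  moreover have "tau ^ 2 \<le> 0.35013 ^ 2" "0.35012 ^ 2 \<le> tau ^ 2"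
    using tau_bounds by (intro power_mono; simp)+
  then have "2 + 3 * tau ^ 2 \<le> 2 + 3 * 0.35013 ^ 2" "2 + 3 * 0.35012 ^ 2 \<le> 2 + 3 * tau ^ 2"
    by linarith+
  ultimately have "1 / (1 - tau) ^ 3 \<le> (2 + 3 * 0.35013 ^ 2) * (1 / (1 - 0.35013))"
      "(2 + 3 * 0.35012 ^ 2) * (1 / (1 - 0.35012)) \<le> 1 / (1 - tau) ^ 3"
    using tau_bounds by (simp_all only:) (rule mult_mono; simp)+
  then show "2.5929 < curv" "curv < 2.5932"
    using tau_bounds unfolding curv_def by (simp_all add: power2_eq_square)
qed

lemma cofactor_ge_1:
  fixes u :: real
  assumes "0 \<le> u" "u \<le> tau"
  shows "1 \<le> cofactor u"
proof -
  have "1 + u \<le> 1 / (1 - u)"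
    using assms tau_bounds by (simp add: field_simps)
  moreover have "2 \<le> 1 / (1 - tau) ^ 2" by (simp add: tau_eq)
  ultimately have "(1 + u) * 2 \<le> 1 / (1 - u) * (1 / (1 - tau) ^ 2)"
    using assms tau_bounds by (intro mult_mono) auto
  then show ?thesis using assms tau_bounds by (simp add: cofactor_def)
qed

text \<open>Since \<open>\<psi>\<close> is stationary at \<open>\<tau>\<close>, replacing \<open>\<tau>\<close> by a number at distance at most \<open>10\<close> to the power
  \<open>-5\<close> changes \<open>\<rho>\<close> by less than \<open>10\<close> to the power \<open>-9\<close>.\<close>

lemma rho_bounds: "0.2044134 < rho" "rho < 0.2044136"
proof -
  have *: "rho - psi 0.35012 = (0.35012 - tau) ^ 2 * cofactor (0.35012::real)"
    using rho_minus_psi[of "0.35012::real"] by simp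
  have "tau ^ 2 \<le> 0.35013 ^ 2" using tau_bounds by (intro power_mono; simp)
  then have "1 / (1 - 0.35012) * (2 + 3 * tau ^ 2) \<le> 1 / (1 - 0.35012) * (2 + 3 * 0.35013 ^ 2)"
    by (intro mult_left_mono) auto
  moreover have "cofactor 0.35012 = 1 / (1 - 0.35012) * (1 / (1 - tau) ^ 2) - 0.35012 - 2 * tau"
    by (simp add: cofactor_def)
  ultimately have "cofactor (0.35012::real) \<le>
      1 / (1 - 0.35012) * (2 + 3 * 0.35013 ^ 2) - 0.35012 - 2 * tau" unfolding tau_eq by linarith
  also have "\<dots> \<le> 4" using tau_bounds by (simp add: power2_eq_square)
  finally have c: "cofactor (0.35012::real) \<le> 4" .
  have "\<bar>0.35012 - tau\<bar> \<le> 0.00001" using tau_bounds by simp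
  then have "(0.35012 - tau) ^ 2 \<le> 0.00001 ^ 2" by (rule power2_le_iff_abs_le[THEN iffD2, rotated]) simp
  then have "(0.35012 - tau) ^ 2 * cofactor (0.35012::real) \<le> 0.00001 ^ 2 * 4"
    using c cofactor_ge_1[of "0.35012"] tau_bounds by (intro mult_mono) auto
  moreover have "0 \<le> (0.35012 - tau) ^ 2 * cofactor (0.35012::real)"
    using cofactor_ge_1[of "0.35012"] tau_bounds by simp
  ultimately have "psi 0.35012 \<le> rho" "rho \<le> psi 0.35012 + 0.00001 ^ 2 * 4" using * by linarith+
  then show "0.2044134 < rho" "rho < 0.2044136"
    by (simp_all add: psi_def power2_eq_square power4_eq_xxxx)
qed

lemma numerics:
  "\<bar>tau - 0.3501\<bar> \<le> 0.00005" "\<bar>rho - 0.2044\<bar> \<le> 0.00005" "\<bar>1 / rho - 4.8920\<bar> \<le> 0.00005"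
  "\<bar>sqrt (2 * rho / (deriv ^^ 2) Lam tau) - 0.2808\<bar> \<le> 0.00005"
  "\<bar>sqrt (rho / (2 * pi * (deriv ^^ 2) Lam tau)) - 0.0792\<bar> \<le> 0.00005"
proof -
  show "\<bar>tau - 0.3501\<bar> \<le> 0.00005" "\<bar>rho - 0.2044\<bar> \<le> 0.00005"
    using tau_bounds rho_bounds by (simp_all add: abs_le_iff)
  have "1 / rho \<le> 1 / 0.2044134" "1 / 0.2044136 \<le> 1 / rho"
    using rho_bounds by (intro divide_left_mono; simp)+
  then show "\<bar>1 / rho - 4.8920\<bar> \<le> 0.00005" by (simp add: abs_le_iff)
  have sqrt_approx: "\<bar>sqrt x - y\<bar> \<le> e" if "(y - e) ^ 2 \<le> x" "x \<le> (y + e) ^ 2" "0 \<le> y + e" for x y e :: real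
    using real_le_rsqrt[OF that(1)] real_le_lsqrt[OF that(3,2)] by (simp add: abs_le_iff)
  have q: "rho / curv \<le> 0.2044136 / 2.5929" "0.2044134 / 2.5932 \<le> rho / curv"
    using rho_bounds curv_bounds by (intro frac_le; simp)+
  have "\<bar>sqrt (rho / curv) - 0.2808\<bar> \<le> 0.00005"
    by (rule sqrt_approx) (use q in \<open>simp_all add: power2_eq_square\<close>)
  then show "\<bar>sqrt (2 * rho / (deriv ^^ 2) Lam tau) - 0.2808\<bar> \<le> 0.00005"
    by (simp add: deriv2_Lam_tau)
  have p: "3.1415 < pi" "pi < 3.1416" using pi_approx by auto
  have r: "rho / curv / (4 * pi) \<le> 0.2044136 / 2.5929 / (4 * 3.1415)"
      "0.2044134 / 2.5932 / (4 * 3.1416) \<le> rho / curv / (4 * pi)"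
    using q p rho_bounds curv_bounds by (intro frac_le; simp)+
  have "\<bar>sqrt (rho / curv / (4 * pi)) - 0.0792\<bar> \<le> 0.00005"
    by (rule sqrt_approx) (use r in \<open>simp_all add: power2_eq_square\<close>)
  moreover have "rho / (2 * pi * (deriv ^^ 2) Lam tau) = rho / curv / (4 * pi)"
    by (simp add: deriv2_Lam_tau)
  ultimately show "\<bar>sqrt (rho / (2 * pi * (deriv ^^ 2) Lam tau)) - 0.0792\<bar> \<le> 0.00005"
    by (simp only:)
qed

section \<open>Laplace's method\<close>

lemma integrable_exp_neg_square:
  assumes "0 < (b::real)"
  shows "integrable lborel (\<lambda>s. exp (- (b * s ^ 2)))"
    and "integral\<^sup>L lborel (\<lambda>s. exp (- (b * s ^ 2))) = sqrt (pi / b)"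
proof -
  define \<sigma> where "\<sigma> = sqrt (1 / (2 * b))"
  have s2: "\<sigma> ^ 2 = 1 / (2 * b)" using assms by (simp add: \<sigma>_def)
  have "0 < \<sigma>" using assms by (simp add: \<sigma>_def)
  have *: "exp (- (b * s ^ 2)) = sqrt (pi / b) * normal_density 0 \<sigma> s" for s
    using assms by (simp add: normal_density_def s2 field_simps)
  show "integrable lborel (\<lambda>s. exp (- (b * s ^ 2)))"
    unfolding * using \<open>0 < \<sigma>\<close> by (intro integrable_mult_right integrable_normal_density) simp
  show "integral\<^sup>L lborel (\<lambda>s. exp (- (b * s ^ 2))) = sqrt (pi / b)"
    unfolding * using \<open>0 < \<sigma>\<close> by simp
qed

text \<open>Laplace's method: after the substitution \<open>t = s / \<surd>n\<close> the integrand converges to a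
  Gaussian and is dominated by one.\<close>

lemma laplace_method:
  fixes a g :: "real \<Rightarrow> complex"
  assumes cont_a: "continuous_on {-d..d} a" and cont_g: "continuous_on {-d..d} g"
    and d: "0 < d" and b: "0 < b" and c: "0 < c"
    and a_le: "\<And>t. \<bar>t\<bar> \<le> d \<Longrightarrow> norm (a t) \<le> 1"
    and g_le: "\<And>t. \<bar>t\<bar> \<le> d \<Longrightarrow> norm (g t) \<le> exp (- (c * t ^ 2))"
    and g_lim: "((\<lambda>t. (g t - 1) / of_real (t ^ 2)) \<longlongrightarrow> - of_real b) (at 0)"
  shows "(\<lambda>n. of_real (sqrt (real n)) * integral {-d..d} (\<lambda>t. a t * g t ^ n))
           \<longlonglongrightarrow> a 0 * of_real (sqrt (pi / b))"
proof (rule LIMSEQ_imp_Suc)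
  define F where "F n t = indicator {-d..d} t *\<^sub>R (a t * g t ^ n)" for n t
  define r where "r n = sqrt (real (Suc n))" for n
  have r_pos: "0 < r n" for n by (simp add: r_def)
  have r2: "r n ^ 2 = real (Suc n)" for n by (simp add: r_def)
  have F_int: "integrable lborel (F n)" and
    F_eq: "integral {-d..d} (\<lambda>t. a t * g t ^ n) = integral\<^sup>L lborel (F n)" for n
  proof -
    have "set_integrable lborel {-d..d} (\<lambda>t. a t * g t ^ n)"
      using cont_a cont_g by (intro borel_integrable_atLeastAtMost' continuous_intros)
    then show "integrable lborel (F n)"
      "integral {-d..d} (\<lambda>t. a t * g t ^ n) = integral\<^sup>L lborel (F n)"
      using set_borel_integral_eq_integral(2)[of "{-d..d}" "\<lambda>t. a t * g t ^ n"]
      by (simp_all add: F_def[abs_def] set_integrable_def set_lebesgue_integral_def)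
  qed
  have subst: "of_real (r n) * integral\<^sup>L lborel (F k) = integral\<^sup>L lborel (\<lambda>s. F k (s / r n))" for n k
    using lborel_integral_real_affine[of "1 / r n" "F k" 0] r_pos[of n]
    by (simp add: field_simps scaleR_conv_of_real)
  have "(\<lambda>n. integral\<^sup>L lborel (\<lambda>s. F (Suc n) (s / r n)))
      \<longlonglongrightarrow> integral\<^sup>L lborel (\<lambda>s. a 0 * of_real (exp (- (b * s ^ 2))))"
  proof (rule integral_dominated_convergence[where w = "\<lambda>s. exp (- (c * s ^ 2))"])
    show "integrable lborel (\<lambda>s. exp (- (c * s ^ 2)))"
      by (rule integrable_exp_neg_square(1)[OF c])
    show "(\<lambda>s. a 0 * of_real (exp (- (b * s ^ 2)))) \<in> borel_measurable lborel"
      by measurable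
    show "(\<lambda>s. F (Suc n) (s / r n)) \<in> borel_measurable lborel" for n
    proof -
      have "F (Suc n) \<in> borel_measurable borel"
        using borel_measurable_integrable[OF F_int[of "Suc n"]] by simp
      then show ?thesis by measurable
    qed
    show "AE s in lborel. norm (F (Suc n) (s / r n)) \<le> exp (- (c * s ^ 2))" for n
    proof (rule AE_I2)
      fix s
      show "norm (F (Suc n) (s / r n)) \<le> exp (- (c * s ^ 2))"
      proof (cases "\<bar>s / r n\<bar> \<le> d")
        case True
        have "norm (a (s / r n)) * norm (g (s / r n)) ^ Suc n \<le> 1 * exp (- (c * (s / r n) ^ 2)) ^ Suc n"
          using a_le[OF True] g_le[OF True] by (intro mult_mono power_mono) auto
        also have "exp (- (c * (s / r n) ^ 2)) ^ Suc n = exp (- (c * s ^ 2))"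
          by (subst exp_of_nat_mult[symmetric]) (simp add: power_divide r2 del: of_nat_Suc)
        finally have "norm (a (s / r n) * g (s / r n) ^ Suc n) \<le> exp (- (c * s ^ 2))"
          by (simp only: norm_mult norm_power mult_1_left)
        moreover have "s / r n \<in> {-d..d}" using True unfolding atLeastAtMost_iff by linarith
        ultimately show ?thesis by (simp only: F_def indicator_simps scaleR_one)
      next
        case False
        then have "s / r n \<notin> {-d..d}" by (auto simp: abs_le_iff)
        then show ?thesis by (simp only: F_def indicator_simps) simp
      qed
    qed
    show "AE s in lborel. (\<lambda>n. F (Suc n) (s / r n)) \<longlonglongrightarrow> a 0 * of_real (exp (- (b * s ^ 2)))"
    proof (rule AE_I2)
      fix s :: real
      have r_top: "filterlim r at_top sequentially"
        unfolding r_def by (intro filterlim_compose[OF sqrt_at_top]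
            filterlim_compose[OF filterlim_real_sequentially] filterlim_Suc)
      have s0: "(\<lambda>n. s / r n) \<longlonglongrightarrow> 0"
        by (rule tendsto_divide_0[OF tendsto_const filterlim_at_top_imp_at_infinity[OF r_top]])
      have ev: "eventually (\<lambda>n. \<bar>s / r n\<bar> < d) sequentially"
        using s0 d by (auto simp: tendsto_iff dist_real_def)
      then have mem: "eventually (\<lambda>n. s / r n \<in> {-d..d}) sequentially"
      proof eventually_elim
        case (elim n)
        then show ?case unfolding atLeastAtMost_iff by linarith
      qed
      have "(\<lambda>n. a (s / r n)) \<longlonglongrightarrow> a 0"
        by (rule continuous_on_tendsto_compose[OF cont_a s0 _ mem]) (use d in auto)
      moreover have "(\<lambda>n. g (s / r n) ^ Suc n) \<longlonglongrightarrow> of_real (exp (- (b * s ^ 2)))"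
      proof (cases "s = 0")
        \<comment> \<open>The hypothesis on \<open>(g t - 1) / t\<^sup>2\<close> forces \<open>g 0 = 1\<close>.\<close>
        case True
        have "isCont g 0" using continuous_on_interior[OF cont_g, of 0] d by auto
        moreover have "((\<lambda>t. (g t - 1) / of_real (t ^ 2) * of_real (t ^ 2)) \<longlongrightarrow> - of_real b * of_real (0 ^ 2)) (at 0)"
          by (intro tendsto_mult g_lim tendsto_of_real tendsto_power tendsto_ident_at)
        then have "((\<lambda>t. g t - 1) \<longlongrightarrow> - of_real b * of_real (0 ^ 2)) (at 0)"
          by (rule Lim_transform_eventually) (auto simp: eventually_at_filter)
        then have "((\<lambda>t. g t - 1) \<longlongrightarrow> 0) (at 0)" by simp
        then have "(g \<longlongrightarrow> 1) (at 0)" by (simp add: LIM_zero_iff)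
        ultimately have "g 0 = 1" by (meson LIM_unique isCont_def)
        then show ?thesis using True by simp
      next
        case False
        \<comment> \<open>Compare with a Gaussian: two numbers in the unit disc that differ by \<open>o(1 / n)\<close> have
          \<open>n\<close>-th powers that differ by \<open>o(1)\<close>.\<close>
        define e where "e t = (of_real (exp (- (b * t ^ 2))) :: complex)" for t :: real
        have "((\<lambda>t. (exp (- (b * t ^ 2)) - 1) / t ^ 2) \<longlongrightarrow> - b) (at (0::real))"
        proof -
          have "((\<lambda>x. (exp x - 1) / x) \<longlongrightarrow> 1) (at (0::real))"
            using DERIV_exp[of "0::real"] by (simp add: has_field_derivative_iff)
          moreover have "filterlim (\<lambda>t. - (b * t ^ 2)) (at 0) (at (0::real))"
          proof (rule filterlim_atI)
            have "((\<lambda>t. - (b * t ^ 2)) \<longlongrightarrow> - (b * 0 ^ 2)) (at (0::real))" by (intro tendsto_intros)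
            then show "((\<lambda>t. - (b * t ^ 2)) \<longlongrightarrow> 0) (at (0::real))" by simp
            show "eventually (\<lambda>t. - (b * t ^ 2) \<noteq> 0) (at (0::real))"
              using b by (auto simp: eventually_at_filter)
          qed
          ultimately have "((\<lambda>t. (exp (- (b * t ^ 2)) - 1) / - (b * t ^ 2)) \<longlongrightarrow> 1) (at (0::real))"
            by (rule filterlim_compose)
          then have "((\<lambda>t. (exp (- (b * t ^ 2)) - 1) / - (b * t ^ 2) * - b) \<longlongrightarrow> 1 * - b) (at (0::real))"
            by (rule tendsto_mult[OF _ tendsto_const])
          moreover have "(exp (- (b * t ^ 2)) - 1) / - (b * t ^ 2) * - b = (exp (- (b * t ^ 2)) - 1) / t ^ 2" for t
            using b by (simp add: divide_simps)
          ultimately show ?thesis by (simp only: mult_1_left)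
        qed
        from tendsto_of_real[OF this, where 'a = complex]
        have "((\<lambda>t. (e t - 1) / of_real (t ^ 2)) \<longlongrightarrow> - of_real b) (at 0)" by (simp add: e_def)
        from tendsto_diff[OF g_lim this]
        have lim: "((\<lambda>t. (g t - e t) / of_real (t ^ 2)) \<longlongrightarrow> 0) (at 0)"
          by (simp add: diff_divide_distrib[symmetric])
        have "filterlim (\<lambda>n. s / r n) (at 0) sequentially"
          using False r_pos by (intro filterlim_atI s0) (auto simp: less_imp_neq[symmetric])
        from filterlim_compose[OF lim this]
        have "(\<lambda>n. (g (s / r n) - e (s / r n)) / of_real ((s / r n) ^ 2)) \<longlonglongrightarrow> 0" .
        then have "(\<lambda>n. norm ((g (s / r n) - e (s / r n)) / of_real ((s / r n) ^ 2)) * s ^ 2) \<longlonglongrightarrow> 0 * s ^ 2"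
          by (intro tendsto_mult tendsto_const tendsto_norm_zero)
        moreover have "norm ((g (s / r n) - e (s / r n)) / of_real ((s / r n) ^ 2)) * s ^ 2 =
            real (Suc n) * norm (g (s / r n) - e (s / r n))" for n
        proof -
          have "norm (of_real ((s / r n) ^ 2) :: complex) = s ^ 2 / real (Suc n)"
            unfolding norm_of_real by (simp add: power_divide r2 del: of_nat_Suc)
          then show ?thesis unfolding norm_divide using False by (simp del: of_nat_Suc)
        qed
        ultimately have lim0: "(\<lambda>n. real (Suc n) * norm (g (s / r n) - e (s / r n))) \<longlonglongrightarrow> 0" by simp
        have "(\<lambda>n. g (s / r n) ^ Suc n - e (s / r n) ^ Suc n) \<longlonglongrightarrow> 0"
        proof (rule Lim_null_comparison[OF _ lim0])
          show "eventually (\<lambda>n. norm (g (s / r n) ^ Suc n - e (s / r n) ^ Suc n) \<le>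
              real (Suc n) * norm (g (s / r n) - e (s / r n))) sequentially"
            using ev
          proof eventually_elim
            case (elim n)
            have "norm (g (s / r n)) \<le> 1"
            proof -
              have "exp (- (c * (s / r n) ^ 2)) \<le> 1" using c by simp
              then show ?thesis using g_le[of "s / r n"] elim by linarith
            qed
            moreover have "norm (e (s / r n)) \<le> 1" using b by (simp add: e_def)
            ultimately show ?case by (rule norm_power_diff)
          qed
        qed
        moreover have "e (s / r n) ^ Suc n = of_real (exp (- (b * s ^ 2)))" for n
          unfolding e_def of_real_power[symmetric]
          by (subst exp_of_nat_mult[symmetric]) (simp add: power_divide r2 del: of_nat_Suc)
        ultimately show ?thesis by (simp only: LIM_zero_iff)
      qed
      ultimately have lim: "(\<lambda>n. a (s / r n) * g (s / r n) ^ Suc n) \<longlonglongrightarrow> a 0 * of_real (exp (- (b * s ^ 2)))"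
        by (rule tendsto_mult)
      show "(\<lambda>n. F (Suc n) (s / r n)) \<longlonglongrightarrow> a 0 * of_real (exp (- (b * s ^ 2)))"
      proof (rule Lim_transform_eventually[OF lim])
        show "eventually (\<lambda>n. a (s / r n) * g (s / r n) ^ Suc n = F (Suc n) (s / r n)) sequentially"
          using mem by eventually_elim (simp add: F_def)
      qed
    qed
  qed
  moreover have "integral\<^sup>L lborel (\<lambda>s. a 0 * of_real (exp (- (b * s ^ 2)))) = a 0 * of_real (sqrt (pi / b))"
    using integrable_exp_neg_square[OF b] by simp
  ultimately show "(\<lambda>n. of_real (sqrt (real (Suc n))) * integral {-d..d} (\<lambda>t. a t * g t ^ Suc n))
      \<longlonglongrightarrow> a 0 * of_real (sqrt (pi / b))"
    unfolding F_eq by (simp only: r_def[symmetric] subst)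
qed

section \<open>Asymptotics of the number of tree interval posets\<close>

text \<open>This is \<open>u / \<psi>(u)\<close> with the common factor \<open>u\<close> cancelled.\<close>

definition phi :: "complex \<Rightarrow> complex" where
  "phi u = (1 - u) / ((1 - u) ^ 2 - u ^ 3)"

definition phi_fps :: "complex fps" where
  "phi_fps = (1 - fps_X) / ((1 - fps_X) ^ 2 - fps_X ^ 3)"

lemma has_fps_expansion_phi: "phi has_fps_expansion phi_fps"
  unfolding phi_def[abs_def] phi_fps_def power2_eq_square power3_eq_cube
  by (intro fps_expansion_intros) simp

lemma has_fps_expansion_power:
  fixes f :: "complex \<Rightarrow> complex"
  assumes "f has_fps_expansion F"
  shows "(\<lambda>u. f u ^ n) has_fps_expansion F ^ n"
  by (induction n) (use assms in \<open>auto intro: fps_expansion_intros\<close>)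

lemma tree_fps_0: "fps_nth tree_fps 0 = 0"
proof -
  have "trees 0 = {}" using leaves_pos by (auto simp: trees_def)
  then show ?thesis by (simp add: tree_fps_def)
qed

lemma tree_fps_fixpoint: "tree_fps = fps_X * (phi_fps oo tree_fps)"
proof -
  let ?T = "tree_fps :: complex fps"
  define D :: "complex fps" where "D = (1 - fps_X) ^ 2 - fps_X ^ 3"
  have D0: "fps_nth D 0 = 1" by (simp add: D_def power2_eq_square power3_eq_cube)
  have "phi_fps * D = 1 - fps_X"
    unfolding phi_fps_def D_def[symmetric] using D0 by (simp add: fps_divide_unit mult.assoc inverse_mult_eq_1)
  then have "(phi_fps * D) oo ?T = (1 - fps_X) oo ?T" by simp
  moreover define E where "E = (1 - ?T) ^ 2 - ?T ^ 3"
  moreover have "D oo ?T = E"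
    by (simp add: D_def E_def fps_compose_sub_distrib tree_fps_0 flip: fps_compose_power)
  ultimately have E: "(phi_fps oo ?T) * E = 1 - ?T"
    by (simp add: fps_compose_mult_distrib tree_fps_0 fps_compose_sub_distrib)
  have "?T * E = (1 - ?T) * (?T - ?T ^ 2) - ?T ^ 4"
    unfolding E_def by (simp add: algebra_simps power2_eq_square power3_eq_cube power4_eq_xxxx)
  also have "\<dots> = (1 - ?T) * (?T - ?T ^ 2) - (1 - ?T) * (?T - fps_X - ?T ^ 2)"
    by (simp only: tree_fps_eq)
  also have "\<dots> = fps_X * (1 - ?T)" by (simp add: algebra_simps)
  also have "\<dots> = fps_X * ((phi_fps oo ?T) * E)" by (simp only: E)
  finally have "?T * E = (fps_X * (phi_fps oo ?T)) * E" by (simp only: mult.assoc)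
  moreover have "fps_nth E 0 = 1" by (simp add: E_def power2_eq_square power3_eq_cube tree_fps_0)
  then have "E \<noteq> 0" by auto
  ultimately show ?thesis by (simp only: mult_cancel_right) simp
qed

lemma norm_cubic_le:
  fixes u :: complex
  assumes "norm u \<le> tau"
  shows "norm (u ^ 3 / (1 - u)) \<le> tau ^ 3 / (1 - tau)"
proof -
  have "1 - tau \<le> norm (1 - u)"
    using norm_triangle_ineq2[of 1 u] assms by simp
  then show ?thesis
    unfolding norm_divide norm_power using assms tau_bounds by (intro frac_le power_mono) auto
qed

lemma rho_factored: "rho = tau * (1 - tau - tau ^ 3 / (1 - tau))"
  unfolding rho_eq_psi psi_def by (simp add: algebra_simps power2_eq_square power3_eq_cube power4_eq_xxxx)

lemma psi_factored: "psi u = u * (1 - u - u ^ 3 / (1 - u))" for u :: complex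
  unfolding psi_def by (simp add: algebra_simps power2_eq_square power3_eq_cube power4_eq_xxxx)

lemma phi_altdef:
  assumes "u \<noteq> 1"
  shows "phi u = 1 / (1 - u - u ^ 3 / (1 - u))"
proof -
  have "(1 - u) ^ 2 - u ^ 3 = (1 - u) * (1 - u - u ^ 3 / (1 - u))"
    using assms by (simp add: right_diff_distrib power2_eq_square)
  then show ?thesis using assms by (simp add: phi_def)
qed

lemma phi_denominator_nonzero:
  fixes u :: complex
  assumes "norm u \<le> tau"
  shows "1 - u - u ^ 3 / (1 - u) \<noteq> 0" "(1 - u) ^ 2 - u ^ 3 \<noteq> 0" "u \<noteq> 1"
proof -
  show u1: "u \<noteq> 1" using assms tau_bounds by auto
  show nz: "1 - u - u ^ 3 / (1 - u) \<noteq> 0"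
  proof
    assume "1 - u - u ^ 3 / (1 - u) = 0"
    then have "1 = u + u ^ 3 / (1 - u)" by (simp add: algebra_simps)
    then have "1 \<le> norm u + norm (u ^ 3 / (1 - u))" by (metis norm_one norm_triangle_ineq)
    then have "1 - tau - tau ^ 3 / (1 - tau) \<le> 0" using assms norm_cubic_le[OF assms] by simp
    then have "rho \<le> 0" unfolding rho_factored using tau_bounds by (intro mult_nonneg_nonpos) auto
    then show False using rho_bounds by simp
  qed
  have "(1 - u) ^ 2 - u ^ 3 = (1 - u) * (1 - u - u ^ 3 / (1 - u))"
    using u1 by (simp add: right_diff_distrib power2_eq_square)
  then show "(1 - u) ^ 2 - u ^ 3 \<noteq> 0" using nz u1 by simp
qed

text \<open>On the circle \<open>|u| = \<tau>\<close> the modulus of \<open>\<psi>\<close> has a strict quadratic minimum \<open>\<rho>\<close> at \<open>\<tau>\<close>,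
  because \<open>\<Lambda>\<close> has nonnegative coefficients.\<close>

lemma norm_psi_circle_ge: "rho + tau ^ 2 * (1 - cos t) \<le> norm (psi (of_real tau * cis t))"
proof -
  define u where "u = of_real tau * cis t"
  have nu: "norm u = tau" using tau_bounds by (simp add: u_def norm_mult)
  have "1 - tau * cos t - tau ^ 3 / (1 - tau) \<le> Re (1 - u - u ^ 3 / (1 - u))"
    using abs_Re_le_cmod[of "u ^ 3 / (1 - u)"] norm_cubic_le[of u] nu by (simp add: u_def)
  also have "\<dots> \<le> norm (1 - u - u ^ 3 / (1 - u))" by (rule complex_Re_le_cmod)
  finally have "tau * (1 - tau * cos t - tau ^ 3 / (1 - tau)) \<le> tau * norm (1 - u - u ^ 3 / (1 - u))"
    using tau_bounds by (intro mult_left_mono) auto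
  also have "\<dots> = norm (psi u)" by (simp only: psi_factored norm_mult nu)
  finally have "tau * (1 - tau * cos t - tau ^ 3 / (1 - tau)) \<le> norm (psi u)" .
  moreover have "tau * (1 - tau * cos t - tau ^ 3 / (1 - tau)) = rho + tau ^ 2 * (1 - cos t)"
    unfolding rho_factored by (simp add: algebra_simps power2_eq_square)
  ultimately show ?thesis by (simp add: u_def)
qed

text \<open>Taylor's formula, with \<open>t\<^sup>2 \<le> 10\<close> to absorb the term of order 4.\<close>

lemma one_minus_cos_ge:
  fixes t :: real
  assumes "\<bar>t\<bar> \<le> pi"
  shows "t ^ 2 / 12 \<le> 1 - cos t"
proof -
  obtain s where s: "cos t = (\<Sum>m<4. cos_coeff m * t ^ m) + cos (s + 1 / 2 * real 4 * pi) / fact 4 * t ^ 4"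
    using Maclaurin_cos_expansion[of t 4] by blast
  have "(\<Sum>m<4. cos_coeff m * t ^ m) = 1 - t ^ 2 / 2"
  proof -
    have "(\<Sum>m<4. f m) = f 0 + f 1 + f 2 + f 3" for f :: "nat \<Rightarrow> real"
      by (simp add: eval_nat_numeral)
    then show ?thesis by (simp add: cos_coeff_def fact_numeral)
  qed
  moreover have "cos (s + 1 / 2 * real 4 * pi) / fact 4 * t ^ 4 \<le> 1 / fact 4 * t ^ 4"
    by (intro mult_right_mono divide_right_mono) auto
  ultimately have le: "cos t \<le> 1 - t ^ 2 / 2 + t ^ 4 / 24" using s by (simp add: fact_numeral)
  have "\<bar>t\<bar> ^ 2 \<le> 3.15 ^ 2" using assms pi_approx by (intro power_mono) auto
  then have "t ^ 2 \<le> 10" by (simp add: power2_eq_square)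
  then have "t ^ 2 * t ^ 2 \<le> 10 * t ^ 2" by (intro mult_right_mono) auto
  moreover have "t ^ 4 = t ^ 2 * t ^ 2" by simp
  ultimately show ?thesis using le by linarith
qed

text \<open>The constant 24 is twice the 12 of the preceding lemma: the factor 2 pays for the
  estimate \<open>1 / (1 + 2 * y) \<le> exp (- y)\<close> on \<open>[0, 1]\<close>.\<close>

lemma rho_over_psi_le:
  assumes "\<bar>t\<bar> \<le> pi"
  shows "norm (of_real rho / psi (of_real tau * cis t)) \<le> exp (- (tau ^ 2 / (24 * rho) * t ^ 2))"
proof -
  define y where "y = tau ^ 2 / (24 * rho) * t ^ 2"
  have "\<bar>t\<bar> ^ 2 \<le> 3.15 ^ 2" using assms pi_approx by (intro power_mono) auto
  then have t10: "t ^ 2 \<le> 10" by (simp add: power2_eq_square)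
  have "tau ^ 2 \<le> 0.4 ^ 2" using tau_bounds by (intro power_mono) auto
  then have "tau ^ 2 * t ^ 2 \<le> 0.16 * 10" using t10 by (intro mult_mono) (auto simp: power2_eq_square)
  then have y1: "0 \<le> y" "y \<le> 1" using rho_bounds by (auto simp: y_def field_simps)
  have "exp y \<le> 1 + y + y ^ 2" using exp_bound[OF y1] .
  also have "\<dots> \<le> 1 + 2 * y" using y1 by (simp add: power2_eq_square mult_left_le)
  finally have "rho * exp y \<le> rho * (1 + 2 * y)" using rho_bounds by (intro mult_left_mono) auto
  also have "\<dots> = rho + tau ^ 2 * (t ^ 2 / 12)" using rho_bounds by (simp add: y_def field_simps)
  also have "\<dots> \<le> rho + tau ^ 2 * (1 - cos t)"
    using one_minus_cos_ge[OF assms] by (intro add_left_mono mult_left_mono) auto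
  also have "\<dots> \<le> norm (psi (of_real tau * cis t))" by (rule norm_psi_circle_ge)
  finally have le: "rho * exp y \<le> norm (psi (of_real tau * cis t))" .
  have pos: "0 < rho * exp y" using rho_bounds by simp
  have npos: "0 < norm (psi (of_real tau * cis t))" using le pos by linarith
  have "rho / norm (psi (of_real tau * cis t)) \<le> rho / (rho * exp y)"
    by (intro divide_left_mono le mult_pos_pos[OF npos pos]) (use rho_bounds in simp)
  also have "\<dots> = exp (- y)" using rho_bounds by (simp add: exp_minus inverse_eq_divide)
  finally have "rho / norm (psi (of_real tau * cis t)) \<le> exp (- y)" .
  moreover have "\<bar>rho\<bar> = rho" using rho_bounds by simp
  ultimately show ?thesis by (simp only: norm_divide norm_of_real y_def)
qed

lemma psi_circle_nonzero: "psi (of_real tau * cis t) \<noteq> (0::complex)"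
proof -
  have "0 < rho + tau ^ 2 * (1 - cos t)" using rho_bounds by (intro add_pos_nonneg mult_nonneg_nonneg) auto
  then show ?thesis using norm_psi_circle_ge[of t] by auto
qed

lemma continuous_psi_circle: "continuous_on S (\<lambda>t. psi (of_real tau * cis t) :: complex)"
proof -
  have "of_real tau * cis t \<noteq> 1" for t
    using phi_denominator_nonzero(3)[of "of_real tau * cis t"] tau_bounds by (simp add: norm_mult)
  then show ?thesis
    unfolding psi_def cis_conv_exp by (intro continuous_intros) (auto simp: cis_conv_exp)
qed

text \<open>The quadratic term comes from \<open>\<rho> - \<psi>(u) = (u - \<tau>)\<^sup>2 * cofactor u\<close>
  at \<open>u = \<tau> * cis t\<close>, where \<open>(u - \<tau>) / t\<close> tends to \<open>\<i> * \<tau>\<close>.\<close>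

lemma rho_over_psi_expansion:
  "((\<lambda>t. (of_real rho / psi (of_real tau * cis t) - 1) / of_real (t ^ 2))
     \<longlongrightarrow> - of_real (tau ^ 2 * curv / rho)) (at 0)"
proof -
  have tau1: "of_real tau \<noteq> (1::complex)" using phi_denominator_nonzero(3)[of "of_real tau"] tau_bounds by simp
  have cis0: "(cis \<longlongrightarrow> 1) (at 0)"
  proof -
    have "((\<lambda>t. exp (\<i> * of_real t)) \<longlongrightarrow> exp (\<i> * of_real 0)) (at 0)" by (intro tendsto_intros)
    then show ?thesis by (simp add: cis_conv_exp[abs_def])
  qed
  have u_lim: "((\<lambda>t. of_real tau * cis t) \<longlongrightarrow> of_real tau) (at 0)"
    using tendsto_mult[OF tendsto_const cis0, of "of_real tau"] by simp
  have "((\<lambda>z. (exp z - 1) / z) \<longlongrightarrow> 1) (at (0::complex))"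
    using DERIV_exp[of "0::complex"] by (simp add: has_field_derivative_iff)
  moreover have "filterlim (\<lambda>t. \<i> * of_real t) (at 0) (at (0::real))"
  proof (rule filterlim_atI)
    have "((\<lambda>t. \<i> * of_real t) \<longlongrightarrow> \<i> * of_real 0) (at (0::real))" by (intro tendsto_intros)
    then show "((\<lambda>t. \<i> * of_real t) \<longlongrightarrow> 0) (at (0::real))" by simp
  qed (auto simp: eventually_at_filter)
  ultimately have "((\<lambda>t. (exp (\<i> * of_real t) - 1) / (\<i> * of_real t)) \<longlongrightarrow> 1) (at (0::real))"
    by (rule filterlim_compose)
  from tendsto_power[OF this, of 2]
  have e2: "((\<lambda>t. ((cis t - 1) / (\<i> * of_real t)) ^ 2) \<longlongrightarrow> 1) (at (0::real))"
    by (simp add: cis_conv_exp)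
  have psi_lim: "((\<lambda>t. psi (of_real tau * cis t)) \<longlongrightarrow> of_real rho) (at 0)"
  proof -
    have "((\<lambda>t. psi (of_real tau * cis t)) \<longlongrightarrow> psi (of_real tau)) (at 0)"
      unfolding psi_def using tau1 by (intro tendsto_intros u_lim) auto
    then show ?thesis by (simp add: rho_eq_psi psi_def)
  qed
  have cof_lim: "((\<lambda>t. cofactor (of_real tau * cis t)) \<longlongrightarrow> of_real curv) (at 0)"
    unfolding cofactor_tau[symmetric] cofactor_def using tau1 by (intro tendsto_intros u_lim) auto
  have rho0: "(of_real rho :: complex) \<noteq> 0" using rho_bounds by simp
  have "((\<lambda>t. - (of_real (tau ^ 2) * ((cis t - 1) / (\<i> * of_real t)) ^ 2 * cofactor (of_real tau * cis t)
      / psi (of_real tau * cis t))) \<longlongrightarrow> - (of_real (tau ^ 2) * 1 * of_real curv / of_real rho)) (at 0)"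
    by (intro tendsto_intros e2 psi_lim cof_lim rho0)
  moreover have "- (of_real (tau ^ 2) * ((cis t - 1) / (\<i> * of_real t)) ^ 2 * cofactor (of_real tau * cis t)
      / psi (of_real tau * cis t)) = (of_real rho / psi (of_real tau * cis t) - 1) / of_real (t ^ 2)"
    if "t \<noteq> 0" for t
  proof -
    define u where "u = of_real tau * cis t"
    have nz: "psi u \<noteq> 0" using psi_circle_nonzero by (simp add: u_def)
    have "u \<noteq> 1" using phi_denominator_nonzero(3)[of u] tau_bounds by (simp add: u_def norm_mult)
    then have "of_real rho - psi u = (u - of_real tau) ^ 2 * cofactor u" by (rule rho_minus_psi)
    moreover have "u - of_real tau = of_real tau * (cis t - 1)" by (simp add: u_def algebra_simps)
    moreover have "of_real rho / psi u - 1 = (of_real rho - psi u) / psi u"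
      using nz by (simp add: diff_divide_distrib)
    ultimately have "of_real rho / psi u - 1 = of_real tau ^ 2 * (cis t - 1) ^ 2 * cofactor u / psi u"
      by (simp only: power_mult_distrib)
    then show ?thesis using that by (simp add: u_def power_divide power_mult_distrib)
  qed
  then have "eventually (\<lambda>t. - (of_real (tau ^ 2) * ((cis t - 1) / (\<i> * of_real t)) ^ 2 * cofactor (of_real tau * cis t)
      / psi (of_real tau * cis t)) = (of_real rho / psi (of_real tau * cis t) - 1) / of_real (t ^ 2)) (at 0)"
    by (simp add: eventually_at_filter)
  ultimately have "((\<lambda>t. (of_real rho / psi (of_real tau * cis t) - 1) / of_real (t ^ 2))
     \<longlongrightarrow> - (of_real (tau ^ 2) * 1 * of_real curv / of_real rho)) (at 0)"
    by (rule Lim_transform_eventually)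
  then show ?thesis by simp
qed

lemma integral_over_period:
  fixes G :: "real \<Rightarrow> complex"
  assumes cont: "continuous_on UNIV G" and per: "\<And>t. G (2 * pi + t) = G t"
  shows "integral {0..2 * pi} G = integral {-pi..pi} G"
proof -
  have int: "G integrable_on {a..b}" for a b
    using cont by (intro integrable_continuous_interval) (rule continuous_on_subset, auto)
  have "integral {0..2 * pi} G = integral {0..pi} G + integral {pi..2 * pi} G"
    using Henstock_Kurzweil_Integration.integral_combine[OF _ _ int, of 0 pi "2 * pi"] by simp
  also have "integral {pi..2 * pi} G = integral {-pi..0} G"
    using integral_shift_Icc_real[of "-pi" 0 G "2 * pi"] per by (simp add: comp_def)
  also have "integral {0..pi} G + integral {-pi..0} G = integral {-pi..pi} G"
    using Henstock_Kurzweil_Integration.integral_combine[OF _ _ int, of "-pi" 0 pi]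
    by (simp add: add.commute)
  finally show ?thesis .
qed

text \<open>Lagrange inversion gives a coefficient of \<open>\<phi>\<^sup>n\<close>, and Cauchy's formula on the circle through
  \<open>\<tau>\<close>, which lies at the edge of where \<open>\<psi>\<close> is injective, turns it into an integral of \<open>1 / \<psi>\<^sup>n\<close>.\<close>

lemma card_trees_integral:
  assumes n: "0 < n"
  shows "of_nat n * of_nat (card (trees n)) =
    of_real (tau / (2 * pi)) * integral {-pi..pi} (\<lambda>t. cis t * (1 / psi (of_real tau * cis t)) ^ n)"
proof -
  let ?I = "integral {-pi..pi} (\<lambda>t. cis t * (1 / psi (of_real tau * cis t)) ^ n)"
  have tau0: "0 < tau" using tau_bounds by simp
  have "of_nat n * of_nat (card (trees n)) = fps_nth (phi_fps ^ n) (n - 1)"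
    using lagrange_inversion[OF tree_fps_fixpoint _ n] by (simp add: phi_fps_def tree_fps_def fps_divide_unit power2_eq_square power3_eq_cube)
  also have "\<dots> = (deriv ^^ (n - 1)) (\<lambda>u. phi u ^ n) 0 / fact (n - 1)"
    by (rule fps_nth_fps_expansion[OF has_fps_expansion_power[OF has_fps_expansion_phi]])
  also have "(deriv ^^ (n - 1)) (\<lambda>u. phi u ^ n) 0 =
      fact (n - 1) / (2 * pi * \<i>) * contour_integral (circlepath 0 tau) (\<lambda>u. phi u ^ n / (u - 0) ^ Suc (n - 1))"
  proof (rule Cauchy_higher_derivative_integral_circlepath(2))
    show "continuous_on (cball 0 tau) (\<lambda>u. phi u ^ n)"
      unfolding phi_def using phi_denominator_nonzero(2) by (intro continuous_intros) auto
    show "(\<lambda>u. phi u ^ n) holomorphic_on ball 0 tau"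
      unfolding phi_def using phi_denominator_nonzero(2) by (intro holomorphic_intros) auto
  qed (use tau0 in auto)
  also have "contour_integral (circlepath 0 tau) (\<lambda>u. phi u ^ n / (u - 0) ^ Suc (n - 1)) =
      integral {0..2 * pi} (\<lambda>t. of_real tau * \<i> * (cis t * (1 / psi (of_real tau * cis t)) ^ n))"
    unfolding circlepath_def
  proof (subst contour_integral_part_circlepath_eq)
    show "0 < 2 * pi" by simp
    show "integral {0..2 * pi} (\<lambda>t. phi (0 + of_real tau * cis t) ^ n / (0 + of_real tau * cis t - 0) ^ Suc (n - 1) * of_real tau * \<i> * cis t) =
      integral {0..2 * pi} (\<lambda>t. of_real tau * \<i> * (cis t * (1 / psi (of_real tau * cis t)) ^ n))"
    proof (rule integral_cong)
      fix t
      define u where "u = of_real tau * cis t"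
      have nu: "norm u \<le> tau" using tau0 by (simp add: u_def norm_mult)
      have "phi u ^ n / u ^ n = (phi u / u) ^ n" by (simp add: power_divide)
      also have "phi u / u = 1 / psi u"
        using phi_denominator_nonzero[OF nu] by (simp add: phi_altdef psi_factored)
      finally show "phi (0 + of_real tau * cis t) ^ n / (0 + of_real tau * cis t - 0) ^ Suc (n - 1) * of_real tau * \<i> * cis t =
          of_real tau * \<i> * (cis t * (1 / psi (of_real tau * cis t)) ^ n)"
        using n by (simp add: u_def)
    qed
  qed
  also have "\<dots> = of_real tau * \<i> * integral {0..2 * pi} (\<lambda>t. cis t * (1 / psi (of_real tau * cis t)) ^ n)"
    by (rule integral_mult_right)
  also have "integral {0..2 * pi} (\<lambda>t. cis t * (1 / psi (of_real tau * cis t)) ^ n) = ?I"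
  proof (rule integral_over_period)
    show "continuous_on UNIV (\<lambda>t. cis t * (1 / psi (of_real tau * cis t)) ^ n)"
      using psi_circle_nonzero by (intro continuous_intros continuous_psi_circle) auto
    have "cis (2 * pi + t) = cis t" for t by (simp flip: cis_mult)
    then show "cis (2 * pi + t) * (1 / psi (of_real tau * cis (2 * pi + t))) ^ n =
        cis t * (1 / psi (of_real tau * cis t)) ^ n" for t by simp
  qed
  finally show ?thesis by (simp add: field_simps)
qed

lemma card_trees_asymptotics:
  "(\<lambda>n. real (card (trees n)) * rho ^ n * (real n * sqrt (real n)))
     \<longlonglongrightarrow> sqrt (rho / (2 * pi * (deriv ^^ 2) Lam tau))"
proof -
  let ?g = "\<lambda>t. of_real rho / psi (of_real tau * cis t) :: complex"
  define b where "b = tau ^ 2 * curv / rho"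
  have pos: "0 < tau" "0 < rho" "0 < curv" using tau_bounds rho_bounds curv_bounds by auto
  then have b: "0 < b" by (simp add: b_def)
  have "(\<lambda>n. of_real (sqrt (real n)) * integral {-pi..pi} (\<lambda>t. cis t * ?g t ^ n))
      \<longlonglongrightarrow> cis 0 * of_real (sqrt (pi / b))"
  proof (rule laplace_method)
    show "continuous_on {-pi..pi} cis" unfolding cis_conv_exp by (intro continuous_intros)
    show "continuous_on {-pi..pi} ?g"
      using psi_circle_nonzero by (intro continuous_intros continuous_psi_circle) auto
    show "norm (?g t) \<le> exp (- (tau ^ 2 / (24 * rho) * t ^ 2))" if "\<bar>t\<bar> \<le> pi" for t
      by (rule rho_over_psi_le[OF that])
    show "((\<lambda>t. (?g t - 1) / of_real (t ^ 2)) \<longlongrightarrow> - of_real b) (at 0)"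
      using rho_over_psi_expansion by (simp only: b_def)
  qed (use b pos in auto)
  then have "(\<lambda>n. of_real (tau / (2 * pi)) * (of_real (sqrt (real n)) * integral {-pi..pi} (\<lambda>t. cis t * ?g t ^ n)))
      \<longlonglongrightarrow> of_real (tau / (2 * pi)) * (cis 0 * of_real (sqrt (pi / b)))"
    by (rule tendsto_mult[OF tendsto_const])
  moreover have "of_real (tau / (2 * pi)) * (of_real (sqrt (real n)) * integral {-pi..pi} (\<lambda>t. cis t * ?g t ^ n)) =
      of_real (real (card (trees n)) * rho ^ n * (real n * sqrt (real n)))" for n
  proof (cases "n = 0")
    case False
    have "integral {-pi..pi} (\<lambda>t. cis t * ?g t ^ n) =
        integral {-pi..pi} (\<lambda>t. of_real rho ^ n * (cis t * (1 / psi (of_real tau * cis t)) ^ n))"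
      by (rule integral_cong) (simp add: power_divide)
    also have "\<dots> = of_real rho ^ n * integral {-pi..pi} (\<lambda>t. cis t * (1 / psi (of_real tau * cis t)) ^ n)"
      by (rule integral_mult_right)
    finally have "of_real (tau / (2 * pi)) * (of_real (sqrt (real n)) * integral {-pi..pi} (\<lambda>t. cis t * ?g t ^ n)) =
        of_real (sqrt (real n)) * of_real rho ^ n * (of_real (tau / (2 * pi)) *
          integral {-pi..pi} (\<lambda>t. cis t * (1 / psi (of_real tau * cis t)) ^ n))" by (simp add: ac_simps)
    also have "\<dots> = of_real (sqrt (real n)) * of_real rho ^ n * (of_nat n * of_nat (card (trees n)))"
      using card_trees_integral[of n] False by simp
    finally show ?thesis by (simp add: ac_simps)
  qed simp
  moreover have "of_real (tau / (2 * pi)) * (cis 0 * of_real (sqrt (pi / b))) =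
      (of_real (sqrt (rho / (2 * pi * (deriv ^^ 2) Lam tau))) :: complex)"
  proof -
    have "tau / (2 * pi) * sqrt (pi / b) = sqrt ((tau / (2 * pi)) ^ 2 * (pi / b))"
      unfolding real_sqrt_mult real_sqrt_abs using pos by simp
    also have "(tau / (2 * pi)) ^ 2 * (pi / b) = rho / (2 * pi * (deriv ^^ 2) Lam tau)"
      using pos by (simp add: deriv2_Lam_tau b_def field_simps power2_eq_square)
    finally have "complex_of_real (tau / (2 * pi) * sqrt (pi / b)) =
        of_real (sqrt (rho / (2 * pi * (deriv ^^ 2) Lam tau)))" by (simp only:)
    then show ?thesis by (simp only: of_real_mult cis_zero mult_1_left)
  qed
  ultimately show ?thesis by (simp only: tendsto_of_real_iff)
qed

section \<open>The generating function near its dominant singularity\<close>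

text \<open>The asymptotics of the coefficients determine the limit of their ratios.\<close>

lemma fps_conv_radius_tree_fps: "fps_conv_radius (tree_fps :: complex fps) = ereal rho"
proof -
  define a where "a n = real (card (trees n)) * rho ^ n * (real n * sqrt (real n))" for n
  define C where "C = sqrt (rho / (2 * pi * (deriv ^^ 2) Lam tau))"
  have a: "a \<longlonglongrightarrow> C" unfolding a_def C_def by (rule card_trees_asymptotics)
  have pos: "0 < rho" "0 < curv" using rho_bounds curv_bounds by auto
  then have C: "0 < C" by (simp add: C_def deriv2_Lam_tau)
  have "(\<lambda>n. a n / a (Suc n)) \<longlonglongrightarrow> C / C"
    using a LIMSEQ_Suc[OF a] C by (intro tendsto_divide) auto
  moreover have "(\<lambda>n. rho * ((real (Suc n) * sqrt (real (Suc n))) / (real n * sqrt (real n)))) \<longlonglongrightarrow> rho * 1"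
  proof (intro tendsto_mult tendsto_const)
    show "(\<lambda>n. (real (Suc n) * sqrt (real (Suc n))) / (real n * sqrt (real n))) \<longlonglongrightarrow> 1"
      by real_asymp
  qed
  ultimately have "(\<lambda>n. a n / a (Suc n) * (rho * ((real (Suc n) * sqrt (real (Suc n))) / (real n * sqrt (real n)))))
      \<longlonglongrightarrow> C / C * (rho * 1)"
    by (rule tendsto_mult)
  then have "(\<lambda>n. norm (fps_nth (tree_fps :: complex fps) n) / norm (fps_nth (tree_fps :: complex fps) (Suc n)))
      \<longlonglongrightarrow> C / C * (rho * 1)"
  proof (rule Lim_transform_eventually)
    show "eventually (\<lambda>n. a n / a (Suc n) * (rho * ((real (Suc n) * sqrt (real (Suc n))) / (real n * sqrt (real n)))) =
        norm (fps_nth (tree_fps :: complex fps) n) / norm (fps_nth (tree_fps :: complex fps) (Suc n))) sequentially"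
      using eventually_gt_at_top[of 0]
    proof eventually_elim
      case (elim n)
      have "a n / a (Suc n) = real (card (trees n)) / real (card (trees (Suc n))) * (1 / rho) *
          ((real n * sqrt (real n)) / (real (Suc n) * sqrt (real (Suc n))))"
        using pos by (simp add: a_def del: of_nat_Suc)
      moreover have "real n * sqrt (real n) \<noteq> 0" "real (Suc n) * sqrt (real (Suc n)) \<noteq> 0" using elim by auto
      ultimately show ?case using pos by (simp add: tree_fps_def del: of_nat_Suc)
    qed
  qed
  then have "(\<lambda>n. norm (fps_nth (tree_fps :: complex fps) n) / norm (fps_nth (tree_fps :: complex fps) (Suc n)))
      \<longlonglongrightarrow> rho" using C by simp
  then show ?thesis
    unfolding fps_conv_radius_def using pos by (intro conv_radius_ratio_limit_nonzero[where c = rho]) auto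
qed

lemma card_trees_asymp_equiv:
  "(\<lambda>n. real (card (trees n))) \<sim>[sequentially]
     (\<lambda>n. sqrt (rho / (2 * pi * (deriv ^^ 2) Lam tau)) * (rho powr (- real n) / real n powr (3 / 2)))"
proof (rule asymp_equivI')
  define C where "C = sqrt (rho / (2 * pi * (deriv ^^ 2) Lam tau))"
  have pos: "0 < rho" "0 < curv" using rho_bounds curv_bounds by auto
  then have C: "0 < C" by (simp add: C_def deriv2_Lam_tau)
  have "(\<lambda>n. real (card (trees n)) * rho ^ n * (real n * sqrt (real n)) / C) \<longlonglongrightarrow> C / C"
    unfolding C_def[symmetric] using card_trees_asymptotics C
    by (intro tendsto_divide tendsto_const) (auto simp: C_def)
  then have "(\<lambda>n. real (card (trees n)) * rho ^ n * (real n * sqrt (real n)) / C) \<longlonglongrightarrow> 1"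
    using C by simp
  then show "(\<lambda>n. real (card (trees n)) /
      (sqrt (rho / (2 * pi * (deriv ^^ 2) Lam tau)) * (rho powr (- real n) / real n powr (3 / 2)))) \<longlonglongrightarrow> 1"
  proof (rule Lim_transform_eventually)
    show "eventually (\<lambda>n. real (card (trees n)) * rho ^ n * (real n * sqrt (real n)) / C =
        real (card (trees n)) /
      (sqrt (rho / (2 * pi * (deriv ^^ 2) Lam tau)) * (rho powr (- real n) / real n powr (3 / 2)))) sequentially"
      using eventually_gt_at_top[of 0]
    proof eventually_elim
      case (elim n)
      have "rho powr (- real n) = 1 / rho ^ n"
        using pos by (simp add: powr_minus powr_realpow inverse_eq_divide)
      moreover have "real n powr (3 / 2) = real n * sqrt (real n)"
      proof -
        have "real n powr (3 / 2) = real n powr (1 + 1 / 2)" by simp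
        also have "\<dots> = real n * sqrt (real n)" unfolding powr_add using elim by (simp add: powr_half_sqrt)
        finally show ?thesis .
      qed
      ultimately show ?case unfolding C_def[symmetric] using pos C elim by simp
    qed
  qed
qed

text \<open>Inside the disc of convergence the generating function inverts \<open>\<psi>\<close>.\<close>

lemma psi_eval_tree_fps:
  fixes z :: complex
  assumes z: "norm z < rho"
  shows "psi (eval_fps tree_fps z) = z"
proof -
  let ?T = "tree_fps :: complex fps"
  let ?R = "\<lambda>F :: complex fps. ereal (norm z) < fps_conv_radius F"
  have T: "?R ?T" using z by (simp add: fps_conv_radius_tree_fps)
  have diff: "?R (F - G)" if "?R F" "?R G" for F G
    using that by (intro less_le_trans[OF _ fps_conv_radius_diff]) simp
  have pow: "?R (F ^ n)" if "?R F" for F n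
    using that by (intro less_le_trans[OF _ fps_conv_radius_power])
  have R: "?R (1 - ?T)" "?R (?T - fps_X)" "?R (?T ^ 2)" "?R (?T - fps_X - ?T ^ 2)"
    using T by (auto intro!: diff pow)
  define t where "t = eval_fps ?T z"
  have "eval_fps ((1 - ?T) * (?T - fps_X - ?T ^ 2)) z = eval_fps (?T ^ 4) z"
    by (simp only: tree_fps_eq)
  then have eq: "(1 - t) * (t - z - t ^ 2) = t ^ 4"
    using T R by (simp add: eval_fps_mult eval_fps_diff eval_fps_power t_def)
  then have "t \<noteq> 1" by auto
  then have "t - z - t ^ 2 = t ^ 4 / (1 - t)" using eq by (simp add: field_simps)
  then show ?thesis unfolding psi_def t_def[symmetric] by (simp add: algebra_simps)
qed

text \<open>On the real segment \<open>T\<close> starts at 0 and cannot reach \<open>\<tau>\<close>, because \<open>\<psi>(\<tau>) = \<rho>\<close>.  This selects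
  the branch of the inverse of \<open>\<psi>\<close> that is continued near \<open>\<rho>\<close>.\<close>

lemma eval_tree_fps_real:
  fixes x :: real
  assumes x: "0 \<le> x" "x < rho"
  shows "\<exists>y. eval_fps tree_fps (of_real x) = (of_real y :: complex) \<and> 0 \<le> y \<and> y < tau \<and> psi y = x"
proof -
  have sums: "(\<lambda>n. fps_nth tree_fps n * of_real v ^ n) sums eval_fps tree_fps (of_real v :: complex)"
    if "0 \<le> v" "v < rho" for v :: real
    using that by (intro sums_eval_fps) (simp add: fps_conv_radius_tree_fps)
  have term_eq: "fps_nth tree_fps n * of_real v ^ n = (of_real (real (card (trees n)) * v ^ n) :: complex)" for n v
    by (simp add: tree_fps_def)
  define S where "S v = Re (eval_fps tree_fps (of_real v))" for v
  have real: "eval_fps tree_fps (of_real v) = (of_real (S v) :: complex)" and nonneg: "0 \<le> S v"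
    if v: "0 \<le> v" "v < rho" for v :: real
  proof -
    note s = sums[OF v, unfolded term_eq]
    have "(\<lambda>n. 0) sums Im (eval_fps tree_fps (of_real v))" using sums_Im[OF s] by simp
    then have "Im (eval_fps tree_fps (of_real v)) = 0" using sums_unique2 sums_zero by blast
    then show "eval_fps tree_fps (of_real v) = (of_real (S v) :: complex)" by (simp add: S_def complex_eq_iff)
    have "(\<lambda>n. real (card (trees n)) * v ^ n) sums S v" using sums_Re[OF s] by (simp add: S_def)
    then show "0 \<le> S v" by (rule sums_le[OF _ sums_zero, rotated]) (use v in auto)
  qed
  have psi_S: "psi (S v) = v" if v: "0 \<le> v" "v < rho" for v
  proof -
    have "psi (of_real (S v)) = (of_real v :: complex)"
      using psi_eval_tree_fps[of "of_real v"] real[OF v] v by simp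
    then have "of_real (psi (S v)) = (of_real v :: complex)" by (simp add: psi_def)
    then show ?thesis by (simp only: of_real_eq_iff)
  qed
  have "S x < tau"
  proof (rule ccontr)
    assume "\<not> S x < tau"
    have "continuous_on {0..x} S"
      unfolding S_def using x
      by (intro continuous_intros continuous_on_eval_fps') (auto simp: fps_conv_radius_tree_fps)
    moreover have "S 0 = 0" by (simp add: S_def eval_fps_at_0 tree_fps_0)
    ultimately obtain v where v: "0 \<le> v" "v \<le> x" "S v = tau"
      using IVT'[of S 0 tau x] \<open>\<not> S x < tau\<close> x tau_bounds by auto
    then have "psi tau = v" using psi_S[of v] x by simp
    then show False using v x rho_eq_psi by simp
  qed
  then show ?thesis using real[OF x] nonneg[OF x] psi_S[OF x] by blast
qed

text \<open>Since \<open>\<rho> - \<psi>\<close> has a double zero at \<open>\<tau>\<close> it has a holomorphic square root \<open>k\<close> there; the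
  inverse \<open>g\<close> of \<open>k\<close>, applied to a square root of \<open>\<rho> - z\<close>, will be the analytic continuation
  of \<open>T\<close>.\<close>

lemma inverse_of_sqrt_rho_minus_psi:
  obtains r e :: real and g :: "complex \<Rightarrow> complex" where "0 < r" "0 < e" "g holomorphic_on ball 0 e"
    "g 0 = of_real tau" "deriv g 0 = - of_real (1 / sqrt curv)"
    "\<And>y. \<bar>tau - y\<bar> < r \<Longrightarrow> 0 \<le> y \<Longrightarrow> y \<le> tau \<Longrightarrow> g (of_real (sqrt (rho - psi y))) = of_real y"
proof -
  define k :: "complex \<Rightarrow> complex" where "k u = (of_real tau - u) * csqrt (cofactor u)" for u
  have tau1: "of_real tau \<noteq> (1::complex)" using phi_denominator_nonzero(3)[of "of_real tau"] tau_bounds by simp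
  have curv: "0 < curv" using curv_bounds by simp
  have "isCont (cofactor :: complex \<Rightarrow> complex) (of_real tau)"
    unfolding cofactor_def using tau1 by (intro continuous_intros) auto
  then have "((cofactor :: complex \<Rightarrow> complex) \<longlongrightarrow> cofactor (of_real tau)) (nhds (of_real tau))"
    unfolding isCont_def tendsto_at_iff_tendsto_nhds .
  from tendsto_Re[OF this]
  have "((\<lambda>u::complex. Re (cofactor u)) \<longlongrightarrow> curv) (nhds (of_real tau))" by (simp add: cofactor_tau)
  then have "eventually (\<lambda>u::complex. 0 < Re (cofactor u)) (nhds (of_real tau))"
    using curv order_tendstoD(1) by blast
  moreover have "eventually (\<lambda>u::complex. u \<noteq> 1) (nhds (of_real tau))"
    using tau1 by (rule t1_space_nhds)
  ultimately have "eventually (\<lambda>u::complex. 0 < Re (cofactor u) \<and> u \<noteq> 1) (nhds (of_real tau))"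
    by (rule eventually_conj)
  then obtain d where d: "0 < d" "\<And>u::complex. dist u (of_real tau) < d \<Longrightarrow> 0 < Re (cofactor u) \<and> u \<noteq> 1"
    unfolding eventually_nhds_metric by blast
  let ?B = "ball (of_real tau :: complex) d"
  have k_hol: "k holomorphic_on ?B"
    unfolding k_def
  proof (intro holomorphic_intros)
    show "(cofactor :: complex \<Rightarrow> complex) holomorphic_on ?B"
      unfolding cofactor_def using d(2) tau1 by (intro holomorphic_intros) (auto simp: dist_commute)
    show "cofactor u \<notin> \<real>\<^sub>\<le>\<^sub>0" if "u \<in> ?B" for u :: complex
      using d(2)[of u] that by (auto simp: complex_nonpos_Reals_iff dist_commute)
  qed
  have csq: "csqrt (of_real curv) = of_real (sqrt curv)" using curv by simp
  have k_deriv: "deriv k (of_real tau) = - of_real (sqrt curv)"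
  proof -
    have "((\<lambda>u. (of_real tau - u) * csqrt (cofactor u)) has_field_derivative
       (0 - 1) * csqrt (cofactor (of_real tau)) + deriv (\<lambda>u. csqrt (cofactor u)) (of_real tau) * (of_real tau - of_real tau))
       (at (of_real tau))"
    proof (intro DERIV_mult DERIV_diff DERIV_const DERIV_ident)
      have "(\<lambda>u::complex. csqrt (cofactor u)) holomorphic_on ?B"
      proof (intro holomorphic_intros)
        show "(cofactor :: complex \<Rightarrow> complex) holomorphic_on ?B"
          unfolding cofactor_def using d(2) tau1 by (intro holomorphic_intros) (auto simp: dist_commute)
        show "cofactor u \<notin> \<real>\<^sub>\<le>\<^sub>0" if "u \<in> ?B" for u :: complex
          using d(2)[of u] that by (auto simp: complex_nonpos_Reals_iff dist_commute)
      qed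
      then show "((\<lambda>u. csqrt (cofactor u)) has_field_derivative deriv (\<lambda>u. csqrt (cofactor u)) (of_real tau)) (at (of_real tau))"
        by (rule holomorphic_derivI) (use d in auto)
    qed
    then have "(k has_field_derivative - of_real (sqrt curv)) (at (of_real tau))"
      by (simp add: k_def[abs_def] cofactor_tau csq)
    then show ?thesis by (rule DERIV_imp_deriv)
  qed
  obtain r where r: "0 < r" "ball (of_real tau) r \<subseteq> ?B" "inj_on k (ball (of_real tau) r)"
    using has_complex_derivative_locally_injective[OF k_hol, of "of_real tau"] d(1) k_deriv curv by auto
  let ?C = "ball (of_real tau :: complex) r"
  have k_hol': "k holomorphic_on ?C" using k_hol r(2) by (rule holomorphic_on_subset)
  obtain g where g: "g holomorphic_on (k ` ?C)" "\<And>u. u \<in> ?C \<Longrightarrow> deriv k u * deriv g (k u) = 1"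
      "\<And>u. u \<in> ?C \<Longrightarrow> g (k u) = u"
    using holomorphic_has_inverse[OF k_hol' open_ball r(3)] by metis
  have k0: "k (of_real tau) = 0" by (simp add: k_def)
  have "open (k ` ?C)" by (rule open_mapping_thm3[OF k_hol' open_ball r(3)])
  moreover have "0 \<in> k ` ?C" using k0 r(1) by (metis centre_in_ball image_eqI)
  ultimately obtain e where e: "0 < e" "ball 0 e \<subseteq> k ` ?C" by (rule openE)
  show ?thesis
  proof (rule that[of r e g])
    show "g holomorphic_on ball 0 e" using g(1) e(2) by (rule holomorphic_on_subset)
    show "g 0 = of_real tau" using g(3)[of "of_real tau"] k0 r(1) by simp
    have "- of_real (sqrt curv) * deriv g 0 = 1"
      using g(2)[of "of_real tau"] k0 k_deriv r(1) by simp
    then show "deriv g 0 = - of_real (1 / sqrt curv)"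
      using curv by (simp add: field_simps minus_equation_iff)
    fix y :: real assume y: "\<bar>tau - y\<bar> < r" "0 \<le> y" "y \<le> tau"
    have "y \<noteq> 1" using y tau_bounds by simp
    then have "rho - psi y = (y - tau) ^ 2 * cofactor y" using rho_minus_psi[of y] by simp
    then have "sqrt (rho - psi y) = (tau - y) * sqrt (cofactor y)"
      using y by (simp add: real_sqrt_mult)
    moreover have "k (of_real y) = of_real ((tau - y) * sqrt (cofactor y))"
    proof -
      have "cofactor (of_real y) = (of_real (cofactor y) :: complex)" by (simp add: cofactor_def)
      moreover have "0 \<le> cofactor y" using cofactor_ge_1[OF y(2,3)] by simp
      ultimately show ?thesis by (simp add: k_def)
    qed
    moreover have "of_real y \<in> ?C" using y(1) by (simp add: dist_of_real dist_real_def)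
    ultimately show "g (of_real (sqrt (rho - psi y))) = of_real y" using g(3)[of "of_real y"] by simp
  qed (use r e in auto)
qed

lemma holomorphic_quadratic_remainder:
  fixes g :: "complex \<Rightarrow> complex"
  assumes "g holomorphic_on ball 0 e" "0 < e"
  shows "\<exists>B. \<forall>w\<in>cball 0 (e / 2). norm (g w - (g 0 + deriv g 0 * w)) \<le> B * norm w ^ 2"
proof -
  let ?S = "cball (0::complex) (e / 2)"
  have sub: "?S \<subseteq> ball 0 e" using assms(2) by auto
  have hol: "(deriv ^^ i) g holomorphic_on ball 0 e" for i
    using assms(1) by (intro holomorphic_higher_deriv open_ball)
  have "continuous_on ?S ((deriv ^^ 2) g)"
    using holomorphic_on_imp_continuous_on[OF hol] sub by (rule continuous_on_subset)
  then have "bounded ((deriv ^^ 2) g ` ?S)"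
    by (intro compact_imp_bounded compact_continuous_image compact_cball)
  then obtain B where B: "\<And>w. w \<in> ?S \<Longrightarrow> norm ((deriv ^^ 2) g w) \<le> B"
    unfolding bounded_iff by blast
  have "norm (g w - (g 0 + deriv g 0 * w)) \<le> B * norm w ^ 2" if w: "w \<in> ?S" for w
  proof -
    have "norm ((deriv ^^ 0) g w - (\<Sum>i\<le>1. (deriv ^^ i) g 0 * (w - 0) ^ i / fact i))
        \<le> B * norm (w - 0) ^ Suc 1 / fact 1"
    proof (rule complex_Taylor[of ?S])
      show "((deriv ^^ i) g has_field_derivative (deriv ^^ Suc i) g x) (at x within ?S)" if "x \<in> ?S" for i x
        using holomorphic_derivI[OF hol open_ball, of x] that sub
        by (auto intro: has_field_derivative_at_within)
      show "norm ((deriv ^^ Suc 1) g x) \<le> B" if "x \<in> ?S" for x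
        using B[OF that] by (simp add: numeral_2_eq_2)
    qed (use w assms(2) in auto)
    then show ?thesis by (simp add: numeral_2_eq_2)
  qed
  then show ?thesis by blast
qed

lemma real_segment_islimpt:
  fixes a b c :: real
  assumes "a < c" "c < b"
  shows "(of_real c :: complex) islimpt of_real ` {a<..<b}"
  unfolding islimpt_approachable
proof (intro allI impI)
  fix e :: real assume "0 < e"
  define x where "x = c + min (e / 2) ((b - c) / 2)"
  have "x \<in> {a<..<b}" "x \<noteq> c" "\<bar>x - c\<bar> < e" using assms \<open>0 < e\<close> by (auto simp: x_def min_def field_simps)
  then show "\<exists>x'\<in>of_real ` {a<..<b}. x' \<noteq> (of_real c :: complex) \<and> dist x' (of_real c) < e"
    by (intro bexI[of _ "of_real x"]) (auto simp: dist_of_real dist_real_def)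
qed

text \<open>Here \<open>s z\<close> is the square root of \<open>\<rho> - z\<close> whose branch cut is the slit.  The functions \<open>g \<circ> s\<close>
  and \<open>T\<close> agree on a real segment to the left of \<open>\<rho>\<close>, hence wherever both are defined; the Taylor
  expansion of \<open>g\<close> to first order gives the claim, because \<open>(s z)\<^sup>2 = \<rho> - z\<close>.\<close>

lemma tree_gf_local_expansion:
  "\<exists>\<epsilon>>0. \<exists>F. F holomorphic_on slit_disc \<epsilon> \<and>
       (\<forall>z \<in> slit_disc \<epsilon> \<inter> ball 0 rho. F z = eval_fps tree_gf z) \<and>
       (\<lambda>z. F z - (of_real tau
               - of_real (sqrt (2 * rho / (deriv ^^ 2) Lam tau)) * csqrt (1 - z / of_real rho)))
         \<in> O[at (of_real rho) within slit_disc \<epsilon>](\<lambda>z. 1 - z / of_real rho)"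
proof -
  obtain r e and g :: "complex \<Rightarrow> complex" where r: "0 < r" and e: "0 < e"
    and g: "g holomorphic_on ball 0 e" "g 0 = of_real tau" "deriv g 0 = - of_real (1 / sqrt curv)"
    and g_inv: "\<And>y. \<bar>tau - y\<bar> < r \<Longrightarrow> 0 \<le> y \<Longrightarrow> y \<le> tau \<Longrightarrow> g (of_real (sqrt (rho - psi y))) = of_real y"
    using inverse_of_sqrt_rho_minus_psi by blast
  have rho: "0 < rho" and curv: "0 < curv" using rho_bounds curv_bounds by auto
  define s :: "complex \<Rightarrow> complex" where "s z = of_real (sqrt rho) * csqrt (1 - z / of_real rho)" for z
  define F where "F z = g (s z)" for z
  \<comment> \<open>Half the radius, so that \<open>s z\<close> stays in a closed disc where the remainder is bounded.\<close>
  define \<epsilon> where "\<epsilon> = (e / 2) ^ 2"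
  have \<epsilon>: "0 < \<epsilon>" using e by (simp add: \<epsilon>_def)
  have s2: "s z ^ 2 = of_real rho * (1 - z / of_real rho)" for z
  proof -
    have "s z ^ 2 = of_real (sqrt rho ^ 2) * csqrt (1 - z / of_real rho) ^ 2"
      by (simp only: s_def power_mult_distrib of_real_power)
    then show ?thesis using rho by simp
  qed
  have s_norm: "norm (s z) ^ 2 = rho * norm (1 - z / of_real rho)" for z
  proof -
    have "norm (s z) ^ 2 = norm (s z ^ 2)" by (simp only: norm_power)
    also have "\<dots> = rho * norm (1 - z / of_real rho)" unfolding s2 norm_mult using rho by simp
    finally show ?thesis .
  qed
  have s_le: "norm (s z) < e / 2" if "z \<in> ball (of_real rho) \<epsilon>" for z
  proof -
    have "norm (s z) ^ 2 = norm (of_real rho * (1 - z / of_real rho))"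
      unfolding s_norm norm_mult using rho by simp
    also have "of_real rho * (1 - z / of_real rho) = of_real rho - z" using rho by (simp add: right_diff_distrib)
    also have "norm (of_real rho - z) < \<epsilon>" using that by (simp add: dist_norm)
    finally have "norm (s z) ^ 2 < (e / 2) ^ 2" by (simp only: \<epsilon>_def)
    then show ?thesis by (rule power_less_imp_less_base) (use e in simp)
  qed
  have arg: "1 - z / of_real rho \<notin> \<real>\<^sub>\<le>\<^sub>0" if z: "z \<in> slit_disc \<epsilon>" for z
  proof
    assume "1 - z / of_real rho \<in> \<real>\<^sub>\<le>\<^sub>0"
    then obtain v where v: "1 - z / of_real rho = of_real v" "v \<le> 0"
      by (rule nonpos_Reals_cases)
    have "z = of_real rho * (1 - (1 - z / of_real rho))" using rho by simp
    then have "z = of_real rho * (1 - of_real v)" by (simp only: v(1))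
    then have "z = of_real (rho * (1 - v))" by simp
    moreover have "rho \<le> rho * (1 - v)" using v(2) rho by simp
    ultimately have "z \<in> of_real ` {rho..}" by blast
    then show False using z by (simp add: slit_disc_def)
  qed
  have s_hol: "s holomorphic_on slit_disc \<epsilon>"
    unfolding s_def[abs_def] using arg rho by (intro holomorphic_intros) auto
  have F_hol: "F holomorphic_on slit_disc \<epsilon>"
  proof -
    have "s ` slit_disc \<epsilon> \<subseteq> ball 0 e"
    proof
      fix w assume "w \<in> s ` slit_disc \<epsilon>"
      then obtain z where "z \<in> ball (of_real rho) \<epsilon>" "w = s z" by (auto simp: slit_disc_def)
      then show "w \<in> ball 0 e" using s_le[of z] e by simp
    qed
    then have "(g \<circ> s) holomorphic_on slit_disc \<epsilon>"
      by (rule holomorphic_on_compose_gen[OF s_hol g(1)])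
    then show ?thesis by (simp add: F_def[abs_def] comp_def)
  qed
  have F_eq: "F z = eval_fps tree_gf z" if z: "z \<in> slit_disc \<epsilon> \<inter> ball 0 rho" for z
  proof -
    let ?S = "ball (of_real rho) \<epsilon> \<inter> ball 0 rho :: complex set"
    have S: "?S = slit_disc \<epsilon> \<inter> ball 0 rho" by (auto simp: slit_disc_def norm_of_real)
    define m where "m = Min {r ^ 2, \<epsilon>, rho}"
    have m: "0 < m" "m \<le> r ^ 2" "m \<le> \<epsilon>" "m \<le> rho" using r \<epsilon> rho by (auto simp: m_def)
    define U where "U = (of_real ` {rho - m<..<rho} :: complex set)"
    have "F z - eval_fps tree_fps z = 0"
    proof (rule analytic_continuation[of "\<lambda>z. F z - eval_fps tree_fps z" ?S U "of_real (rho - m / 2)"])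
      show "(\<lambda>z. F z - eval_fps tree_fps z) holomorphic_on ?S"
      proof (intro holomorphic_intros)
        show "F holomorphic_on ?S" unfolding S using F_hol by (rule holomorphic_on_subset) auto
        show "?S \<subseteq> eball 0 (fps_conv_radius (tree_fps :: complex fps))" by (simp add: fps_conv_radius_tree_fps)
      qed
      show "connected ?S" by (intro convex_connected convex_Int convex_ball)
      show "U \<subseteq> ?S" using m by (auto simp: U_def dist_of_real dist_real_def)
      show "of_real (rho - m / 2) \<in> ?S" using m
        by (simp add: dist_of_real dist_real_def del: of_real_diff of_real_divide)
      show "of_real (rho - m / 2) islimpt U"
        unfolding U_def using m by (intro real_segment_islimpt) auto
      show "F w - eval_fps tree_fps w = 0" if w: "w \<in> U" for w
      proof -
        obtain x where x: "w = of_real x" "rho - m < x" "x < rho" using w by (auto simp: U_def)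
        then have x0: "0 \<le> x" using m by simp
        obtain y where y: "eval_fps tree_fps (of_real x) = (of_real y :: complex)" "0 \<le> y" "y < tau" "psi y = x"
          using eval_tree_fps_real[OF x0 x(3)] by blast
        \<comment> \<open>\<open>T x\<close> is close to \<open>\<tau>\<close> because \<open>(\<tau> - y)\<^sup>2 \<le> \<rho> - x\<close>.\<close>
        have "\<bar>tau - y\<bar> < r"
        proof -
          have "y \<noteq> 1" using y tau_bounds by simp
          then have "rho - x = (y - tau) ^ 2 * cofactor y" using rho_minus_psi[of y] y(4) by simp
          moreover have "(y - tau) ^ 2 * 1 \<le> (y - tau) ^ 2 * cofactor y"
            using cofactor_ge_1[of y] y by (intro mult_left_mono) auto
          ultimately have "(y - tau) ^ 2 < r ^ 2" using x m by linarith
          then have "\<bar>y - tau\<bar> < r" using r by (intro power2_less_imp_less[of "\<bar>y - tau\<bar>"]) auto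
          then show ?thesis by simp
        qed
        then have "g (of_real (sqrt (rho - x))) = of_real y" using g_inv[of y] y by simp
        moreover have "s (of_real x) = of_real (sqrt (rho - x))"
        proof -
          have "1 - of_real x / of_real rho = (of_real (1 - x / rho) :: complex)" by simp
          moreover have "0 \<le> 1 - x / rho" using x rho by simp
          ultimately have "s (of_real x) = of_real (sqrt rho * sqrt (1 - x / rho))"
            unfolding s_def by (simp only: of_real_sqrt of_real_mult)
          also have "sqrt rho * sqrt (1 - x / rho) = sqrt (rho - x)"
            using rho by (simp add: right_diff_distrib flip: real_sqrt_mult)
          finally show ?thesis .
        qed
        ultimately show ?thesis using y(1) x(1) by (simp add: F_def)
      qed
      show "open ?S" by (intro open_Int open_ball)
      show "z \<in> ?S" unfolding S by (rule z)
    qed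
    then show ?thesis by (simp add: tree_gf_eq_tree_fps)
  qed
  obtain B where B: "\<And>w. w \<in> cball 0 (e / 2) \<Longrightarrow> norm (g w - (g 0 + deriv g 0 * w)) \<le> B * norm w ^ 2"
    using holomorphic_quadratic_remainder[OF g(1) e] by blast
  have lin: "g 0 + deriv g 0 * s z =
      of_real tau - of_real (sqrt (2 * rho / (deriv ^^ 2) Lam tau)) * csqrt (1 - z / of_real rho)" for z
    by (simp add: g(2,3) s_def deriv2_Lam_tau real_sqrt_divide)
  have "(\<lambda>z. F z - (of_real tau
               - of_real (sqrt (2 * rho / (deriv ^^ 2) Lam tau)) * csqrt (1 - z / of_real rho)))
         \<in> O[at (of_real rho) within slit_disc \<epsilon>](\<lambda>z. 1 - z / of_real rho)"
  proof (rule bigoI[where c = "B * rho"])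
    have "norm (F z - (g 0 + deriv g 0 * s z)) \<le> B * rho * norm (1 - z / of_real rho)"
      if "z \<in> slit_disc \<epsilon>" for z
    proof -
      have "s z \<in> cball 0 (e / 2)" using s_le[of z] that by (simp add: slit_disc_def)
      then show ?thesis using B[of "s z"] by (simp add: F_def s_norm mult.assoc)
    qed
    then show "eventually (\<lambda>z. norm (F z - (of_real tau
               - of_real (sqrt (2 * rho / (deriv ^^ 2) Lam tau)) * csqrt (1 - z / of_real rho)))
        \<le> B * rho * norm (1 - z / of_real rho)) (at (of_real rho) within slit_disc \<epsilon>)"
      unfolding lin[symmetric] by (simp add: eventually_at_filter)
  qed
  then show ?thesis using \<epsilon> F_hol F_eq by blast
qed

theorem theorem23:
  shows "(\<exists>!u. u \<in> {0<..<1} \<and> deriv Lam u = 1) \<and>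
    fps_conv_radius tree_gf = ereal rho \<and>
    (\<exists>\<epsilon>>0. \<exists>F. F holomorphic_on slit_disc \<epsilon> \<and>
       (\<forall>z \<in> slit_disc \<epsilon> \<inter> ball 0 rho. F z = eval_fps tree_gf z) \<and>
       (\<lambda>z. F z - (of_real tau
               - of_real (sqrt (2 * rho / (deriv ^^ 2) Lam tau)) * csqrt (1 - z / of_real rho)))
         \<in> O[at (of_real rho) within slit_disc \<epsilon>](\<lambda>z. 1 - z / of_real rho)) \<and>
    \<bar>tau - 0.3501\<bar> \<le> 0.00005 \<and>
    \<bar>rho - 0.2044\<bar> \<le> 0.00005 \<and>
    \<bar>sqrt (2 * rho / (deriv ^^ 2) Lam tau) - 0.2808\<bar> \<le> 0.00005 \<and>
    (\<lambda>n. real (num_tree_posets n)) \<sim>[sequentially]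
      (\<lambda>n. sqrt (rho / (2 * pi * (deriv ^^ 2) Lam tau)) *
           (rho powr (- real n) / real n powr (3 / 2))) \<and>
    \<bar>sqrt (rho / (2 * pi * (deriv ^^ 2) Lam tau)) - 0.0792\<bar> \<le> 0.00005 \<and>
    \<bar>1 / rho - 4.8920\<bar> \<le> 0.00005"
proof (intro conjI)
  show "fps_conv_radius tree_gf = ereal rho"
    unfolding tree_gf_eq_tree_fps by (rule fps_conv_radius_tree_fps)
  show "(\<lambda>n. real (num_tree_posets n)) \<sim>[sequentially]
      (\<lambda>n. sqrt (rho / (2 * pi * (deriv ^^ 2) Lam tau)) *
           (rho powr (- real n) / real n powr (3 / 2)))"
    unfolding num_tree_posets_eq_card_trees by (rule card_trees_asymp_equiv)
qed (rule ex1_deriv_Lam_eq_1 tree_gf_local_expansion numerics)+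

end
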